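(* Let $R\ge 2$ and $$a(t)=b(t)\prod_{r=1}^R|t-t_r|^{-2\alpha_r}\varphi_{\beta_r,t_r}(t)\qquad(t\in\mathbb{T}),$$ where $t_1,\ldots,t_R$ are distinct points on $\mathbb{T}$, $\alpha_r,\beta_r$ are complex numbers with $0<\operatorname{Re}\alpha_r<1/2$ and $-1/2<\operatorname{Re}\beta_r\le 1/2$, $b\in L^\infty(\mathbb{T})$ is continuous at the points $t_1,\ldots,t_R$, and $b(t_r)\ne0$ for all $r$. Write $$a(t)=\sum_{r=1}^R|t-t_r|^{-2\alpha_r}\varphi_{\beta_r,t_r}(t)\,b_r(t)\qquad(t\in\mathbb{T})$$ with functions $b_r\in L^\infty(\mathbb{T})$ such that $b_r$ is continuous at $t_r$ and $b_r(t_r)\neq0$. Put $\rho=\max\{\operatorname{Re}\alpha_1,\ldots,\operatorname{Re}\alpha_R\}$ and $M=\{r:\operatorname{Re}\alpha_r=\rho\}$. If there is a $t_0\in\mathbb{T}$ such that, for every $r$, $t_r=e^{2\pi i\phi_r}t_0$ with a rational number $\phi_r$, then $$\|T_n(a)\|\sim\max_{r\in M}\|K_r\|\,|b_r(t_r)|\;n^{2\rho}\qquad\text{as } n\to\infty,$$ where $K_r$ is the integral operator on $L^2(0,1)$ whose kernel is $C_{\alpha_r,\beta_r}^{+}(x-y)^{2\alpha_r-1}$ for $x>y$ and $C_{\alpha_r,\beta_r}^{-}(y-x)^{2\alpha_r-1}$ for $x<y$, with $$C_{\alpha,\beta}^{\pm}=\Gamma(1-2\alpha)\,\frac{\sin\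pi(\alpha\mp\beta)}{\pi}.$$
   Context: $\mathbb{T}$ is the complex unit circle. $\varphi_{\beta,\tau}(t)=\exp\bigl(i\beta\arg(-t/\tau)\bigr)$ for $t,\tau\in\mathbb{T}$, with $\arg z\in(-\pi,\pi]$. For $a\in L^1(\mathbb{T})$, $T_n(a)=(a_{j-k})_{j,k=0}^{n-1}$ is the $n\times n$ Toeplitz matrix formed from the Fourier coefficients $a_k=\frac{1}{2\pi}\int_{-\pi}^{\pi}a(e^{i\theta})e^{-ik\theta}\,d\theta$. $\|T_n(a)\|$ is the spectral norm (operator norm on $\mathbb{C}^n$ with the Euclidean norm), and $\|K_r\|$ is the operator norm on $L^2(0,1)$. The notation $x_n\sim y_n$ means $x_n/y_n\to1$. For real $u>0$ and complex $\gamma$, $u^\gamma=\exp(\gamma\log u)$. A decomposition of $a$ with functions $b_r$ of the stated kind always exists, and the values $b_r(t_r)$ are determined by $a$: $b_r(t_r)=b(t_r)\prod_{j\ne r}|t_r-t_j|^{-2\alpha_j}\varphi_{\beta_j,t_j}(t_r)$. *)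

theory Defs
  imports "HOL-Analysis.Analysis" "Jordan_Normal_Form.Matrix"
begin

text \<open>
  Functions on the unit circle are represented by functions of type complex to complex, of which
  only the values on \<^term>\<open>sphere (0::complex) 1\<close> matter; the circle carries the Lebesgue measure of
  the parametrisation \<^const>\<open>cis\<close> on \<open>{-pi..pi}\<close>.
\<close>

definition circle_AE :: "(complex \<Rightarrow> bool) \<Rightarrow> bool" where
  "circle_AE P \<longleftrightarrow> (AE \<theta> in lebesgue_on {-pi..pi}. P (cis \<theta>))"

definition circle_Linf :: "(complex \<Rightarrow> complex) set" where
  "circle_Linf = {f. (\<lambda>\<theta>. f (cis \<theta>)) \<in> borel_measurable (lebesgue_on {-pi..pi}) \<and>
                     (\<exists>C. circle_AE (\<lambda>t. cmod (f t) \<le> C))}"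

definition fourier_coeff :: "(complex \<Rightarrow> complex) \<Rightarrow> int \<Rightarrow> complex" where
  "fourier_coeff a k =
     1 / (2 * of_real pi) * (LINT \<theta>|lebesgue_on {-pi..pi}. a (cis \<theta>) * cis (- (of_int k * \<theta>)))"

definition toeplitz :: "nat \<Rightarrow> (complex \<Rightarrow> complex) \<Rightarrow> complex mat" where
  "toeplitz n a = Matrix.mat n n (\<lambda>(j, k). fourier_coeff a (int j - int k))"

definition vec_l2_norm :: "complex Matrix.vec \<Rightarrow> real" where
  "vec_l2_norm v = L2_set (\<lambda>i. cmod (vec_index v i)) {..<dim_vec v}"

definition spectral_norm :: "complex mat \<Rightarrow> real" where
  "spectral_norm A = (SUP v \<in> {v \<in> carrier_vec (dim_col A). vec_l2_norm v \<le> 1}. vec_l2_norm (A *\<^sub>v v))"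

text \<open>
  The Fisher--Hartwig factors. \<^const>\<open>Arg\<close> takes its values in the half-open interval from
  \<open>-pi\<close> (excluded) to \<open>pi\<close> (included). For \<open>u > 0\<close>, \<open>of_real u powr z\<close> is \<open>exp (z * ln u)\<close>;
  at \<open>t = \<tau>\<close> the first factor is \<open>0\<close> by convention, which affects only a null set.
\<close>

definition phi :: "complex \<Rightarrow> complex \<Rightarrow> complex \<Rightarrow> complex" where
  "phi \<beta> \<tau> t = exp (\<i> * \<beta> * of_real (Arg (- t / \<tau>)))"

definition fh_factor :: "complex \<Rightarrow> complex \<Rightarrow> complex \<Rightarrow> complex \<Rightarrow> complex" where
  "fh_factor \<alpha> \<beta> \<tau> t = of_real (cmod (t - \<tau>)) powr (- 2 * \<alpha>) * phi \<beta> \<tau> t"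

definition C_plus :: "complex \<Rightarrow> complex \<Rightarrow> complex" where
  "C_plus \<alpha> \<beta> = Gamma (1 - 2 * \<alpha>) * (sin (of_real pi * (\<alpha> - \<beta>)) / of_real pi)"

definition C_minus :: "complex \<Rightarrow> complex \<Rightarrow> complex" where
  "C_minus \<alpha> \<beta> = Gamma (1 - 2 * \<alpha>) * (sin (of_real pi * (\<alpha> + \<beta>)) / of_real pi)"

definition fh_kernel :: "complex \<Rightarrow> complex \<Rightarrow> real \<Rightarrow> real \<Rightarrow> complex" where
  "fh_kernel \<alpha> \<beta> x y =
     (if x > y then C_plus \<alpha> \<beta> * of_real (x - y) powr (2 * \<alpha> - 1)
      else if x < y then C_minus \<alpha> \<beta> * of_real (y - x) powr (2 * \<alpha> - 1)
      else 0)"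

text \<open>Elements of \<open>L\<^sup>2(0,1)\<close> are represented by square-integrable functions.\<close>

definition L2_01 :: "(real \<Rightarrow> complex) set" where
  "L2_01 = {f \<in> borel_measurable (lebesgue_on {0<..<1}).
              integrable (lebesgue_on {0<..<1}) (\<lambda>x. (cmod (f x))\<^sup>2)}"

definition L2_01_norm :: "(real \<Rightarrow> complex) \<Rightarrow> real" where
  "L2_01_norm f = sqrt (LINT x|lebesgue_on {0<..<1}. (cmod (f x))\<^sup>2)"

definition integral_operator :: "(real \<Rightarrow> real \<Rightarrow> complex) \<Rightarrow> (real \<Rightarrow> complex) \<Rightarrow> real \<Rightarrow> complex" where
  "integral_operator k f x = (LINT y|lebesgue_on {0<..<1}. k x y * f y)"

text \<open>
  The operator norm on \<open>L\<^sup>2(0,1)\<close>. It is meaningful only for operators that map \<^const>\<open>L2_01\<close>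
  boundedly into itself; for the integral operators with kernel \<^const>\<open>fh_kernel\<close> and
  \<open>0 < Re \<alpha>\<close>, this holds by Schur's test, as \<open>\<bar>x - y\<bar> powr (2 * Re \<alpha> - 1)\<close> is integrable in
  each variable, uniformly in the other.
\<close>

definition L2_01_op_norm :: "((real \<Rightarrow> complex) \<Rightarrow> real \<Rightarrow> complex) \<Rightarrow> real" where
  "L2_01_op_norm K = (SUP f \<in> {f \<in> L2_01. L2_01_norm f \<le> 1}. L2_01_norm (K f))"

end

theory Submission imports Defs
begin

text \<open>
  Norms are handled through sesquilinear forms: \<open>form n A u v\<close> is the sum of
  \<open>A j k * u k * cnj (v j)\<close>, and the spectral norm is the best constant in
  \<open>\<bar>form n A u v\<bar> \<le> C * \<parallel>u\<parallel> * \<parallel>v\<parallel>\<close>. For a Toeplitz matrix the form is the integral of the symbol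
  against \<open>U * cnj V\<close>, where \<open>U\<close>, \<open>V\<close> are the trigonometric polynomials with coefficients \<open>u\<close>, \<open>v\<close>.

  Only the behaviour of the symbol at its strongest singularities matters. By
  \<open>\<bar>U\<bar> \<le> sqrt n * \<parallel>u\<parallel>\<close> at distance at most \<open>1/n\<close> from a point and by Parseval's identity elsewhere,
  a symbol that is dominated by \<open>\<epsilon> * \<bar>z - \<tau>\<bar> powr (- s) + C\<close> gives a form of size at most a constant
  times \<open>\<epsilon> * n powr s + C\<close> (\<open>singular_symbol_form_le\<close>). With \<open>s = 2 * \<rho>\<close>, one may therefore drop every summand
  with \<open>Re (\<alpha> r) < \<rho>\<close>, replace \<open>br r\<close> by its value at \<open>t r\<close>, and replace the factor
  \<open>fh_factor\<close> by any symbol with the same one-sided limits at \<open>t r\<close> after division by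
  \<open>\<bar>z - t r\<bar> powr (- 2 * \<alpha> r)\<close>. The choice made here is a linear combination of \<open>(1 - z / \<tau>) powr (- 2 * \<alpha>)\<close> and
  \<open>(1 - \<tau> / z) powr (- 2 * \<alpha>)\<close>: its Fourier coefficients are binomial coefficients, and Gauss's product together
  with the reflection formula for the Gamma function shows that they are asymptotic to
  \<open>C_plus * k powr (2 * \<alpha> - 1)\<close> at \<open>k\<close> and to \<open>C_minus * k powr (2 * \<alpha> - 1)\<close> at \<open>- k\<close> as \<open>k\<close> tends to infinity
  (\<open>model_coeff_asymp\<close>). These are the values of the kernel of \<open>K_r\<close> at integer points.

  The matrix of such coefficients is close to the compression of \<open>K_r\<close> to step functions. The kernel is homogeneous
  of degree \<open>2 * \<alpha> - 1\<close>, so scaling by \<open>n\<close> turns its cell averages into matrix entries, with an error of smaller order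
  than \<open>d powr (2 * Re \<alpha> - 1)\<close> at distance \<open>d\<close> from the diagonal; Schur's test sums these errors to
  \<open>o(n powr (2 * Re \<alpha>))\<close> (\<open>discretization\<close>). For several singularities the entries carry the phases
  \<open>t r powr (k - j)\<close>, and this is where the rational angles enter. They provide an \<open>N\<close> such that all \<open>(t r) ^ N\<close> agree.
  Cut the indices into blocks of length \<open>N\<close> and let the step functions be constant on blocks; the
  phases then enter only through the sums of \<open>t r ^ j * u j\<close> over a block. The vectors of phases that belong to distinct
  singularities are orthogonal characters, so by Bessel's inequality the step functions \<open>f r\<close> obtained from one vector \<open>u\<close> satisfy
  \<open>(\<Sum>r\<in>M. \<parallel>f r\<parallel>\<^sup>2) \<le> \<parallel>u\<parallel>\<^sup>2\<close>. Up to errors the form of \<open>T\<^sub>n(a)\<close> is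
  \<open>\<Sum>r\<in>M. br r (t r) * n powr (2 * \<alpha> r) * \<langle>K_r f r, g r\<rangle>\<close>, hence bounded by the maximum in the theorem times \<open>n powr (2 * \<rho>)\<close>; conversely, a
  vector \<open>u\<close> that cancels the phases of a single maximizing \<open>r\<close> makes all other \<open>f q\<close> vanish and the bound is attained in the limit.
  The argument treats sizes divisible by \<open>N\<close>; monotonicity of the spectral norm under enlarging the matrix gives the others.
\<close>

section \<open>Sesquilinear forms and the spectral norm\<close>

text \<open>The entries are given by a function of the indices rather than by a matrix, so that one function serves the matrices of all sizes \<open>n\<close>.\<close>

definition form :: "nat \<Rightarrow> (nat \<Rightarrow> nat \<Rightarrow> complex) \<Rightarrow> (nat \<Rightarrow> complex) \<Rightarrow> (nat \<Rightarrow> complex) \<Rightarrow> complex" where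
  "form n A u v = (\<Sum>j<n. \<Sum>k<n. A j k * u k * cnj (v j))"

definition l2 :: "nat \<Rightarrow> (nat \<Rightarrow> complex) \<Rightarrow> real" where
  "l2 n u = L2_set (\<lambda>i. cmod (u i)) {..<n}"

lemma l2_nonneg [simp]: "0 \<le> l2 n u"
  by (simp add: l2_def)

lemma l2_power2: "(l2 n u)\<^sup>2 = (\<Sum>i<n. (cmod (u i))\<^sup>2)"
  by (simp add: l2_def L2_set_def sum_nonneg)

lemma l2_scale: "l2 n (\<lambda>i. c * u i) = cmod c * l2 n u"
  by (simp add: l2_def norm_mult L2_set_right_distrib)

lemma l2_zero_form:
  assumes "l2 n u = 0" shows "form n A u v = 0"
  using assms by (simp add: l2_def L2_set_eq_0_iff form_def)

lemma vec_l2_norm_vec: "vec_l2_norm (Matrix.vec n u) = l2 n u"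
  by (auto simp: vec_l2_norm_def l2_def intro!: L2_set_cong)

lemma mat_vec_index:
  "i < n \<Longrightarrow> vec_index (Matrix.mat n n (\<lambda>(j, k). A j k) *\<^sub>v Matrix.vec n u) i = (\<Sum>k<n. A i k * u k)"
  by (simp add: scalar_prod_def lessThan_atLeast0)

lemma mat_vec_eq:
  "Matrix.mat n n (\<lambda>(j, k). A j k) *\<^sub>v Matrix.vec n u = Matrix.vec n (\<lambda>j. \<Sum>k<n. A j k * u k)"
  by (rule eq_vecI) (simp_all add: mat_vec_index del: index_mult_mat_vec)

lemma form_eq_inner: "form n A u v = (\<Sum>j<n. (\<Sum>k<n. A j k * u k) * cnj (v j))"
  by (simp add: form_def sum_distrib_right)

lemma sum_mult_cnj_le: "cmod (\<Sum>j<n. w j * cnj (v j)) \<le> l2 n w * l2 n v"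
proof -
  have "cmod (\<Sum>j<n. w j * cnj (v j)) \<le> (\<Sum>j<n. \<bar>cmod (w j)\<bar> * \<bar>cmod (v j)\<bar>)"
    by (rule order_trans[OF norm_sum]) (simp add: norm_mult)
  also have "\<dots> \<le> l2 n w * l2 n v"
    unfolding l2_def by (rule L2_set_mult_ineq)
  finally show ?thesis .
qed

lemma spectral_norm_eq:
  "spectral_norm (Matrix.mat n n (\<lambda>(j, k). A j k))
     = (SUP u \<in> {u. l2 n u \<le> 1}. l2 n (\<lambda>j. \<Sum>k<n. A j k * u k))"
proof -
  have "{v \<in> carrier_vec n. vec_l2_norm v \<le> 1} = Matrix.vec n ` {u. l2 n u \<le> 1}"
  proof (intro equalityI subsetI)
    fix v :: "complex Matrix.vec"
    assume v: "v \<in> {v \<in> carrier_vec n. vec_l2_norm v \<le> 1}"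
    then have "v = Matrix.vec n (\<lambda>i. vec_index v i)"
      by (intro eq_vecI) auto
    with v show "v \<in> Matrix.vec n ` {u. l2 n u \<le> 1}"
      by (metis (mono_tags, lifting) image_eqI mem_Collect_eq vec_l2_norm_vec)
  qed (auto simp: vec_l2_norm_vec)
  then show ?thesis
    by (simp add: spectral_norm_def image_image mat_vec_eq vec_l2_norm_vec)
qed

text \<open>Without this bound the supremum in the definition of the spectral norm would carry no information.\<close>

lemma bdd_above_mat_image:
  "bdd_above ((\<lambda>u. l2 n (\<lambda>j. \<Sum>k<n. A j k * u k)) ` {u. l2 n u \<le> 1})"
proof (rule bdd_aboveI2)
  fix u assume u: "u \<in> {u. l2 n u \<le> 1}"
  have u1: "cmod (u k) \<le> 1" if "k < n" for k
    using u member_le_L2_set[of "{..<n}" k "\<lambda>i. cmod (u i)"] that by (auto simp: l2_def)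
  have "l2 n (\<lambda>j. \<Sum>k<n. A j k * u k) \<le> (\<Sum>j<n. cmod (\<Sum>k<n. A j k * u k))"
    unfolding l2_def by (rule L2_set_le_sum) simp
  also have "\<dots> \<le> (\<Sum>j<n. \<Sum>k<n. cmod (A j k))"
    by (intro sum_mono order_trans[OF norm_sum]) (auto simp: norm_mult intro!: mult_left_le u1)
  finally show "l2 n (\<lambda>j. \<Sum>k<n. A j k * u k) \<le> (\<Sum>j<n. \<Sum>k<n. cmod (A j k))" .
qed

text \<open>Testing the form on \<open>u\<close> and \<open>v = A u\<close> gives \<open>\<parallel>A u\<parallel>\<^sup>2 \<le> C * \<parallel>u\<parallel> * \<parallel>A u\<parallel>\<close>.\<close>

lemma spectral_norm_leI:
  assumes "0 \<le> C" and "\<And>u v. cmod (form n A u v) \<le> C * l2 n u * l2 n v"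
  shows "spectral_norm (Matrix.mat n n (\<lambda>(j, k). A j k)) \<le> C"
  unfolding spectral_norm_eq
proof (rule cSUP_least)
  have "(\<lambda>_. 0) \<in> {u. l2 n u \<le> 1}" by (simp add: l2_def L2_set_def)
  then show "{u. l2 n u \<le> 1} \<noteq> {}" by blast
next
  fix u assume u: "u \<in> {u. l2 n u \<le> 1}"
  define w where "w = (\<lambda>j. \<Sum>k<n. A j k * u k)"
  have "(l2 n w)\<^sup>2 = cmod (form n A u w)"
  proof -
    have "form n A u w = of_real ((l2 n w)\<^sup>2)"
      unfolding form_eq_inner l2_power2 w_def[symmetric] of_real_sum
      by (intro sum.cong refl) (simp only: complex_norm_square w_def)
    then show ?thesis by (simp add: norm_power)
  qed
  also have "\<dots> \<le> C * l2 n u * l2 n w" by (rule assms)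
  also have "\<dots> \<le> C * 1 * l2 n w"
    using u assms(1) by (intro mult_right_mono mult_left_mono) auto
  finally have "l2 n w * l2 n w \<le> C * l2 n w" by (simp add: power2_eq_square)
  then have "l2 n w \<le> C"
    using assms(1) l2_nonneg[of n w] by (cases "l2 n w = 0") auto
  then show "l2 n (\<lambda>j. \<Sum>k<n. A j k * u k) \<le> C" by (simp add: w_def)
qed

lemma form_le_spectral_norm:
  "cmod (form n A u v) \<le> spectral_norm (Matrix.mat n n (\<lambda>(j, k). A j k)) * l2 n u * l2 n v"
proof (cases "l2 n u = 0")
  case True
  then show ?thesis by (simp add: l2_zero_form)
next
  case False
  then have pos: "l2 n u > 0" using l2_nonneg[of n u] by linarith
  define x where "x = (\<lambda>i. of_real (1 / l2 n u) * u i)"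
  have x1: "l2 n x = 1" unfolding x_def l2_scale using pos by (simp add: norm_divide)
  have ux: "u = (\<lambda>i. of_real (l2 n u) * x i)" using pos by (auto simp: x_def)
  have "(\<lambda>j. \<Sum>k<n. A j k * u k) = (\<lambda>j. of_real (l2 n u) * (\<Sum>k<n. A j k * x k))"
    by (subst ux) (simp add: sum_distrib_left mult_ac)
  then have "l2 n (\<lambda>j. \<Sum>k<n. A j k * u k) = l2 n u * l2 n (\<lambda>j. \<Sum>k<n. A j k * x k)"
    by (simp add: l2_scale)
  also have "\<dots> \<le> l2 n u * spectral_norm (Matrix.mat n n (\<lambda>(j, k). A j k))"
    unfolding spectral_norm_eq
    by (intro mult_left_mono cSUP_upper bdd_above_mat_image) (auto simp: x1)
  finally have le: "l2 n (\<lambda>j. \<Sum>k<n. A j k * u k)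
      \<le> l2 n u * spectral_norm (Matrix.mat n n (\<lambda>(j, k). A j k))" .
  have "cmod (form n A u v) \<le> l2 n (\<lambda>j. \<Sum>k<n. A j k * u k) * l2 n v"
    unfolding form_eq_inner by (rule sum_mult_cnj_le)
  also have "\<dots> \<le> l2 n u * spectral_norm (Matrix.mat n n (\<lambda>(j, k). A j k)) * l2 n v"
    by (intro mult_right_mono le) simp
  finally show ?thesis by (simp add: mult_ac)
qed

lemma spectral_norm_nonneg: "0 \<le> spectral_norm (Matrix.mat n n (\<lambda>(j, k). A j k))"
proof -
  have z: "(\<lambda>_. 0) \<in> {u. l2 n u \<le> 1}" by (simp add: l2_def L2_set_def)
  have "0 \<le> l2 n (\<lambda>j. \<Sum>k<n. A j k * (\<lambda>_. 0) k)" by simp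
  also have "\<dots> \<le> spectral_norm (Matrix.mat n n (\<lambda>(j, k). A j k))"
    unfolding spectral_norm_eq by (rule cSUP_upper[OF z bdd_above_mat_image])
  finally show ?thesis .
qed

text \<open>The smaller matrix is a corner of the larger one: extend the test vectors by zero.\<close>

lemma spectral_norm_mono:
  assumes "n \<le> n'"
  shows "spectral_norm (Matrix.mat n n (\<lambda>(j, k). A j k))
    \<le> spectral_norm (Matrix.mat n' n' (\<lambda>(j, k). A j k))"
proof (rule spectral_norm_leI[OF spectral_norm_nonneg])
  fix u v
  define cut where "cut = (\<lambda>(u :: nat \<Rightarrow> complex) i. if i < n then u i else 0)"
  have cut_sum: "(\<Sum>k<n'. g k (cut u k)) = (\<Sum>k<n. g k (u k))" if "\<And>k. g k 0 = 0"
    for g :: "nat \<Rightarrow> complex \<Rightarrow> 'b::comm_monoid_add" and u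
  proof -
    have "(\<Sum>k<n'. g k (cut u k)) = (\<Sum>k<n. g k (cut u k))"
      by (rule sum.mono_neutral_right) (use assms that in \<open>auto simp: cut_def\<close>)
    also have "\<dots> = (\<Sum>k<n. g k (u k))" by (rule sum.cong) (auto simp: cut_def)
    finally show ?thesis .
  qed
  have l2_cut: "l2 n' (cut u) = l2 n u" for u
    unfolding l2_def L2_set_def using cut_sum[of "\<lambda>_ z. (cmod z)\<^sup>2" u] by simp
  have "form n' A (cut u) (cut v) = form n A u v"
    unfolding form_eq_inner
    using cut_sum[of "\<lambda>j z. (\<Sum>k<n'. A j k * cut u k) * cnj z" v] cut_sum[of "\<lambda>k z. A j k * z" u for j]
    by simp
  then show "cmod (form n A u v) \<le> spectral_norm (Matrix.mat n' n' (\<lambda>(j, k). A j k)) * l2 n u * l2 n v"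
    using form_le_spectral_norm[of n' A "cut u" "cut v"] by (simp add: l2_cut)
qed

lemma form_diff: "form n (\<lambda>j k. A j k - B j k) u v = form n A u v - form n B u v"
  by (simp add: form_def algebra_simps sum_subtractf)

lemma form_add: "form n (\<lambda>j k. A j k + B j k) u v = form n A u v + form n B u v"
  by (simp add: form_def algebra_simps sum.distrib)

lemma form_sum: "form n (\<lambda>j k. \<Sum>r\<in>S. A r j k) u v = (\<Sum>r\<in>S. form n (A r) u v)"
  unfolding form_def sum_distrib_right
  by (simp only: sum.swap[of _ S])

lemma form_cmult: "form n (\<lambda>j k. c * A j k) u v = c * form n A u v"
  by (simp add: form_def sum_distrib_left mult.assoc)

lemma row_sum_le:
  fixes e :: "nat \<Rightarrow> real"
  assumes "\<And>d. 0 \<le> e d" "j < n"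
  shows "(\<Sum>k<n. e (nat \<bar>int j - int k\<bar>)) \<le> 2 * (\<Sum>d<n. e d)"
proof -
  have "(\<Sum>k<n. e (nat \<bar>int j - int k\<bar>))
      = (\<Sum>k\<in>{..j}. e (nat \<bar>int j - int k\<bar>)) + (\<Sum>k\<in>{Suc j..<n}. e (nat \<bar>int j - int k\<bar>))"
    using assms by (subst sum.union_disjoint[symmetric]) (auto intro!: sum.cong)
  also have "(\<Sum>k\<in>{..j}. e (nat \<bar>int j - int k\<bar>)) = (\<Sum>d\<in>{..j}. e d)"
    by (rule sum.reindex_bij_witness[of _ "\<lambda>d. j - d" "\<lambda>k. j - k"]) (auto intro!: arg_cong[of _ _ e])
  also have "\<dots> \<le> (\<Sum>d<n. e d)" using assms by (intro sum_mono2) auto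
  also have "(\<Sum>k\<in>{Suc j..<n}. e (nat \<bar>int j - int k\<bar>)) = (\<Sum>d\<in>{1..<n - j}. e d)"
    by (rule sum.reindex_bij_witness[of _ "\<lambda>d. j + d" "\<lambda>k. k - j"]) (auto intro!: arg_cong[of _ _ e])
  also have "\<dots> \<le> (\<Sum>d<n. e d)" using assms by (intro sum_mono2) auto
  finally show ?thesis by simp
qed

text \<open>Schur's test. Write each weight as a product of two square roots and apply the Cauchy--Schwarz inequality to the sum over
  index pairs; what remains are row and column sums of the weights.\<close>

lemma form_schur:
  fixes e :: "nat \<Rightarrow> real"
  assumes e: "\<And>d. 0 \<le> e d" and A: "\<And>j k. j < n \<Longrightarrow> k < n \<Longrightarrow> cmod (A j k) \<le> e (nat \<bar>int j - int k\<bar>)"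
  shows "cmod (form n A u v) \<le> 2 * (\<Sum>d<n. e d) * l2 n u * l2 n v"
proof -
  let ?e = "\<lambda>j k. e (nat \<bar>int j - int k\<bar>)"
  let ?S = "2 * (\<Sum>d<n. e d)"
  let ?I = "{..<n} \<times> {..<n}"
  have S0: "0 \<le> ?S" using e by (simp add: sum_nonneg)
  have fin: "L2_set (\<lambda>(j, k). sqrt (?e j k) * cmod (u k)) ?I \<le> sqrt ?S * l2 n u"
  proof -
    have "(\<Sum>(j,k)\<in>?I. (sqrt (?e j k) * cmod (u k))\<^sup>2) = (\<Sum>k<n. \<Sum>j<n. ?e j k * (cmod (u k))\<^sup>2)"
      unfolding sum.cartesian_product[symmetric]
      by (subst sum.swap) (simp add: power_mult_distrib e)
    also have "\<dots> = (\<Sum>k<n. (\<Sum>j<n. ?e k j) * (cmod (u k))\<^sup>2)"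
      by (simp add: sum_distrib_right abs_minus_commute)
    also have "\<dots> \<le> (\<Sum>k<n. ?S * (cmod (u k))\<^sup>2)"
      by (intro sum_mono mult_right_mono row_sum_le e) auto
    also have "\<dots> = ?S * (l2 n u)\<^sup>2" by (simp add: l2_power2 sum_distrib_left)
    finally show ?thesis
      unfolding L2_set_def
      by (intro real_le_lsqrt) (auto simp: power_mult_distrib S0 sum_nonneg case_prod_unfold e)
  qed
  have fin': "L2_set (\<lambda>(j, k). sqrt (?e j k) * cmod (v j)) ?I \<le> sqrt ?S * l2 n v"
  proof -
    have "(\<Sum>(j,k)\<in>?I. (sqrt (?e j k) * cmod (v j))\<^sup>2) = (\<Sum>j<n. \<Sum>k<n. ?e j k * (cmod (v j))\<^sup>2)"
      by (simp add: sum.cartesian_product[symmetric] power_mult_distrib e)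
    also have "\<dots> = (\<Sum>j<n. (\<Sum>k<n. ?e j k) * (cmod (v j))\<^sup>2)"
      by (simp add: sum_distrib_right)
    also have "\<dots> \<le> (\<Sum>k<n. ?S * (cmod (v k))\<^sup>2)"
      by (intro sum_mono mult_right_mono row_sum_le e) auto
    also have "\<dots> = ?S * (l2 n v)\<^sup>2" by (simp add: l2_power2 sum_distrib_left)
    finally show ?thesis
      unfolding L2_set_def
      by (intro real_le_lsqrt) (auto simp: power_mult_distrib S0 sum_nonneg case_prod_unfold e)
  qed
  have "cmod (form n A u v) \<le> (\<Sum>j<n. \<Sum>k<n. cmod (A j k) * cmod (u k) * cmod (v j))"
    unfolding form_def by (intro order_trans[OF norm_sum] sum_mono) (auto simp: norm_mult)
  also have "\<dots> \<le> (\<Sum>j<n. \<Sum>k<n. ?e j k * cmod (u k) * cmod (v j))"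
    by (intro sum_mono mult_right_mono A) auto
  also have "\<dots> = (\<Sum>x\<in>?I. \<bar>(\<lambda>(j,k). sqrt (?e j k) * cmod (u k)) x\<bar> * \<bar>(\<lambda>(j,k). sqrt (?e j k) * cmod (v j)) x\<bar>)"
    unfolding sum.cartesian_product
    by (rule sum.cong) (auto simp: abs_mult e mult_ac)
  also have "\<dots> \<le> (sqrt ?S * l2 n u) * (sqrt ?S * l2 n v)"
    by (rule order_trans[OF L2_set_mult_ineq]) (intro mult_mono fin fin' mult_nonneg_nonneg; simp add: S0)
  also have "\<dots> = ?S * l2 n u * l2 n v"
    using S0 by (simp add: real_sqrt_mult_self mult_ac flip: real_sqrt_mult)
  finally show ?thesis .
qed

lemma unit_power_sum_zero:
  fixes z w :: complex
  assumes "cmod z = 1" "cmod w = 1" "z \<noteq> w" "(z / w) ^ N = 1"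
  shows "(\<Sum>s<N. z ^ (a + s) * cnj (w ^ (a + s))) = 0"
proof -
  have w: "w \<noteq> 0" using assms by auto
  have c: "cnj w = 1 / w"
    using complex_norm_square[of w] assms w by (simp add: field_simps)
  have "(\<Sum>s<N. z ^ (a + s) * cnj (w ^ (a + s))) = (\<Sum>s<N. (z / w) ^ a * (z / w) ^ s)"
    using w by (simp add: c power_add power_divide field_simps)
  also have "\<dots> = (z / w) ^ a * (\<Sum>s<N. (z / w) ^ s)" by (simp add: sum_distrib_left)
  also have "(\<Sum>s<N. (z / w) ^ s) = 0"
    using assms w by (simp add: sum_gp_strict)
  finally show ?thesis by simp
qed

lemma unit_power_sum_eq:
  fixes z :: complex
  assumes "cmod z = 1"
  shows "(\<Sum>s<N. z ^ (a + s) * cnj (z ^ (a + s))) = of_nat N"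
proof -
  have "z ^ (a + s) * cnj (z ^ (a + s)) = 1" for s
    unfolding complex_norm_square[symmetric] by (simp add: norm_power assms)
  then show ?thesis by simp
qed

text \<open>The vectors \<open>(z r ^ (a + s))\<close>, \<open>s < N\<close>, have squared length \<open>N\<close> and are pairwise orthogonal, because
  \<open>z r / z q\<close> is an \<open>N\<close>-th root of unity different from \<open>1\<close>. Bessel's inequality follows from the Cauchy--Schwarz inequality for \<open>u\<close>
  and the combination \<open>p\<close> of these vectors whose coefficients are the inner products with \<open>u\<close>.\<close>

lemma bessel_characters:
  fixes z :: "'i \<Rightarrow> complex"
  assumes fin: "finite S" and z1: "\<And>r. r \<in> S \<Longrightarrow> cmod (z r) = 1" and inj: "inj_on z S"
    and root: "\<And>r q. r \<in> S \<Longrightarrow> q \<in> S \<Longrightarrow> (z r / z q) ^ N = 1"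
  shows "(\<Sum>r\<in>S. (cmod (\<Sum>s<N. z r ^ (a + s) * u s))\<^sup>2) \<le> real N * (\<Sum>s<N. (cmod (u s))\<^sup>2)"
proof -
  define h where "h = (\<lambda>r. \<Sum>s<N. z r ^ (a + s) * u s)"
  define T where "T = (\<Sum>r\<in>S. (cmod (h r))\<^sup>2)"
  define p where "p = (\<lambda>s. \<Sum>r\<in>S. h r * cnj (z r ^ (a + s)))"
  have T0: "0 \<le> T" by (simp add: T_def sum_nonneg)
  have Tp: "complex_of_real T = (\<Sum>s<N. u s * cnj (p s))"
  proof -
    have "complex_of_real T = (\<Sum>r\<in>S. h r * cnj (h r))"
      by (simp only: T_def of_real_sum complex_norm_square)
    also have "\<dots> = (\<Sum>r\<in>S. \<Sum>s<N. z r ^ (a + s) * u s * cnj (h r))"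
      by (simp add: h_def sum_distrib_right)
    also have "\<dots> = (\<Sum>s<N. \<Sum>r\<in>S. z r ^ (a + s) * u s * cnj (h r))" by (rule sum.swap)
    also have "\<dots> = (\<Sum>s<N. u s * cnj (p s))"
      by (simp add: p_def sum_distrib_left mult_ac)
    finally show ?thesis .
  qed
  have pN: "(l2 N p)\<^sup>2 = real N * T"
  proof -
    have "complex_of_real ((l2 N p)\<^sup>2) = (\<Sum>s<N. p s * cnj (p s))"
      by (simp only: l2_power2 of_real_sum complex_norm_square)
    also have "\<dots> = (\<Sum>s<N. \<Sum>q\<in>S. \<Sum>r\<in>S. h r * cnj (h q) * (z q ^ (a + s) * cnj (z r ^ (a + s))))"
      by (simp add: p_def sum_distrib_left sum_distrib_right mult_ac)
    also have "\<dots> = (\<Sum>q\<in>S. \<Sum>r\<in>S. \<Sum>s<N. h r * cnj (h q) * (z q ^ (a + s) * cnj (z r ^ (a + s))))"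
      by (subst sum.swap) (intro sum.cong refl sum.swap)
    also have "\<dots> = (\<Sum>q\<in>S. \<Sum>r\<in>S. h r * cnj (h q) * (if q = r then of_nat N else 0))"
    proof (intro sum.cong refl)
      fix q r assume "q \<in> S" "r \<in> S"
      then show "(\<Sum>s<N. h r * cnj (h q) * (z q ^ (a + s) * cnj (z r ^ (a + s))))
          = h r * cnj (h q) * (if q = r then of_nat N else 0)"
        unfolding sum_distrib_left[symmetric]
        using unit_power_sum_eq[OF z1, of q a N] unit_power_sum_zero[OF z1 z1 _ root, of q r a] inj
        by (cases "q = r") (auto simp: inj_on_def)
    qed
    also have "\<dots> = (\<Sum>q\<in>S. of_nat N * (h q * cnj (h q)))"
      using fin by (intro sum.cong refl) (simp add: if_distrib[of "\<lambda>x. _ * x"] sum.delta cong: if_cong)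
    also have "\<dots> = complex_of_real (real N * T)"
      by (simp only: T_def of_real_mult of_real_sum complex_norm_square sum_distrib_left of_real_of_nat_eq)
    finally show ?thesis using of_real_eq_iff by blast
  qed
  have "T = cmod (complex_of_real T)" using T0 by simp
  also have "\<dots> \<le> l2 N u * l2 N p" unfolding Tp by (rule sum_mult_cnj_le)
  finally have "T\<^sup>2 \<le> (l2 N u * l2 N p)\<^sup>2" using T0 by (intro power_mono)
  also have "(l2 N u * l2 N p)\<^sup>2 = (l2 N u)\<^sup>2 * (real N * T)"
    by (simp only: power_mult_distrib pN)
  finally have "T * T \<le> (real N * (l2 N u)\<^sup>2) * T"
    by (simp only: power2_eq_square mult_ac)
  then have "T \<le> real N * (l2 N u)\<^sup>2"
    using T0 by (cases "T = 0") auto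
  then show ?thesis by (simp add: T_def h_def l2_power2)
qed

section \<open>Toeplitz forms of singular symbols\<close>

lemma nn_integral_powr_interval:
  fixes s h p :: real
  assumes "0 < s" "s < 1" "0 \<le> h"
  shows "(\<integral>\<^sup>+x. ennreal (\<bar>x - p\<bar> powr (-s)) * indicator {p-h..p+h} x \<partial>lborel)
           \<le> ennreal (2 * h powr (1 - s) / (1 - s))"
proof -
  define g where "g = (\<lambda>x. ennreal (x powr (-s)) * indicator {0..h} x)"
  have [measurable]: "g \<in> borel_measurable borel" by (simp add: g_def)
  have g: "integral\<^sup>N lborel g = ennreal (h powr (1 - s) / (1 - s))"
    using nn_integral_has_integral_lebesgue'[OF _ has_integral_powr_from_0[of "-s" h]] assms
    by (simp add: g_def)
  have "(\<integral>\<^sup>+x. ennreal (\<bar>x - p\<bar> powr (-s)) * indicator {p-h..p+h} x \<partial>lborel)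
      \<le> (\<integral>\<^sup>+x. g (- p + 1 * x) + g (p + (-1) * x) \<partial>lborel)"
    by (intro nn_integral_mono) (auto simp: g_def indicator_def abs_real_def)
  also have "\<dots> = (\<integral>\<^sup>+x. g (- p + 1 * x) \<partial>lborel) + (\<integral>\<^sup>+x. g (p + (-1) * x) \<partial>lborel)"
    by (rule nn_integral_add) auto
  also have "\<dots> = integral\<^sup>N lborel g + integral\<^sup>N lborel g"
    using nn_integral_real_affine[of g 1 "-p"] nn_integral_real_affine[of g "-1" p] by simp
  also have "\<dots> = ennreal (2 * h powr (1 - s) / (1 - s))"
    using assms by (simp add: g flip: ennreal_plus)
  finally show ?thesis .
qed

text \<open>Within distance \<open>h\<close> of the singularity \<open>G\<close> is replaced by its bound \<open>B\<close>, and outside the weight is replaced by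
  its largest value there. The choice of \<open>h\<close> balances the two terms in the applications.\<close>

lemma nn_integral_powr_weight:
  fixes s h p :: real and G :: "real \<Rightarrow> ennreal"
  assumes s: "0 < s" "s < 1" and h: "0 < h" and S: "S \<in> sets lebesgue"
    and G: "G \<in> borel_measurable (lebesgue_on S)" and B: "\<And>x. x \<in> S \<Longrightarrow> G x \<le> B"
  shows "(\<integral>\<^sup>+x. ennreal (\<bar>x - p\<bar> powr (-s)) * G x \<partial>lebesgue_on S)
           \<le> ennreal (2 * h powr (1 - s) / (1 - s)) * B + ennreal (h powr (-s)) * (\<integral>\<^sup>+x. G x \<partial>lebesgue_on S)"
proof -
  let ?I = "\<lambda>x. ennreal (\<bar>x - p\<bar> powr (-s)) * indicator {p-h..p+h} x"
  have Im: "?I \<in> borel_measurable borel" by measurable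
  then have I1: "?I \<in> borel_measurable (lebesgue_on S)"
    by (intro measurable_restrict_space1 measurable_completion) simp
  have "(\<integral>\<^sup>+x. ennreal (\<bar>x - p\<bar> powr (-s)) * G x \<partial>lebesgue_on S)
      \<le> (\<integral>\<^sup>+x. ?I x * B + ennreal (h powr (-s)) * G x \<partial>lebesgue_on S)"
  proof (intro nn_integral_mono)
    fix x assume "x \<in> space (lebesgue_on S)"
    then have x: "x \<in> S" by simp
    show "ennreal (\<bar>x - p\<bar> powr (-s)) * G x \<le> ?I x * B + ennreal (h powr (-s)) * G x"
    proof (cases "x \<in> {p-h..p+h}")
      case True
      then show ?thesis using B[OF x] by (simp add: add_increasing2 mult_left_mono)
    next
      case False
      then have "h \<le> \<bar>x - p\<bar>" by auto
      then have "\<bar>x - p\<bar> powr (-s) \<le> h powr (-s)"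
        using s h by (intro powr_mono2') auto
      then show ?thesis using False by (simp add: mult_right_mono ennreal_leI)
    qed
  qed
  also have "\<dots> = (\<integral>\<^sup>+x. ?I x \<partial>lebesgue_on S) * B + ennreal (h powr (-s)) * (\<integral>\<^sup>+x. G x \<partial>lebesgue_on S)"
    using I1 G by (simp add: nn_integral_add nn_integral_cmult nn_integral_multc)
  also have "(\<integral>\<^sup>+x. ?I x \<partial>lebesgue_on S) \<le> (\<integral>\<^sup>+x. ?I x \<partial>lebesgue)"
    using S by (subst nn_integral_restrict_space) (auto intro!: nn_integral_mono simp: indicator_def)
  also have "(\<integral>\<^sup>+x. ?I x \<partial>lebesgue) \<le> ennreal (2 * h powr (1 - s) / (1 - s))"
    using nn_integral_powr_interval[of s h p] s h by (simp add: nn_integral_completion)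
  finally show ?thesis by (simp add: mult_right_mono)
qed

abbreviation circ :: "real measure" where "circ \<equiv> lebesgue_on {-pi..pi}"

lemma borel_measurable_lebesgue_on_borel:
  "f \<in> borel_measurable borel \<Longrightarrow> f \<in> borel_measurable (lebesgue_on S)"
  by (intro measurable_restrict_space1 measurable_completion) simp

lemma emeasure_circ: "emeasure circ (space circ) = ennreal (2 * pi)"
  by (simp add: emeasure_restrict_space)

definition trig :: "nat \<Rightarrow> (nat \<Rightarrow> complex) \<Rightarrow> real \<Rightarrow> complex" where
  "trig n u \<theta> = (\<Sum>k<n. u k * cis (real k * \<theta>))"

lemma continuous_on_trig: "continuous_on S (trig n u)"
  unfolding trig_def by (intro continuous_intros)

lemma trig_measurable [measurable]: "trig n u \<in> borel_measurable borel"
  by (intro borel_measurable_continuous_onI continuous_on_trig)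

lemma trig_measurable_circ [measurable]: "trig n u \<in> borel_measurable (lebesgue_on S)"
  by (rule borel_measurable_lebesgue_on_borel) measurable

lemma cmod_trig_le: "cmod (trig n u \<theta>) \<le> sqrt (real n) * l2 n u"
proof -
  have "cmod (trig n u \<theta>) \<le> (\<Sum>k<n. \<bar>1\<bar> * \<bar>cmod (u k)\<bar>)"
    unfolding trig_def by (rule order_trans[OF norm_sum]) (simp add: norm_mult)
  also have "\<dots> \<le> L2_set (\<lambda>_. 1) {..<n} * l2 n u"
    unfolding l2_def by (rule L2_set_mult_ineq)
  finally show ?thesis by (simp add: L2_set_constant)
qed

lemma has_bochner_integral_cis:
  "has_bochner_integral circ (\<lambda>\<theta>. cis (of_int k * \<theta>)) (if k = 0 then of_real (2 * pi) else 0)"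
proof -
  have int: "integrable circ (\<lambda>\<theta>. cis (of_int k * \<theta>))"
    by (intro continuous_imp_integrable_real continuous_intros)
  have "((\<lambda>\<theta>. cis (of_int k * \<theta>)) has_integral (if k = 0 then of_real (2 * pi) else 0)) {-pi..pi}"
  proof (cases "k = 0")
    case True
    then show ?thesis using has_integral_const_real[of "1::complex" "-pi" pi] by (simp add: scaleR_conv_of_real)
  next
    case False
    let ?F = "\<lambda>\<theta>. cis (of_int k * \<theta>) / (\<i> * of_int k)"
    have "((\<lambda>\<theta>. cis (of_int k * \<theta>)) has_integral (?F pi - ?F (-pi))) {-pi..pi}"
    proof (rule fundamental_theorem_of_calculus)
      fix x
      show "(?F has_vector_derivative cis (of_int k * x)) (at x within {-pi..pi})"
        unfolding cis_conv_exp
        using False by (auto intro!: derivative_eq_intros has_vector_derivative_real_field simp: field_simps)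
    qed simp
    moreover have "cis (of_int k * pi) = cis (of_int k * (-pi))"
    proof -
      have "cis (of_int k * pi) = cis (of_int k * (-pi)) * cis (2 * pi * of_int k)"
        by (simp only: cis_mult) (simp add: algebra_simps)
      then show ?thesis by simp
    qed
    ultimately show ?thesis using False by simp
  qed
  then show ?thesis
    using int lebesgue_integral_eq_integral[OF int] by (auto simp: has_bochner_integral_iff integral_unique)
qed

lemma nn_integral_trig: "(\<integral>\<^sup>+\<theta>. ennreal ((cmod (trig n u \<theta>))\<^sup>2) \<partial>circ) = ennreal (2 * pi * (l2 n u)\<^sup>2)"
proof -
  have eq: "complex_of_real ((cmod (trig n u \<theta>))\<^sup>2)
      = (\<Sum>j<n. \<Sum>k<n. u j * cnj (u k) * cis (of_int (int j - int k) * \<theta>))" for \<theta>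
  proof -
    have c: "cis (of_int (int j - int k) * \<theta>) = cis (real j * \<theta>) * cis (- (real k * \<theta>))" for j k
      by (simp add: cis_mult left_diff_distrib)
    show ?thesis
      unfolding complex_norm_square trig_def cnj_sum sum_product c
      by (intro sum.cong refl) (simp add: cis_cnj)
  qed
  have "has_bochner_integral circ (\<lambda>\<theta>. complex_of_real ((cmod (trig n u \<theta>))\<^sup>2))
    (\<Sum>j<n. \<Sum>k<n. u j * cnj (u k) * (if int j - int k = 0 then of_real (2 * pi) else 0))"
    unfolding eq
    by (intro has_bochner_integral_sum has_bochner_integral_mult_right has_bochner_integral_cis)
  also have "(\<Sum>j<n. \<Sum>k<n. u j * cnj (u k) * (if int j - int k = 0 then of_real (2 * pi) else 0))
      = (\<Sum>j<n. u j * cnj (u j) * complex_of_real (2 * pi))"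
    by (intro sum.cong refl) (simp add: if_distrib[of "\<lambda>x. _ * x"] cong: if_cong)
  also have "\<dots> = complex_of_real (2 * pi * (l2 n u)\<^sup>2)"
    by (simp only: complex_norm_square[symmetric] l2_power2 of_real_mult of_real_sum sum_distrib_left mult.commute)
  finally have "has_bochner_integral circ (\<lambda>\<theta>. (cmod (trig n u \<theta>))\<^sup>2) (2 * pi * (l2 n u)\<^sup>2)"
    by (auto dest!: has_bochner_integral_bounded_linear[OF bounded_linear_Re] simp only: Re_complex_of_real)
  then show ?thesis
    by (simp add: has_bochner_integral_iff nn_integral_eq_integral)
qed

lemma sin_ge_third: "0 \<le> y \<Longrightarrow> y \<le> pi / 2 \<Longrightarrow> y / 3 \<le> sin y" for y :: real
proof -
  assume y: "0 \<le> y" "y \<le> pi / 2"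
  have "\<bar>sin y - (\<Sum>m<3. sin_coeff m * y ^ m)\<bar> \<le> inverse (fact 3) * \<bar>y\<bar> ^ 3"
    by (rule Maclaurin_sin_bound)
  then have "\<bar>sin y - y\<bar> \<le> y ^ 3 / 6"
    using y by (simp add: sin_coeff_def eval_nat_numeral fact_numeral)
  moreover have "y ^ 3 \<le> 4 * y"
  proof -
    have "y \<le> 2" using y pi_half_less_two by linarith
    then have "y * y \<le> 2 * 2" using y by (intro mult_mono) auto
    then have "y * y * y \<le> 4 * y" using y by (intro mult_right_mono) auto
    then show ?thesis by (simp add: eval_nat_numeral)
  qed
  ultimately show ?thesis by linarith
qed

lemma cmod_cis_diff: "cmod (cis a - cis b) = 2 * \<bar>sin ((a - b) / 2)\<bar>"
proof -
  have "(cmod (cis a - cis b))\<^sup>2 = (2 * \<bar>sin ((a - b) / 2)\<bar>)\<^sup>2"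
  proof -
    have "(cmod (cis a - cis b))\<^sup>2 = (cos a - cos b)\<^sup>2 + (sin a - sin b)\<^sup>2"
      by (simp add: cmod_power2)
    also have "\<dots> = (sin a)\<^sup>2 + (cos a)\<^sup>2 + ((sin b)\<^sup>2 + (cos b)\<^sup>2) - 2 * cos (a - b)"
      by (simp add: power2_eq_square algebra_simps cos_diff)
    also have "\<dots> = 2 - 2 * cos (2 * ((a - b) / 2))"
      unfolding sin_cos_squared_add by (simp only: times_divide_eq_right nonzero_mult_div_cancel_left)
    also have "\<dots> = (2 * \<bar>sin ((a - b) / 2)\<bar>)\<^sup>2"
      by (subst cos_double_sin) (simp add: power_mult_distrib)
    finally show ?thesis .
  qed
  then show ?thesis by (subst (asm) power2_eq_iff_nonneg) auto
qed

lemma cmod_cis_diff_ge: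
  assumes "\<bar>a - b\<bar> \<le> pi"
  shows "\<bar>a - b\<bar> / 3 \<le> cmod (cis a - cis b)"
proof -
  have "\<bar>a - b\<bar> / 2 / 3 \<le> sin (\<bar>a - b\<bar> / 2)"
    using assms by (intro sin_ge_third) auto
  also have "sin (\<bar>a - b\<bar> / 2) \<le> \<bar>sin ((a - b) / 2)\<bar>"
  proof (cases "b \<le> a")
    case True
    then show ?thesis by simp
  next
    case False
    then have "\<bar>a - b\<bar> / 2 = - ((a - b) / 2)" by (simp add: field_simps)
    then have "sin (\<bar>a - b\<bar> / 2) = - sin ((a - b) / 2)" by (simp only: sin_minus)
    then show ?thesis by simp
  qed
  finally show ?thesis by (simp add: cmod_cis_diff)
qed

text \<open>A chord is at least a third of its arc. The angle \<open>\<phi>\<close> has three representatives modulo \<open>2 * pi\<close> that can be the one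
  closest to \<open>\<theta>\<close>, and the right-hand side adds up all of them.\<close>

lemma circle_powr_le:
  assumes "\<theta> \<in> {-pi..pi}" "\<phi> \<in> {-pi..pi}" "0 < s" "s < 1"
  shows "cmod (cis \<theta> - cis \<phi>) powr (-s)
     \<le> 3 * (\<bar>\<theta> - \<phi>\<bar> powr (-s) + \<bar>\<theta> - (\<phi> - 2 * pi)\<bar> powr (-s) + \<bar>\<theta> - (\<phi> + 2 * pi)\<bar> powr (-s))"
proof -
  have main: "cmod (cis \<theta> - cis \<phi>) powr (-s) \<le> 3 * \<bar>\<theta> - \<psi>\<bar> powr (-s)"
    if \<psi>: "cis \<psi> = cis \<phi>" "\<bar>\<theta> - \<psi>\<bar> \<le> pi" for \<psi>
  proof (cases "\<theta> = \<psi>")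
    case True
    then show ?thesis using \<psi> by simp
  next
    case False
    have "cmod (cis \<theta> - cis \<psi>) powr (-s) \<le> (\<bar>\<theta> - \<psi>\<bar> / 3) powr (-s)"
      using cmod_cis_diff_ge[of \<theta> \<psi>] \<psi> False assms by (intro powr_mono2') auto
    also have "\<dots> = 3 powr s * \<bar>\<theta> - \<psi>\<bar> powr (-s)"
      by (simp add: powr_divide powr_minus_divide)
    also have "3 powr s \<le> 3 powr (1::real)" using assms by (intro powr_mono) auto
    finally show ?thesis using \<psi> by (simp add: mult_right_mono)
  qed
  have c1: "cis (\<phi> - 2 * pi) = cis \<phi>" by (simp flip: cis_divide)
  have c2: "cis (\<phi> + 2 * pi) = cis \<phi>" by (simp flip: cis_mult)
  have "\<bar>\<theta> - \<phi>\<bar> \<le> pi \<or> \<bar>\<theta> - (\<phi> - 2 * pi)\<bar> \<le> pi \<or> \<bar>\<theta> - (\<phi> + 2 * pi)\<bar> \<le> pi"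
    using assms by (auto simp: abs_real_def)
  then show ?thesis
    using main[of \<phi>] main[OF c1] main[OF c2]
      powr_ge_zero[of "\<bar>\<theta> - \<phi>\<bar>" "-s"] powr_ge_zero[of "\<bar>\<theta> - (\<phi> - 2 * pi)\<bar>" "-s"]
      powr_ge_zero[of "\<bar>\<theta> - (\<phi> + 2 * pi)\<bar>" "-s"]
    by argo
qed

text \<open>One factor \<open>3\<close> comes from comparing chords with arcs, the other from the three representatives of an angle.\<close>

definition weight_const :: "real \<Rightarrow> real" where
  "weight_const s = 9 * (2 / (1 - s) + 2 * pi)"

lemma weight_const_pos: "0 < s \<Longrightarrow> s < 1 \<Longrightarrow> 0 < weight_const s"
  by (simp add: weight_const_def add_pos_pos)

lemma ennreal_lincomb:
  "0 \<le> a \<Longrightarrow> 0 \<le> b \<Longrightarrow> 0 \<le> c \<Longrightarrow> 0 \<le> d \<Longrightarrow>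
    ennreal a * ennreal b + ennreal c * ennreal d = ennreal (a * b + c * d)"
  by (simp only: ennreal_mult ennreal_plus mult_nonneg_nonneg)

text \<open>The basic estimate, obtained with \<open>h = 1 / n\<close>: near the singularity \<open>\<bar>U\<bar>\<^sup>2 \<le> n * \<parallel>u\<parallel>\<^sup>2\<close>, and
  away from it the weight is at most \<open>n powr s\<close> while Parseval's identity controls the integral of \<open>\<bar>U\<bar>\<^sup>2\<close>.\<close>

lemma nn_integral_circle_weight:
  assumes \<tau>: "cmod \<tau> = 1" and s: "0 < s" "s < 1" and n: "1 \<le> n"
  shows "(\<integral>\<^sup>+\<theta>. ennreal (cmod (cis \<theta> - \<tau>) powr (-s)) * ennreal ((cmod (trig n u \<theta>))\<^sup>2) \<partial>circ)
          \<le> ennreal (weight_const s * real n powr s * (l2 n u)\<^sup>2)"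
proof -
  define G where "G = (\<lambda>\<theta>. ennreal ((cmod (trig n u \<theta>))\<^sup>2))"
  define \<phi> where "\<phi> = Arg \<tau>"
  have \<phi>: "\<phi> \<in> {-pi..pi}" "cis \<phi> = \<tau>"
    using \<tau> Arg_bounded[of \<tau>] cis_Arg[of \<tau>] by (cases "\<tau> = 0", auto simp: \<phi>_def sgn_div_norm)+
  have [measurable]: "G \<in> borel_measurable circ" by (simp add: G_def)
  have B: "G \<theta> \<le> ennreal (real n * (l2 n u)\<^sup>2)" for \<theta>
  proof -
    have "(cmod (trig n u \<theta>))\<^sup>2 \<le> (sqrt (real n) * l2 n u)\<^sup>2"
      by (intro power_mono cmod_trig_le) auto
    then show ?thesis by (simp add: G_def power_mult_distrib ennreal_leI)
  qed
  have one: "(\<integral>\<^sup>+\<theta>. ennreal (\<bar>\<theta> - \<psi>\<bar> powr (-s)) * G \<theta> \<partial>circ)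
      \<le> ennreal ((2 / (1 - s) + 2 * pi) * real n powr s * (l2 n u)\<^sup>2)" for \<psi>
  proof -
    have "(\<integral>\<^sup>+\<theta>. ennreal (\<bar>\<theta> - \<psi>\<bar> powr (-s)) * G \<theta> \<partial>circ)
      \<le> ennreal (2 * (1 / real n) powr (1 - s) / (1 - s)) * ennreal (real n * (l2 n u)\<^sup>2)
        + ennreal ((1 / real n) powr (-s)) * (\<integral>\<^sup>+\<theta>. G \<theta> \<partial>circ)"
      using s n B by (intro nn_integral_powr_weight) auto
    also have "\<dots> = ennreal (2 * (1 / real n) powr (1 - s) / (1 - s) * (real n * (l2 n u)\<^sup>2)
        + (1 / real n) powr (-s) * (2 * pi * (l2 n u)\<^sup>2))"
      unfolding G_def nn_integral_trig by (rule ennreal_lincomb) (use s in auto)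
    also have "2 * (1 / real n) powr (1 - s) / (1 - s) * (real n * (l2 n u)\<^sup>2)
        + (1 / real n) powr (-s) * (2 * pi * (l2 n u)\<^sup>2)
       = (2 / (1 - s) + 2 * pi) * real n powr s * (l2 n u)\<^sup>2"
    proof -
      have n1: "1 / real n = real n powr (-1)" using n by (simp add: powr_minus_divide)
      have "(1 / real n) powr (1 - s) * real n = real n powr (- 1 * (1 - s)) * real n powr 1"
        unfolding n1 powr_powr using n by simp
      also have "\<dots> = real n powr s" by (simp only: powr_add[symmetric]) simp
      finally have 1: "(1 / real n) powr (1 - s) * real n = real n powr s" .
      have 2: "(1 / real n) powr (-s) = real n powr s"
        unfolding n1 powr_powr by simp
      have "2 * (1 / real n) powr (1 - s) / (1 - s) * (real n * (l2 n u)\<^sup>2)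
        = 2 / (1 - s) * ((1 / real n) powr (1 - s) * real n) * (l2 n u)\<^sup>2" by simp
      then show ?thesis unfolding 1 2 by (simp add: distrib_right)
    qed
    finally show ?thesis .
  qed
  let ?w = "\<lambda>\<psi> \<theta>. ennreal (\<bar>\<theta> - \<psi>\<bar> powr (-s)) * G \<theta>"
  have wm: "?w \<psi> \<in> borel_measurable circ" for \<psi>
    by (rule borel_measurable_times_ennreal[OF borel_measurable_lebesgue_on_borel]) measurable
  have "(\<integral>\<^sup>+\<theta>. ennreal (cmod (cis \<theta> - \<tau>) powr (-s)) * G \<theta> \<partial>circ)
     \<le> (\<integral>\<^sup>+\<theta>. 3 * (?w \<phi> \<theta> + ?w (\<phi> - 2 * pi) \<theta> + ?w (\<phi> + 2 * pi) \<theta>) \<partial>circ)"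
  proof (intro nn_integral_mono)
    fix \<theta> assume "\<theta> \<in> space circ"
    then have "\<theta> \<in> {-pi..pi}" by simp
    from circle_powr_le[OF this \<phi>(1) s, unfolded \<phi>(2)]
    have "ennreal (cmod (cis \<theta> - \<tau>) powr (-s))
      \<le> ennreal (3 * (\<bar>\<theta> - \<phi>\<bar> powr (-s) + \<bar>\<theta> - (\<phi> - 2 * pi)\<bar> powr (-s) + \<bar>\<theta> - (\<phi> + 2 * pi)\<bar> powr (-s)))"
      by (rule ennreal_leI)
    also have "\<dots> = 3 * (ennreal (\<bar>\<theta> - \<phi>\<bar> powr (-s)) + ennreal (\<bar>\<theta> - (\<phi> - 2 * pi)\<bar> powr (-s))
        + ennreal (\<bar>\<theta> - (\<phi> + 2 * pi)\<bar> powr (-s)))"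
      by (subst ennreal_mult) simp_all
    finally have "ennreal (cmod (cis \<theta> - \<tau>) powr (-s)) * G \<theta> \<le> \<dots> * G \<theta>"
      by (rule mult_right_mono) simp
    then show "ennreal (cmod (cis \<theta> - \<tau>) powr (-s)) * G \<theta>
      \<le> 3 * (?w \<phi> \<theta> + ?w (\<phi> - 2 * pi) \<theta> + ?w (\<phi> + 2 * pi) \<theta>)"
      by (simp only: distrib_right mult.assoc)
  qed
  also have "\<dots> = 3 * (integral\<^sup>N circ (?w \<phi>) + integral\<^sup>N circ (?w (\<phi> - 2 * pi)) + integral\<^sup>N circ (?w (\<phi> + 2 * pi)))"
    by (simp only: nn_integral_cmult[OF borel_measurable_add[OF borel_measurable_add[OF wm wm] wm]]
        nn_integral_add[OF borel_measurable_add[OF wm wm] wm] nn_integral_add[OF wm wm])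
  also have "\<dots> \<le> 3 * (ennreal ((2 / (1 - s) + 2 * pi) * real n powr s * (l2 n u)\<^sup>2)
      + ennreal ((2 / (1 - s) + 2 * pi) * real n powr s * (l2 n u)\<^sup>2)
      + ennreal ((2 / (1 - s) + 2 * pi) * real n powr s * (l2 n u)\<^sup>2))"
    by (intro mult_left_mono add_mono one) simp
  also have "\<dots> = ennreal (weight_const s * real n powr s * (l2 n u)\<^sup>2)"
  proof -
    define x where "x = (2 / (1 - s) + 2 * pi) * real n powr s * (l2 n u)\<^sup>2"
    have x: "0 \<le> x" using s by (simp add: x_def)
    have "3 * (ennreal x + ennreal x + ennreal x) = ennreal (9 * x)"
    proof -
      have "ennreal x + ennreal x + ennreal x = ennreal (3 * x)"
        using x by (simp flip: ennreal_plus)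
      moreover have "3 * ennreal (3 * x) = ennreal (3 * (3 * x))"
        using x by (subst ennreal_mult[of 3]) auto
      ultimately show ?thesis by simp
    qed
    then show ?thesis unfolding x_def weight_const_def by (simp only: mult.assoc)
  qed
  finally show ?thesis by (simp add: G_def)
qed

text \<open>A bound for the quadratic form bounds the bilinear one, by the arithmetic-geometric mean inequality
  with weights that normalise \<open>u\<close> and \<open>v\<close>.\<close>

lemma nn_integral_product_le:
  assumes K: "0 \<le> K" and w: "w \<in> borel_measurable circ"
    and bd: "\<And>u. (\<integral>\<^sup>+\<theta>. w \<theta> * ennreal ((cmod (trig n u \<theta>))\<^sup>2) \<partial>circ) \<le> ennreal (K * (l2 n u)\<^sup>2)"
  shows "(\<integral>\<^sup>+\<theta>. w \<theta> * ennreal (cmod (trig n u \<theta>) * cmod (trig n v \<theta>)) \<partial>circ) \<le> ennreal (K * l2 n u * l2 n v)"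
proof (cases "l2 n u = 0 \<or> l2 n v = 0")
  case True
  then have z: "trig n u \<theta> = 0 \<or> trig n v \<theta> = 0" for \<theta>
    using cmod_trig_le[of n u \<theta>] cmod_trig_le[of n v \<theta>] by auto
  have "w \<theta> * ennreal (cmod (trig n u \<theta>) * cmod (trig n v \<theta>)) = 0" for \<theta>
    using z[of \<theta>] by auto
  then show ?thesis by (simp only: nn_integral_const) simp
next
  case False
  define p where "p = l2 n u"
  define q where "q = l2 n v"
  have pq: "0 < p" "0 < q"
    using False l2_nonneg[of n u] l2_nonneg[of n v] by (auto simp: p_def q_def less_le)
  let ?U = "\<lambda>\<theta>. cmod (trig n u \<theta>)" and ?V = "\<lambda>\<theta>. cmod (trig n v \<theta>)"
  have amgm: "x * y \<le> q / (2 * p) * x\<^sup>2 + p / (2 * q) * y\<^sup>2" for x y :: real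
  proof -
    have "0 \<le> (q * x - p * y)\<^sup>2" by simp
    then have "2 * p * q * (x * y) \<le> 2 * p * q * (q / (2 * p) * x\<^sup>2 + p / (2 * q) * y\<^sup>2)"
      using pq by (simp add: power2_eq_square algebra_simps)
    then show ?thesis using pq by simp
  qed
  have "(\<integral>\<^sup>+\<theta>. w \<theta> * ennreal (?U \<theta> * ?V \<theta>) \<partial>circ)
      \<le> (\<integral>\<^sup>+\<theta>. ennreal (q / (2 * p)) * (w \<theta> * ennreal ((?U \<theta>)\<^sup>2))
            + ennreal (p / (2 * q)) * (w \<theta> * ennreal ((?V \<theta>)\<^sup>2)) \<partial>circ)"
  proof (intro nn_integral_mono)
    fix \<theta>
    have "ennreal (?U \<theta> * ?V \<theta>) \<le> ennreal (q / (2 * p) * (?U \<theta>)\<^sup>2 + p / (2 * q) * (?V \<theta>)\<^sup>2)"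
      by (rule ennreal_leI[OF amgm])
    also have "\<dots> = ennreal (q / (2 * p)) * ennreal ((?U \<theta>)\<^sup>2) + ennreal (p / (2 * q)) * ennreal ((?V \<theta>)\<^sup>2)"
      by (rule ennreal_lincomb[symmetric]) (use pq in auto)
    finally have "w \<theta> * ennreal (?U \<theta> * ?V \<theta>) \<le> w \<theta> * \<dots>" by (rule mult_left_mono) simp
    then show "w \<theta> * ennreal (?U \<theta> * ?V \<theta>) \<le> ennreal (q / (2 * p)) * (w \<theta> * ennreal ((?U \<theta>)\<^sup>2))
            + ennreal (p / (2 * q)) * (w \<theta> * ennreal ((?V \<theta>)\<^sup>2))"
      by (simp add: distrib_left mult_ac)
  qed
  also have "\<dots> = ennreal (q / (2 * p)) * (\<integral>\<^sup>+\<theta>. w \<theta> * ennreal ((?U \<theta>)\<^sup>2) \<partial>circ)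
            + ennreal (p / (2 * q)) * (\<integral>\<^sup>+\<theta>. w \<theta> * ennreal ((?V \<theta>)\<^sup>2) \<partial>circ)"
    using w by (simp add: nn_integral_add nn_integral_cmult)
  also have "\<dots> \<le> ennreal (q / (2 * p)) * ennreal (K * p\<^sup>2) + ennreal (p / (2 * q)) * ennreal (K * q\<^sup>2)"
    unfolding p_def q_def by (intro add_mono mult_left_mono bd) auto
  also have "\<dots> = ennreal (q / (2 * p) * (K * p\<^sup>2) + p / (2 * q) * (K * q\<^sup>2))"
    by (rule ennreal_lincomb) (use pq K in auto)
  also have "q / (2 * p) * (K * p\<^sup>2) + p / (2 * q) * (K * q\<^sup>2) = K * p * q"
    using pq by (simp add: power2_eq_square)
  finally show ?thesis by (simp add: p_def q_def)
qed

lemma fourier_form_integral: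
  assumes f: "integrable circ (\<lambda>\<theta>. f (cis \<theta>))"
  shows "form n (\<lambda>j k. fourier_coeff f (int j - int k)) u v
    = 1 / (2 * of_real pi) * (LINT \<theta>|circ. f (cis \<theta>) * (trig n u \<theta> * cnj (trig n v \<theta>)))"
proof -
  have cism: "(\<lambda>\<theta>. cis (- (x * \<theta>))) \<in> borel_measurable circ" for x
    by (intro borel_measurable_lebesgue_on_borel borel_measurable_continuous_onI continuous_intros)
  have int: "integrable circ (\<lambda>\<theta>. f (cis \<theta>) * cis (- (of_int (int j - int k) * \<theta>)))" for j k
    by (rule Bochner_Integration.integrable_bound[OF f])
      (auto simp: norm_mult intro!: borel_measurable_times[OF borel_measurable_integrable[OF f] cism])
  have prod: "trig n u \<theta> * cnj (trig n v \<theta>)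
      = (\<Sum>j<n. \<Sum>k<n. cis (- (of_int (int j - int k) * \<theta>)) * (u k * cnj (v j)))" for \<theta>
  proof -
    have c: "cis (- (of_int (int j - int k) * \<theta>)) = cis (real k * \<theta>) * cis (- (real j * \<theta>))" for j k
      unfolding cis_mult by (rule arg_cong[of _ _ cis]) (simp add: algebra_simps)
    have "trig n u \<theta> * cnj (trig n v \<theta>)
      = (\<Sum>k<n. \<Sum>j<n. u k * cis (real k * \<theta>) * cnj (v j * cis (real j * \<theta>)))"
      unfolding trig_def cnj_sum sum_product ..
    also have "\<dots> = (\<Sum>j<n. \<Sum>k<n. u k * cis (real k * \<theta>) * cnj (v j * cis (real j * \<theta>)))"
      by (rule sum.swap)
    finally show ?thesis
      unfolding c by (simp only: cis_cnj complex_cnj_mult mult_ac)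
  qed
  have "(LINT \<theta>|circ. f (cis \<theta>) * (trig n u \<theta> * cnj (trig n v \<theta>)))
    = (LINT \<theta>|circ. (\<Sum>j<n. \<Sum>k<n. f (cis \<theta>) * cis (- (of_int (int j - int k) * \<theta>)) * (u k * cnj (v j))))"
    unfolding prod by (simp add: sum_distrib_left mult.assoc)
  also have "\<dots> = (\<Sum>j<n. \<Sum>k<n. (LINT \<theta>|circ. f (cis \<theta>) * cis (- (of_int (int j - int k) * \<theta>))) * (u k * cnj (v j)))"
    using int by (simp add: Bochner_Integration.integral_sum)
  finally show ?thesis
    unfolding form_def fourier_coeff_def by (simp add: sum_distrib_left mult.assoc)
qed

context
  fixes T :: "complex set" and s \<epsilon> C :: real and f :: "complex \<Rightarrow> complex"
  assumes T: "finite T" "\<And>\<tau>. \<tau> \<in> T \<Longrightarrow> cmod \<tau> = 1"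
    and s: "0 < s" "s < 1" and \<epsilon>: "0 \<le> \<epsilon>" and C: "0 \<le> C"
    and f: "(\<lambda>\<theta>. f (cis \<theta>)) \<in> borel_measurable circ"
    and bd: "AE \<theta> in circ. cmod (f (cis \<theta>)) \<le> \<epsilon> * (\<Sum>\<tau>\<in>T. cmod (cis \<theta> - \<tau>) powr (-s)) + C"
begin

lemma weight_nn_integral:
  assumes n: "1 \<le> n"
  shows "(\<integral>\<^sup>+\<theta>. ennreal (\<epsilon> * (\<Sum>\<tau>\<in>T. cmod (cis \<theta> - \<tau>) powr (-s)) + C) * ennreal ((cmod (trig n u \<theta>))\<^sup>2) \<partial>circ)
    \<le> ennreal ((\<epsilon> * real (card T) * weight_const s * real n powr s + 2 * pi * C) * (l2 n u)\<^sup>2)"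
proof -
  let ?G = "\<lambda>\<theta>. ennreal ((cmod (trig n u \<theta>))\<^sup>2)"
  let ?w = "\<lambda>\<tau> \<theta>. ennreal (cmod (cis \<theta> - \<tau>) powr (-s))"
  let ?K = "weight_const s * real n powr s * (l2 n u)\<^sup>2"
  have K0: "0 \<le> ?K" using weight_const_pos[OF s] by simp
  have [measurable]: "cis \<in> borel_measurable borel"
    by (intro borel_measurable_continuous_onI continuous_intros)
  have wm: "(\<lambda>\<theta>. ?w \<tau> \<theta> * ?G \<theta>) \<in> borel_measurable circ" for \<tau>
    by (rule borel_measurable_lebesgue_on_borel) measurable
  have Gm: "?G \<in> borel_measurable circ" by measurable
  have "(\<integral>\<^sup>+\<theta>. ennreal (\<epsilon> * (\<Sum>\<tau>\<in>T. cmod (cis \<theta> - \<tau>) powr (-s)) + C) * ?G \<theta> \<partial>circ)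
     = (\<integral>\<^sup>+\<theta>. ennreal \<epsilon> * (\<Sum>\<tau>\<in>T. ?w \<tau> \<theta> * ?G \<theta>) + ennreal C * ?G \<theta> \<partial>circ)"
  proof (rule nn_integral_cong)
    fix \<theta>
    have "ennreal (\<epsilon> * (\<Sum>\<tau>\<in>T. cmod (cis \<theta> - \<tau>) powr (-s)) + C)
       = ennreal \<epsilon> * (\<Sum>\<tau>\<in>T. ?w \<tau> \<theta>) + ennreal C"
      using \<epsilon> C by (simp add: ennreal_plus ennreal_mult sum_nonneg)
    then show "ennreal (\<epsilon> * (\<Sum>\<tau>\<in>T. cmod (cis \<theta> - \<tau>) powr (-s)) + C) * ?G \<theta>
       = ennreal \<epsilon> * (\<Sum>\<tau>\<in>T. ?w \<tau> \<theta> * ?G \<theta>) + ennreal C * ?G \<theta>"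
      by (simp only: distrib_right sum_distrib_right mult.assoc)
  qed
  also have "\<dots> = ennreal \<epsilon> * (\<Sum>\<tau>\<in>T. \<integral>\<^sup>+\<theta>. ?w \<tau> \<theta> * ?G \<theta> \<partial>circ) + ennreal C * (\<integral>\<^sup>+\<theta>. ?G \<theta> \<partial>circ)"
    using wm Gm by (simp add: nn_integral_add nn_integral_cmult nn_integral_sum)
  also have "\<dots> \<le> ennreal \<epsilon> * (\<Sum>\<tau>\<in>T. ennreal ?K) + ennreal C * ennreal (2 * pi * (l2 n u)\<^sup>2)"
    unfolding nn_integral_trig
    by (intro add_mono mult_left_mono sum_mono nn_integral_circle_weight T s n) auto
  also have "(\<Sum>\<tau>\<in>T. ennreal ?K) = ennreal (real (card T) * ?K)"
    using K0 by (simp add: ennreal_of_nat_eq_real_of_nat ennreal_mult)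
  also have "ennreal \<epsilon> * ennreal (real (card T) * ?K) + ennreal C * ennreal (2 * pi * (l2 n u)\<^sup>2)
      = ennreal (\<epsilon> * (real (card T) * ?K) + C * (2 * pi * (l2 n u)\<^sup>2))"
    by (rule ennreal_lincomb) (use \<epsilon> C K0 in auto)
  also have "\<epsilon> * (real (card T) * ?K) + C * (2 * pi * (l2 n u)\<^sup>2)
      = (\<epsilon> * real (card T) * weight_const s * real n powr s + 2 * pi * C) * (l2 n u)\<^sup>2"
    by (simp add: distrib_right)
  finally show ?thesis .
qed

lemma weight_nonneg: "0 \<le> \<epsilon> * (\<Sum>\<tau>\<in>T. cmod (cis \<theta> - \<tau>) powr (-s)) + C"
  using \<epsilon> C by (intro add_nonneg_nonneg mult_nonneg_nonneg sum_nonneg) auto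

lemma singular_symbol_integrable: "integrable circ (\<lambda>\<theta>. f (cis \<theta>))"
proof (rule integrableI_bounded[OF f])
  let ?w = "\<lambda>\<theta>. ennreal (\<epsilon> * (\<Sum>\<tau>\<in>T. cmod (cis \<theta> - \<tau>) powr (-s)) + C)"
  have "(\<integral>\<^sup>+\<theta>. ennreal (norm (f (cis \<theta>))) \<partial>circ) \<le> (\<integral>\<^sup>+\<theta>. ?w \<theta> * ennreal ((cmod (trig 1 (\<lambda>_. 1) \<theta>))\<^sup>2) \<partial>circ)"
    by (rule nn_integral_mono_AE) (use bd in eventually_elim, simp add: trig_def ennreal_leI)
  also have "\<dots> < \<infinity>"
    by (rule le_less_trans[OF weight_nn_integral]) auto
  finally show "(\<integral>\<^sup>+\<theta>. ennreal (norm (f (cis \<theta>))) \<partial>circ) < \<infinity>" .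
qed

text \<open>What makes perturbations of the symbol harmless: a small multiple of the singular weight stays a small
  multiple of \<open>n powr s\<close>, and a bounded part, however large, contributes only a constant.\<close>

lemma singular_symbol_form_le:
  assumes n: "1 \<le> n"
  shows "cmod (form n (\<lambda>j k. fourier_coeff f (int j - int k)) u v)
    \<le> (\<epsilon> * real (card T) * weight_const s * real n powr s + C) * l2 n u * l2 n v"
proof -
  let ?w = "\<lambda>\<theta>. ennreal (\<epsilon> * (\<Sum>\<tau>\<in>T. cmod (cis \<theta> - \<tau>) powr (-s)) + C)"
  let ?K = "\<epsilon> * real (card T) * weight_const s * real n powr s"
  have K0: "0 \<le> ?K" using weight_const_pos[OF s] \<epsilon> by simp
  have [measurable]: "cis \<in> borel_measurable borel"
    by (intro borel_measurable_continuous_onI continuous_intros)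
  have wm: "?w \<in> borel_measurable circ"
    by (rule borel_measurable_lebesgue_on_borel) measurable
  let ?I = "LINT \<theta>|circ. f (cis \<theta>) * (trig n u \<theta> * cnj (trig n v \<theta>))"
  have "ennreal (cmod ?I) \<le> (\<integral>\<^sup>+\<theta>. ennreal (norm (f (cis \<theta>) * (trig n u \<theta> * cnj (trig n v \<theta>)))) \<partial>circ)"
    by (cases "integrable circ (\<lambda>\<theta>. f (cis \<theta>) * (trig n u \<theta> * cnj (trig n v \<theta>)))")
      (auto intro: integral_norm_bound_ennreal simp: not_integrable_integral_eq)
  also have "\<dots> \<le> (\<integral>\<^sup>+\<theta>. ?w \<theta> * ennreal (cmod (trig n u \<theta>) * cmod (trig n v \<theta>)) \<partial>circ)"
    by (rule nn_integral_mono_AE)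
      (use bd in eventually_elim, simp add: norm_mult mult_right_mono weight_nonneg flip: ennreal_mult)
  also have "\<dots> \<le> ennreal ((?K + 2 * pi * C) * l2 n u * l2 n v)"
    by (rule nn_integral_product_le[OF _ wm weight_nn_integral[OF n]]) (use K0 C in auto)
  finally have "cmod ?I \<le> (?K + 2 * pi * C) * l2 n u * l2 n v"
    using K0 C by (subst (asm) ennreal_le_iff) auto
  then have "cmod ?I / (2 * pi) \<le> ((?K + 2 * pi * C) * l2 n u * l2 n v) / (2 * pi)"
    by (rule divide_right_mono) simp
  also have "\<dots> = (?K / (2 * pi) + C) * l2 n u * l2 n v"
    by (simp add: add_divide_distrib distrib_right)
  also have "\<dots> \<le> (?K + C) * l2 n u * l2 n v"
  proof -
    have "?K \<le> ?K * (2 * pi)" using mult_left_mono[of 1 "2 * pi" ?K] K0 pi_gt3 by simp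
    then have "?K / (2 * pi) \<le> ?K" by (simp add: divide_le_eq)
    then show ?thesis by (intro mult_right_mono) auto
  qed
  finally show ?thesis
    unfolding fourier_form_integral[OF singular_symbol_integrable] by (simp add: norm_mult norm_divide)
qed

end

section \<open>A model symbol with explicit Fourier coefficients\<close>

definition binom_coeff :: "complex \<Rightarrow> nat \<Rightarrow> complex" where
  "binom_coeff z k = pochhammer z k / fact k"

text \<open>The binomial series with its signs absorbed, since \<open>binom_coeff z k\<close> is \<open>(-1) ^ k\<close> times the generalized binomial
  coefficient of \<open>- z\<close>.\<close>

lemma binomial_series_minus:
  assumes "cmod w < 1"
  shows "(\<lambda>k. binom_coeff z k * w ^ k) sums (1 - w) powr (- z)"
proof -
  have "(\<lambda>k. ((- z) gchoose k) * (- w) ^ k) sums (1 + (- w)) powr (- z)"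
    by (rule gen_binomial_complex) (use assms in simp)
  moreover have "((- z) gchoose k) * (- w) ^ k = binom_coeff z k * w ^ k" for k
  proof -
    have "(-1) ^ k * (- w) ^ k = w ^ k" by (simp flip: power_mult_distrib)
    then show ?thesis by (simp add: binom_coeff_def gbinomial_pochhammer mult_ac)
  qed
  ultimately show ?thesis by simp
qed

lemma norm_powr_minus_le:
  assumes "0 \<le> Re z" "w \<noteq> 0"
  shows "cmod (w powr (- z)) \<le> exp (pi * \<bar>Im z\<bar>) * cmod w powr (- Re z)"
proof -
  have "Im z * Arg w \<le> \<bar>Im z\<bar> * \<bar>Arg w\<bar>" using abs_ge_self[of "Im z * Arg w"] by (simp add: abs_mult)
  also have "\<dots> \<le> \<bar>Im z\<bar> * pi"
    using Arg_bounded[of w] by (intro mult_left_mono) auto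
  finally have "exp (Im z * Arg w) \<le> exp (pi * \<bar>Im z\<bar>)" by (simp add: mult.commute)
  then show ?thesis by (simp add: norm_powr_complex mult.commute mult_right_mono)
qed

lemma finite_circle_preimage: "finite {\<theta> \<in> {-pi..pi}. cis \<theta> = \<tau>}"
proof -
  have inj: "inj_on cis {-pi<..pi}"
    using Arg_cis by (metis inj_on_inverseI)
  have "finite {\<theta> \<in> {-pi<..pi}. cis \<theta> = \<tau>}"
    by (rule finite_subset[of _ "the_inv_into {-pi<..pi} cis ` {\<tau>}"])
      (use the_inv_into_f_f[OF inj] in force, simp)
  moreover have "{\<theta> \<in> {-pi..pi}. cis \<theta> = \<tau>} \<subseteq> insert (-pi) {\<theta> \<in> {-pi<..pi}. cis \<theta> = \<tau>}"
    by auto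
  ultimately show ?thesis by (meson finite_insert finite_subset)
qed

lemma AE_circ_neq: "AE \<theta> in circ. cis \<theta> \<noteq> \<tau>"
proof (rule AE_I)
  show "{\<theta> \<in> space circ. \<not> cis \<theta> \<noteq> \<tau>} \<subseteq> {\<theta> \<in> {-pi..pi}. cis \<theta> = \<tau>}" by auto
  have n: "{\<theta> \<in> {-pi..pi}. cis \<theta> = \<tau>} \<in> null_sets lebesgue"
    using finite_circle_preimage by (simp add: negligible_finite flip: negligible_iff_null_sets)
  then show "emeasure circ {\<theta> \<in> {-pi..pi}. cis \<theta> = \<tau>} = 0"
    by (subst emeasure_restrict_space) auto
  show "{\<theta> \<in> {-pi..pi}. cis \<theta> = \<tau>} \<in> sets circ"
    using n by (subst sets_restrict_space_iff) auto
qed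

text \<open>Inside the disc the binomial series converges uniformly and may be integrated termwise. The cases \<open>e = 1\<close> and
  \<open>e = -1\<close> cover the powers of \<open>1 - z / \<tau>\<close> and of \<open>1 - \<tau> / z\<close>.\<close>

lemma fourier_binomial_disc:
  assumes \<sigma>: "cmod \<sigma> = 1" and r: "0 \<le> r" "r < 1" and e: "e = 1 \<or> e = (-1::int)"
  shows "(LINT \<theta>|circ. (1 - of_real r * \<sigma> * cis (of_int e * \<theta>)) powr (- z) * cis (- (of_int m * \<theta>)))
    = (if 0 \<le> e * m then 2 * of_real pi * binom_coeff z (nat (e * m)) * (of_real r * \<sigma>) ^ nat (e * m) else 0)"
proof -
  let ?c = "binom_coeff z"
  let ?f = "\<lambda>k \<theta>. ?c k * (of_real r * \<sigma>) ^ k * cis (of_int (e * int k - m) * \<theta>)"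
  have "summable (\<lambda>k. ?c k * of_real ((1 + r) / 2) ^ k)"
    using binomial_series_minus[of "of_real ((1 + r) / 2)" z] r by (auto simp: sums_iff norm_divide simp flip: of_real_add)
  then have "summable (\<lambda>k. cmod (?c k * of_real r ^ k))"
    by (rule powser_insidea) (use r in \<open>simp add: norm_divide flip: of_real_add\<close>)
  then have summ: "summable (\<lambda>k. cmod (?c k * (of_real r * \<sigma>) ^ k))"
    by (simp add: norm_mult norm_power \<sigma>)
  have int: "has_bochner_integral circ (?f k)
      (?c k * (of_real r * \<sigma>) ^ k * (if e * int k - m = 0 then of_real (2 * pi) else 0))" for k
    by (intro has_bochner_integral_mult_right has_bochner_integral_cis)
  have nrm: "(LINT \<theta>|circ. cmod (?f k \<theta>)) = 2 * pi * cmod (?c k * (of_real r * \<sigma>) ^ k)" for k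
    using emeasure_circ by (simp add: norm_mult measure_def)
  have S: "(\<lambda>k. integral\<^sup>L circ (?f k)) sums (LINT \<theta>|circ. (\<Sum>k. ?f k \<theta>))"
  proof (rule sums_integral)
    show "integrable circ (?f k)" for k using int[of k] by (simp add: has_bochner_integral_iff)
    show "AE \<theta> in circ. summable (\<lambda>k. norm (?f k \<theta>))"
      using summ by (simp add: norm_mult)
    show "summable (\<lambda>k. LINT \<theta>|circ. norm (?f k \<theta>))"
      unfolding nrm by (intro summable_mult summ)
  qed
  have fS: "(\<Sum>k. ?f k \<theta>) = (1 - of_real r * \<sigma> * cis (of_int e * \<theta>)) powr (- z) * cis (- (of_int m * \<theta>))" for \<theta>
  proof -
    have "(\<lambda>k. ?c k * (of_real r * \<sigma> * cis (of_int e * \<theta>)) ^ k * cis (- (of_int m * \<theta>))) sums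
      ((1 - of_real r * \<sigma> * cis (of_int e * \<theta>)) powr (- z) * cis (- (of_int m * \<theta>)))"
      by (intro sums_mult2 binomial_series_minus) (use r \<sigma> in \<open>simp add: norm_mult\<close>)
    moreover have "?c k * (of_real r * \<sigma> * cis (of_int e * \<theta>)) ^ k * cis (- (of_int m * \<theta>)) = ?f k \<theta>" for k
    proof -
      have "cis (of_int e * \<theta>) ^ k * cis (- (of_int m * \<theta>)) = cis (of_int (e * int k - m) * \<theta>)"
      proof -
        have "real k * (of_int e * \<theta>) + - (of_int m * \<theta>) = of_int (e * int k - m) * \<theta>"
          by (simp add: algebra_simps)
        then show ?thesis by (simp only: Complex.DeMoivre cis_mult)
      qed
      then show ?thesis by (simp add: power_mult_distrib mult.assoc)
    qed
    ultimately show ?thesis by (simp add: sums_iff)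
  qed
  have iff: "e * int k - m = 0 \<longleftrightarrow> 0 \<le> e * m \<and> k = nat (e * m)" for k
    using e by auto
  have "(\<lambda>k. integral\<^sup>L circ (?f k)) = (\<lambda>k. if k = nat (e * m) then
      (if 0 \<le> e * m then 2 * of_real pi * ?c (nat (e * m)) * (of_real r * \<sigma>) ^ nat (e * m) else 0) else 0)"
  proof
    fix k
    show "integral\<^sup>L circ (?f k) = (if k = nat (e * m) then
      (if 0 \<le> e * m then 2 * of_real pi * ?c (nat (e * m)) * (of_real r * \<sigma>) ^ nat (e * m) else 0) else 0)"
      unfolding has_bochner_integral_integral_eq[OF int[of k]] iff by simp
  qed
  then have "(\<lambda>k. integral\<^sup>L circ (?f k)) sums
      (if 0 \<le> e * m then 2 * of_real pi * ?c (nat (e * m)) * (of_real r * \<sigma>) ^ nat (e * m) else 0)"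
    using sums_single[of "nat (e * m)" "\<lambda>_. if 0 \<le> e * m then 2 * of_real pi * ?c (nat (e * m)) * (of_real r * \<sigma>) ^ nat (e * m) else 0"]
    by simp
  with S show ?thesis unfolding fS by (rule sums_unique2)
qed

lemma circle_singularity_integrable:
  assumes "cmod \<tau> = 1" "0 < s" "s < 1"
  shows "integrable circ (\<lambda>\<theta>. cmod (cis \<theta> - \<tau>) powr (- s))"
proof -
  have [measurable]: "cis \<in> borel_measurable borel"
    by (intro borel_measurable_continuous_onI continuous_intros)
  have "integrable circ (\<lambda>\<theta>. (\<lambda>w. complex_of_real (cmod (w - \<tau>) powr (- s))) (cis \<theta>))"
    by (rule singular_symbol_integrable[of "{\<tau>}" s 1 0])
      (use assms in \<open>auto intro!: borel_measurable_lebesgue_on_borel\<close>)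
  then show ?thesis by (simp add: complex_of_real_integrable_eq)
qed

text \<open>This makes the boundary singularity an integrable majorant for the symbols with smaller radius.\<close>

lemma one_minus_scaled_ge:
  assumes "cmod w = 1" "0 \<le> r" "r \<le> 1"
  shows "cmod (1 - w) \<le> 2 * cmod (1 - of_real r * w)"
proof -
  have "1 - w = (1 - of_real r * w) - of_real (1 - r) * w" by (simp add: algebra_simps)
  then have "cmod (1 - w) \<le> cmod (1 - of_real r * w) + cmod (of_real (1 - r) * w)"
    by (metis norm_triangle_ineq4)
  also have "cmod (of_real (1 - r) * w) = 1 - r"
    using assms by (simp only: norm_mult norm_of_real) simp
  also have "1 - r \<le> cmod (1 - of_real r * w)"
    using norm_triangle_ineq2[of 1 "of_real r * w"] assms by (simp add: norm_mult)
  finally show ?thesis by simp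
qed

lemma circle_powr_measurable:
  assumes \<sigma>: "cmod \<sigma> = 1" and e: "e = 1 \<or> e = (-1::int)"
  shows "(\<lambda>\<theta>. (1 - \<sigma> * cis (of_int e * \<theta>)) powr (- z)) \<in> borel_measurable (lebesgue_on S)"
proof (rule borel_measurable_lebesgue_on_borel)
  let ?A = "{\<theta>. \<sigma> * cis (of_int e * \<theta>) \<noteq> 1}"
  let ?F = "\<lambda>\<theta>. (1 - \<sigma> * cis (of_int e * \<theta>)) powr (- z)"
  have "open ?A" by (intro open_Collect_neq continuous_intros)
  then have op: "?A \<in> sets borel" by simp
  have "(\<lambda>\<theta>. indicator ?A \<theta> *\<^sub>R ?F \<theta>) \<in> borel_measurable borel"
  proof (rule borel_measurable_continuous_on_indicator[OF op])
    have "Re (\<sigma> * cis (of_int e * \<theta>)) \<le> 1" for \<theta>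
      using complex_Re_le_cmod[of "\<sigma> * cis (of_int e * \<theta>)"] \<sigma> by (simp add: norm_mult)
    then show "continuous_on ?A ?F"
      by (intro continuous_intros) auto
  qed
  moreover have "indicator ?A \<theta> *\<^sub>R ?F \<theta> = ?F \<theta>" for \<theta>
    by (cases "\<theta> \<in> ?A") auto
  ultimately show "?F \<in> borel_measurable borel" by simp
qed

text \<open>Let the radius in \<open>fourier_binomial_disc\<close> tend to \<open>1\<close>, by dominated convergence.\<close>

lemma fourier_binomial_circle:
  assumes \<sigma>: "cmod \<sigma> = 1" and z: "0 < Re z" "Re z < 1" and e: "e = 1 \<or> e = (-1::int)"
  shows "(LINT \<theta>|circ. (1 - \<sigma> * cis (of_int e * \<theta>)) powr (- z) * cis (- (of_int m * \<theta>)))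
    = (if 0 \<le> e * m then 2 * of_real pi * binom_coeff z (nat (e * m)) * \<sigma> ^ nat (e * m) else 0)"
proof -
  \<comment> \<open>any sequence in \<open>{0..<1}\<close> that tends to \<open>1\<close> would do\<close>
  define r where "r = (\<lambda>n. real n / real (Suc n))"
  have r: "0 \<le> r n" "r n < 1" for n by (auto simp: r_def)
  have r1: "r \<longlonglongrightarrow> 1" unfolding r_def by (rule LIMSEQ_n_over_Suc_n)
  have r1c: "(\<lambda>n. complex_of_real (r n)) \<longlonglongrightarrow> 1" using tendsto_of_real[OF r1] by simp
  \<comment> \<open>the point of the circle at which the symbol is singular\<close>
  define \<tau> where "\<tau> = (if e = 1 then cnj \<sigma> else \<sigma>)"
  have \<tau>: "cmod \<tau> = 1" by (simp add: \<tau>_def \<sigma>)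
  have \<sigma>c: "\<sigma> * cnj \<sigma> = 1" using \<sigma> by (simp flip: complex_norm_square)
  have dist: "cmod (1 - \<sigma> * cis (of_int e * \<theta>)) = cmod (cis \<theta> - \<tau>)" for \<theta>
    using e
  proof
    assume e: "e = 1"
    have "1 - \<sigma> * cis \<theta> = \<sigma> * (cnj \<sigma> - cis \<theta>)" by (simp add: algebra_simps \<sigma>c)
    then show ?thesis using e \<sigma> by (simp add: \<tau>_def norm_mult norm_minus_commute)
  next
    assume e: "e = -1"
    have "1 - \<sigma> * cis (- \<theta>) = cis (- \<theta>) * (cis \<theta> - \<sigma>)" by (simp add: algebra_simps cis_mult)
    then show ?thesis using e by (simp add: \<tau>_def norm_mult)
  qed
  let ?F = "\<lambda>\<rho> \<theta>. (1 - of_real \<rho> * \<sigma> * cis (of_int e * \<theta>)) powr (- z) * cis (- (of_int m * \<theta>))"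
  define D where "D = exp (pi * \<bar>Im z\<bar>) * 2 powr Re z"
  have lim: "(\<lambda>n. ?F (r n) \<theta>) \<longlonglongrightarrow> ?F 1 \<theta>" if "cis \<theta> \<noteq> \<tau>" for \<theta>
  proof -
    have ne: "1 - \<sigma> * cis (of_int e * \<theta>) \<noteq> 0" using dist[of \<theta>] that by auto
    have "Re (\<sigma> * cis (of_int e * \<theta>)) \<le> cmod (\<sigma> * cis (of_int e * \<theta>))" by (rule complex_Re_le_cmod)
    then have "Re (1 - \<sigma> * cis (of_int e * \<theta>)) \<ge> 0" using \<sigma> by (simp add: norm_mult)
    then have "1 - \<sigma> * cis (of_int e * \<theta>) \<notin> \<real>\<^sub>\<le>\<^sub>0"
      using ne by (auto simp: complex_nonpos_Reals_iff complex_eq_iff)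
    moreover have "(\<lambda>n. 1 - of_real (r n) * \<sigma> * cis (of_int e * \<theta>)) \<longlonglongrightarrow> 1 - of_real 1 * \<sigma> * cis (of_int e * \<theta>)"
      by (intro tendsto_intros r1)
    ultimately show ?thesis
      by (intro tendsto_mult tendsto_powr_complex tendsto_const) auto
  qed
  have bound: "cmod (?F (r n) \<theta>) \<le> D * cmod (cis \<theta> - \<tau>) powr (- Re z)" if "cis \<theta> \<noteq> \<tau>" for n \<theta>
  proof -
    define w where "w = \<sigma> * cis (of_int e * \<theta>)"
    have w1: "cmod w = 1" by (simp add: w_def norm_mult \<sigma>)
    have wd: "cmod (1 - w) = cmod (cis \<theta> - \<tau>)" using dist by (simp add: w_def)
    have le: "cmod (1 - w) \<le> 2 * cmod (1 - of_real (r n) * w)"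
      by (rule one_minus_scaled_ge) (use w1 r[of n] in auto)
    have pos: "0 < cmod (1 - w)" using wd that by simp
    then have "cmod ((1 - of_real (r n) * w) powr (- z)) \<le> exp (pi * \<bar>Im z\<bar>) * cmod (1 - of_real (r n) * w) powr (- Re z)"
      using le z by (intro norm_powr_minus_le) auto
    also have "cmod (1 - of_real (r n) * w) powr (- Re z) \<le> (cmod (1 - w) / 2) powr (- Re z)"
      using le pos z by (intro powr_mono2') auto
    also have "\<dots> = 2 powr Re z * cmod (1 - w) powr (- Re z)"
      by (simp add: powr_divide powr_minus_divide)
    finally show ?thesis by (simp add: norm_mult w_def[symmetric] mult.assoc D_def wd)
  qed
  have meas: "?F (r n) \<in> borel_measurable circ" for n
  proof (rule borel_measurable_lebesgue_on_borel, rule borel_measurable_continuous_onI)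
    have "Re (of_real (r n) * \<sigma> * cis (of_int e * \<theta>)) \<le> 1" for \<theta>
      using complex_Re_le_cmod[of "of_real (r n) * \<sigma> * cis (of_int e * \<theta>)"] r[of n] \<sigma>
      by (simp add: norm_mult)
    moreover have "1 - of_real (r n) * \<sigma> * cis (of_int e * \<theta>) \<noteq> 0" for \<theta>
    proof
      assume "1 - of_real (r n) * \<sigma> * cis (of_int e * \<theta>) = 0"
      then have "cmod (of_real (r n) * \<sigma> * cis (of_int e * \<theta>)) = 1" by simp
      then show False using r[of n] \<sigma> by (simp add: norm_mult)
    qed
    ultimately show "continuous_on UNIV (?F (r n))"
      by (intro continuous_intros) auto
  qed
  have ae: "AE \<theta> in circ. (\<lambda>n. ?F (r n) \<theta>) \<longlonglongrightarrow> ?F 1 \<theta>"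
    using AE_circ_neq[of \<tau>] lim by auto
  have bae: "AE \<theta> in circ. cmod (?F (r n) \<theta>) \<le> D * cmod (cis \<theta> - \<tau>) powr (- Re z)" for n
    using AE_circ_neq[of \<tau>] bound by auto
  have cism: "(\<lambda>\<theta>. cis (- (of_int m * \<theta>))) \<in> borel_measurable circ"
    by (intro borel_measurable_lebesgue_on_borel borel_measurable_continuous_onI continuous_intros)
  have meas1: "?F 1 \<in> borel_measurable circ"
    using borel_measurable_times[OF circle_powr_measurable[OF \<sigma> e] cism] by simp
  have "(\<lambda>n. integral\<^sup>L circ (?F (r n))) \<longlonglongrightarrow> integral\<^sup>L circ (?F 1)"
    using integral_dominated_convergence[OF meas1 meas _ ae bae]
      circle_singularity_integrable[OF \<tau> z] by simp
  moreover have "(\<lambda>n. integral\<^sup>L circ (?F (r n))) \<longlonglongrightarrow>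
      (if 0 \<le> e * m then 2 * of_real pi * binom_coeff z (nat (e * m)) * (1 * \<sigma>) ^ nat (e * m) else 0)"
    unfolding fourier_binomial_disc[OF \<sigma> r e]
    by (cases "0 \<le> e * m") (auto intro!: tendsto_power tendsto_mult_left tendsto_mult[OF r1c tendsto_const, simplified])
  ultimately show ?thesis using LIMSEQ_unique by fastforce
qed

text \<open>Up to the factor \<open>k / (k + z)\<close> the left-hand side is the sequence in Gauss's product for the reciprocal Gamma function.\<close>

lemma binom_coeff_asymp:
  "(\<lambda>k. binom_coeff z k * of_nat k powr (1 - z)) \<longlonglongrightarrow> rGamma z"
proof -
  have "(\<lambda>k. rGamma_series z k * (1 / (1 + z / of_nat k))) \<longlonglongrightarrow> rGamma z * (1 / (1 + 0))"
    by (intro tendsto_mult tendsto_divide tendsto_add tendsto_const rGamma_series_LIMSEQ lim_const_over_n) simp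
  moreover have "eventually (\<lambda>k. rGamma_series z k * (1 / (1 + z / of_nat k)) = binom_coeff z k * of_nat k powr (1 - z)) sequentially"
    using eventually_gt_at_top[of "nat \<lceil>cmod z\<rceil>"]
  proof eventually_elim
    case (elim k)
    then have k: "cmod z < real k" "0 < k" by linarith+
    have ne: "of_nat k + z \<noteq> 0"
    proof
      assume "of_nat k + z = 0"
      then have "z = - of_nat k" by (simp add: eq_neg_iff_add_eq_0 add.commute)
      then show False using k by simp
    qed
    have "of_nat k powr (1 - z) * exp (z * of_real (ln (real k))) = of_nat k"
      using k by (simp add: powr_def Ln_of_nat exp_diff left_diff_distrib exp_of_real)
    then have "of_nat k powr (1 - z) = of_nat k / exp (z * of_real (ln (real k)))"
      by (simp add: field_simps)
    moreover have "1 / (1 + z / of_nat k) = of_nat k / (of_nat k + z)"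
      using k by (simp add: field_simps)
    ultimately show ?case
      using ne by (simp add: rGamma_series_def binom_coeff_def pochhammer_Suc add.commute)
  qed
  ultimately show ?thesis by (simp add: Lim_transform_eventually)
qed

text \<open>With \<open>x = Arg (- z / \<tau>)\<close>, the function \<open>exp (\<i> * \<beta> * x)\<close> has to be matched at \<open>x = pi\<close> and at \<open>x = - pi\<close> by
  a combination of \<open>exp (- \<i> * \<alpha> * x)\<close> and \<open>exp (\<i> * \<alpha> * x)\<close>. The coefficients \<open>jump_plus\<close> and \<open>jump_minus\<close> solve this
  linear system.\<close>

definition jump_plus :: "complex \<Rightarrow> complex \<Rightarrow> complex" where
  "jump_plus \<alpha> \<beta> = sin (of_real pi * (\<alpha> - \<beta>)) / sin (of_real pi * (2 * \<alpha>))"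

definition jump_minus :: "complex \<Rightarrow> complex \<Rightarrow> complex" where
  "jump_minus \<alpha> \<beta> = sin (of_real pi * (\<alpha> + \<beta>)) / sin (of_real pi * (2 * \<alpha>))"

text \<open>Divided by \<open>\<bar>z - \<tau>\<bar> powr (- 2 * \<alpha>)\<close>, this symbol has the same one-sided limits at \<open>\<tau>\<close> as the Fisher--Hartwig factor.\<close>

definition model :: "complex \<Rightarrow> complex \<Rightarrow> complex \<Rightarrow> complex \<Rightarrow> complex" where
  "model \<alpha> \<beta> \<tau> z = jump_plus \<alpha> \<beta> * (1 - z / \<tau>) powr (- (2 * \<alpha>)) + jump_minus \<alpha> \<beta> * (1 - \<tau> / z) powr (- (2 * \<alpha>))"

text \<open>The Fourier coefficients of \<open>model \<alpha> \<beta> 1\<close>; both terms contribute at \<open>m = 0\<close>.\<close>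

definition model_coeff :: "complex \<Rightarrow> complex \<Rightarrow> int \<Rightarrow> complex" where
  "model_coeff \<alpha> \<beta> m = (if 0 \<le> m then jump_plus \<alpha> \<beta> * binom_coeff (2 * \<alpha>) (nat m) else 0)
     + (if m \<le> 0 then jump_minus \<alpha> \<beta> * binom_coeff (2 * \<alpha>) (nat (- m)) else 0)"

lemma not_nonpos_Int: "0 < Re z \<Longrightarrow> z \<notin> \<int>\<^sub>\<le>\<^sub>0"
  by (auto elim!: nonpos_Ints_cases)

text \<open>Euler's reflection formula.\<close>

lemma sin_pi_eq:
  assumes "0 < Re z" "Re z < 1"
  shows "sin (of_real pi * z) \<noteq> 0" "rGamma z = Gamma (1 - z) * sin (of_real pi * z) / of_real pi"
proof -
  have 0: "rGamma z \<noteq> 0" "rGamma (1 - z) \<noteq> 0"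
    using assms by (auto simp: rGamma_eq_zero_iff not_nonpos_Int)
  then show "sin (of_real pi * z) \<noteq> 0"
    using rGamma_reflection_complex[of z] by auto
  show "rGamma z = Gamma (1 - z) * sin (of_real pi * z) / of_real pi"
    using rGamma_reflection_complex[of z] 0 by (simp add: Gamma_def field_simps)
qed

text \<open>The reflection formula turns \<open>jump_plus \<alpha> \<beta> / Gamma (2 * \<alpha>)\<close> into \<open>C_plus \<alpha> \<beta>\<close>, and likewise for the other sign.\<close>

lemma model_coeff_asymp:
  assumes "0 < Re \<alpha>" "Re \<alpha> < 1 / 2"
  shows "(\<lambda>k. model_coeff \<alpha> \<beta> (int k) * of_nat k powr (1 - 2 * \<alpha>)) \<longlonglongrightarrow> C_plus \<alpha> \<beta>"
    and "(\<lambda>k. model_coeff \<alpha> \<beta> (- int k) * of_nat k powr (1 - 2 * \<alpha>)) \<longlonglongrightarrow> C_minus \<alpha> \<beta>"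
proof -
  have s: "0 < Re (2 * \<alpha>)" "Re (2 * \<alpha>) < 1" using assms by auto
  have ev: "eventually (\<lambda>k. 0 < k) sequentially" by (rule eventually_gt_at_top)
  have "jump_plus \<alpha> \<beta> * rGamma (2 * \<alpha>) = C_plus \<alpha> \<beta>"
    using sin_pi_eq[OF s] by (simp add: jump_plus_def C_plus_def)
  then have "(\<lambda>k. jump_plus \<alpha> \<beta> * (binom_coeff (2 * \<alpha>) k * of_nat k powr (1 - 2 * \<alpha>))) \<longlonglongrightarrow> C_plus \<alpha> \<beta>"
    using tendsto_mult_left[OF binom_coeff_asymp[of "2 * \<alpha>"], of "jump_plus \<alpha> \<beta>"] by simp
  then show "(\<lambda>k. model_coeff \<alpha> \<beta> (int k) * of_nat k powr (1 - 2 * \<alpha>)) \<longlonglongrightarrow> C_plus \<alpha> \<beta>"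
    by (rule Lim_transform_eventually)
      (use ev in eventually_elim, simp add: model_coeff_def mult.assoc)
  have "jump_minus \<alpha> \<beta> * rGamma (2 * \<alpha>) = C_minus \<alpha> \<beta>"
    using sin_pi_eq[OF s] by (simp add: jump_minus_def C_minus_def)
  then have "(\<lambda>k. jump_minus \<alpha> \<beta> * (binom_coeff (2 * \<alpha>) k * of_nat k powr (1 - 2 * \<alpha>))) \<longlonglongrightarrow> C_minus \<alpha> \<beta>"
    using tendsto_mult_left[OF binom_coeff_asymp[of "2 * \<alpha>"], of "jump_minus \<alpha> \<beta>"] by simp
  then show "(\<lambda>k. model_coeff \<alpha> \<beta> (- int k) * of_nat k powr (1 - 2 * \<alpha>)) \<longlonglongrightarrow> C_minus \<alpha> \<beta>"
    by (rule Lim_transform_eventually)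
      (use ev in eventually_elim, simp add: model_coeff_def mult.assoc)
qed

text \<open>Since \<open>- z / \<tau> = cis x\<close>, one has \<open>1 - z / \<tau> = 1 + cis x = 2 * cos (x / 2) * cis (x / 2)\<close> with
  \<open>\<bar>x / 2\<bar> < pi / 2\<close>, so modulus and argument can be read off.\<close>

lemma circle_polar:
  assumes "cmod \<tau> = 1" "cmod z = 1" "z \<noteq> \<tau>"
  defines "x \<equiv> Arg (- z / \<tau>)"
  shows "\<bar>x\<bar> = 2 * arccos (cmod (z - \<tau>) / 2)"
    and "(1 - z / \<tau>) powr (- (2 * \<alpha>)) = of_real (cmod (z - \<tau>)) powr (- 2 * \<alpha>) * exp (- (\<i> * \<alpha> * of_real x))"
    and "(1 - \<tau> / z) powr (- (2 * \<alpha>)) = of_real (cmod (z - \<tau>)) powr (- 2 * \<alpha>) * exp (\<i> * \<alpha> * of_real x)"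
proof -
  have ne: "\<tau> \<noteq> 0" "z \<noteq> 0" using assms by auto
  have cx: "cis x = - z / \<tau>"
    using cis_Arg[of "- z / \<tau>"] ne assms by (simp add: x_def sgn_div_norm norm_divide)
  have xb: "- pi < x" "x \<le> pi" using Arg_bounded[of "- z / \<tau>"] by (auto simp: x_def)
  have "x \<noteq> pi"
  proof
    assume "x = pi"
    then have "z / \<tau> = 1" using cx by simp
    then show False using assms ne by simp
  qed
  then have xp: "\<bar>x\<bar> < pi" using xb by auto
  have cpos: "0 < cos (x / 2)" using xp by (intro cos_gt_zero_pi) auto
  have half: "1 + cis y = of_real (2 * cos (y / 2)) * cis (y / 2)" for y
    using cos_double_cos[of "y / 2"] sin_double[of "y / 2"] by (simp add: complex_eq_iff power2_eq_square)
  have w1: "1 - z / \<tau> = of_real (2 * cos (x / 2)) * cis (x / 2)"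
    using cx half[of x] by simp
  have w2: "1 - \<tau> / z = of_real (2 * cos (x / 2)) * cis (- (x / 2))"
  proof -
    have "cis (- x) = - \<tau> / z" using cx ne by (simp flip: cis_inverse)
    then show ?thesis using half[of "- x"] by simp
  qed
  have mod: "cmod (z - \<tau>) = 2 * cos (x / 2)"
  proof -
    have "cmod (1 - z / \<tau>) = cmod (z - \<tau>)"
      using ne assms by (simp add: diff_divide_eq_iff norm_divide norm_minus_commute)
    then show ?thesis unfolding w1 using cpos by (simp add: norm_mult)
  qed
  show "\<bar>x\<bar> = 2 * arccos (cmod (z - \<tau>) / 2)"
  proof -
    have "arccos (cos (\<bar>x\<bar> / 2)) = \<bar>x\<bar> / 2" using xp by (intro arccos_cos) auto
    moreover have "cos (\<bar>x\<bar> / 2) = cos (x / 2)" by (cases "0 \<le> x") (auto simp: abs_if)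
    ultimately show ?thesis by (simp add: mod)
  qed
  have key: "(of_real d * cis y) powr (- (2 * \<alpha>)) = of_real d powr (- 2 * \<alpha>) * exp (- (\<i> * (2 * \<alpha>) * of_real y))"
    if "0 < d" "\<bar>y\<bar> < pi" for d y
  proof -
    have "Ln (of_real d * cis y) = Complex (ln d) y"
      using that Ln_rcis[of d y] by (simp add: rcis_def abs_less_iff)
    then have "Ln (of_real d * cis y) = of_real (ln d) + \<i> * of_real y" by (simp add: Complex_eq)
    then have "(of_real d * cis y) powr (- (2 * \<alpha>)) = exp (- (2 * \<alpha>) * (of_real (ln d) + \<i> * of_real y))"
      using that by (simp add: powr_def)
    also have "\<dots> = exp (- (2 * \<alpha>) * of_real (ln d)) * exp (- (\<i> * (2 * \<alpha>) * of_real y))"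
      by (simp add: algebra_simps flip: exp_add)
    also have "exp (- (2 * \<alpha>) * of_real (ln d)) = of_real d powr (- 2 * \<alpha>)"
      using that by (simp add: powr_def Ln_of_real)
    finally show ?thesis .
  qed
  show "(1 - z / \<tau>) powr (- (2 * \<alpha>)) = of_real (cmod (z - \<tau>)) powr (- 2 * \<alpha>) * exp (- (\<i> * \<alpha> * of_real x))"
    unfolding w1 mod using key[of "2 * cos (x / 2)" "x / 2"] cpos xp by (simp add: mult.assoc)
  show "(1 - \<tau> / z) powr (- (2 * \<alpha>)) = of_real (cmod (z - \<tau>)) powr (- 2 * \<alpha>) * exp (\<i> * \<alpha> * of_real x)"
    unfolding w2 mod using key[of "2 * cos (x / 2)" "- (x / 2)"] cpos xp by (simp add: mult.assoc)
qed

lemma exp_ii_bound: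
  assumes "\<bar>x\<bar> \<le> pi"
  shows "cmod (exp (\<i> * \<gamma> * of_real x)) \<le> exp (pi * \<bar>Im \<gamma>\<bar>)"
proof -
  have "- (Im \<gamma> * x) \<le> \<bar>Im \<gamma>\<bar> * \<bar>x\<bar>" using abs_ge_minus_self[of "Im \<gamma> * x"] by (simp add: abs_mult)
  also have "\<dots> \<le> \<bar>Im \<gamma>\<bar> * pi" using assms by (intro mult_left_mono) auto
  finally show ?thesis by (simp add: mult.commute)
qed

lemma Arg_abs_le: "\<bar>Arg z\<bar> \<le> pi"
  using Arg_bounded[of z] by auto

lemma norm_of_real_powr: "0 \<le> d \<Longrightarrow> cmod (of_real d powr \<gamma>) = d powr Re \<gamma>"
  by (simp add: norm_powr_real_powr)

text \<open>The difference between the Fisher--Hartwig factor and the model symbol, after division by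
  \<open>\<bar>z - \<tau>\<bar> powr (- 2 * \<alpha>)\<close>, as a function of \<open>x = Arg (- z / \<tau>)\<close>.\<close>

definition mismatch :: "complex \<Rightarrow> complex \<Rightarrow> real \<Rightarrow> complex" where
  "mismatch \<alpha> \<beta> x = exp (\<i> * \<beta> * of_real x)
     - (jump_plus \<alpha> \<beta> * exp (- (\<i> * \<alpha> * of_real x)) + jump_minus \<alpha> \<beta> * exp (\<i> * \<alpha> * of_real x))"

text \<open>The addition theorems, applied to the equations that define \<open>jump_plus\<close> and \<open>jump_minus\<close>.\<close>

lemma mismatch_pi:
  assumes "0 < Re \<alpha>" "Re \<alpha> < 1 / 2"
  shows "mismatch \<alpha> \<beta> pi = 0" "mismatch \<alpha> \<beta> (- pi) = 0"
proof -
  define P where "P = of_real pi * \<alpha>"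
  define Q where "Q = of_real pi * \<beta>"
  have s2: "sin (2 * P) \<noteq> 0"
    using sin_pi_eq(1)[of "2 * \<alpha>"] assms by (simp add: P_def mult_ac)
  have jp: "jump_plus \<alpha> \<beta> = sin (P - Q) / sin (2 * P)"
    by (simp add: jump_plus_def P_def Q_def algebra_simps)
  have jm: "jump_minus \<alpha> \<beta> = sin (P + Q) / sin (2 * P)"
    by (simp add: jump_minus_def P_def Q_def algebra_simps)
  have e: "exp (\<i> * z) = cos z + \<i> * sin z" "exp (- (\<i> * z)) = cos z - \<i> * sin z" for z
    using exp_Euler[of z] exp_minus_Euler[of z] by simp_all
  have 1: "sin (P - Q) * (cos P - \<i> * sin P) + sin (P + Q) * (cos P + \<i> * sin P) = sin (2 * P) * (cos Q + \<i> * sin Q)"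
    unfolding sin_diff sin_add sin_double by (simp add: algebra_simps)
  have 2: "sin (P - Q) * (cos P + \<i> * sin P) + sin (P + Q) * (cos P - \<i> * sin P) = sin (2 * P) * (cos Q - \<i> * sin Q)"
    unfolding sin_diff sin_add sin_double by (simp add: algebra_simps)
  have r: "\<i> * \<beta> * of_real pi = \<i> * Q" "\<i> * \<alpha> * of_real pi = \<i> * P"
    "\<i> * \<beta> * of_real (- pi) = - (\<i> * Q)" "\<i> * \<alpha> * of_real (- pi) = - (\<i> * P)"
    by (simp_all add: P_def Q_def mult_ac)
  show "mismatch \<alpha> \<beta> pi = 0"
    unfolding mismatch_def r e jp jm using 1 s2 by (simp add: divide_simps)
  show "mismatch \<alpha> \<beta> (- pi) = 0"
    unfolding mismatch_def r minus_minus e jp jm using 2 s2 by (simp add: divide_simps)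
qed

lemma fh_minus_model:
  assumes "cmod \<tau> = 1" "cmod z = 1"
  shows "fh_factor \<alpha> \<beta> \<tau> z - model \<alpha> \<beta> \<tau> z
    = of_real (cmod (z - \<tau>)) powr (- 2 * \<alpha>) * mismatch \<alpha> \<beta> (Arg (- z / \<tau>))"
proof (cases "z = \<tau>")
  case True
  then show ?thesis using assms by (auto simp: fh_factor_def model_def)
next
  case False
  show ?thesis
    unfolding fh_factor_def model_def phi_def mismatch_def
      circle_polar(2)[OF assms False] circle_polar(3)[OF assms False]
    by (simp add: algebra_simps)
qed

lemma fh_le:
  "cmod (fh_factor \<alpha> \<beta> \<tau> z) \<le> exp (pi * \<bar>Im \<beta>\<bar>) * cmod (z - \<tau>) powr (- (2 * Re \<alpha>))"
proof -
  have "cmod (of_real (cmod (z - \<tau>)) powr (- 2 * \<alpha>)) = cmod (z - \<tau>) powr (- (2 * Re \<alpha>))"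
    by (simp add: norm_of_real_powr)
  then show ?thesis
    unfolding fh_factor_def phi_def norm_mult
    by (metis exp_ii_bound[OF Arg_abs_le] mult.commute mult_right_mono powr_ge_zero)
qed

lemma mismatch_bounded: "\<exists>K\<ge>0. \<forall>x. \<bar>x\<bar> \<le> pi \<longrightarrow> cmod (mismatch \<alpha> \<beta> x) \<le> K"
proof -
  let ?e = "exp (pi * \<bar>Im \<alpha>\<bar>)"
  let ?K = "exp (pi * \<bar>Im \<beta>\<bar>) + (cmod (jump_plus \<alpha> \<beta>) * ?e + cmod (jump_minus \<alpha> \<beta>) * ?e)"
  have "cmod (mismatch \<alpha> \<beta> x) \<le> ?K" if "\<bar>x\<bar> \<le> pi" for x
    unfolding mismatch_def
    using exp_ii_bound[OF that, of \<beta>] exp_ii_bound[OF that, of \<alpha>] exp_ii_bound[of "- x" \<alpha>] that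
    by (intro order_trans[OF norm_triangle_ineq4] add_mono order_trans[OF norm_triangle_ineq])
      (simp_all add: norm_mult mult_left_mono)
  then show ?thesis by (intro exI[of _ ?K]) auto
qed

lemma model_le:
  assumes "cmod \<tau> = 1"
  shows "\<exists>K\<ge>0. \<forall>z. cmod z = 1 \<longrightarrow> cmod (model \<alpha> \<beta> \<tau> z) \<le> K * cmod (z - \<tau>) powr (- (2 * Re \<alpha>))"
proof -
  obtain K where K: "K \<ge> 0" "\<And>x. \<bar>x\<bar> \<le> pi \<Longrightarrow> cmod (mismatch \<alpha> \<beta> x) \<le> K"
    using mismatch_bounded by blast
  have "cmod (model \<alpha> \<beta> \<tau> z) \<le> (exp (pi * \<bar>Im \<beta>\<bar>) + K) * cmod (z - \<tau>) powr (- (2 * Re \<alpha>))" if "cmod z = 1" for z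
  proof -
    have "model \<alpha> \<beta> \<tau> z = fh_factor \<alpha> \<beta> \<tau> z - of_real (cmod (z - \<tau>)) powr (- 2 * \<alpha>) * mismatch \<alpha> \<beta> (Arg (- z / \<tau>))"
      using fh_minus_model[OF assms that, of \<alpha> \<beta>] by (simp add: algebra_simps)
    then have "cmod (model \<alpha> \<beta> \<tau> z) \<le> cmod (fh_factor \<alpha> \<beta> \<tau> z)
        + cmod (of_real (cmod (z - \<tau>)) powr (- 2 * \<alpha>) * mismatch \<alpha> \<beta> (Arg (- z / \<tau>)))"
      by (metis norm_triangle_ineq4)
    also have "\<dots> \<le> exp (pi * \<bar>Im \<beta>\<bar>) * cmod (z - \<tau>) powr (- (2 * Re \<alpha>)) + cmod (z - \<tau>) powr (- (2 * Re \<alpha>)) * K"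
      unfolding norm_mult
      by (intro add_mono fh_le mult_mono K Arg_abs_le) (auto simp: norm_of_real_powr)
    finally show ?thesis by (simp add: algebra_simps)
  qed
  then show ?thesis using K(1) by (intro exI[of _ "exp (pi * \<bar>Im \<beta>\<bar>) + K"]) auto
qed

text \<open>As \<open>z\<close> tends to \<open>\<tau>\<close>, the angle \<open>x\<close> tends to \<open>pi\<close> or to \<open>- pi\<close>, where the mismatch vanishes.\<close>

lemma fh_model_close:
  assumes \<tau>: "cmod \<tau> = 1" and \<alpha>: "0 < Re \<alpha>" "Re \<alpha> < 1 / 2" and \<epsilon>: "0 < \<epsilon>"
  shows "\<exists>\<delta>>0. \<forall>z. cmod z = 1 \<longrightarrow> cmod (z - \<tau>) < \<delta> \<longrightarrow>
    cmod (fh_factor \<alpha> \<beta> \<tau> z - model \<alpha> \<beta> \<tau> z) \<le> \<epsilon> * cmod (z - \<tau>) powr (- (2 * Re \<alpha>))"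
proof -
  have tend: "((\<lambda>d. mismatch \<alpha> \<beta> (c * arccos (d / 2))) \<longlongrightarrow> 0) (at 0)" if c: "c = 2 \<or> c = -2" for c :: real
  proof -
    have "((\<lambda>d. arccos (d / 2)) \<longlongrightarrow> arccos (0 / 2)) (at (0::real))"
      by (rule tendsto_eq_rhs, rule isCont_tendsto_compose[OF isCont_arccos]) (auto intro!: tendsto_eq_intros)
    then have "((\<lambda>d. mismatch \<alpha> \<beta> (c * arccos (d / 2))) \<longlongrightarrow> mismatch \<alpha> \<beta> (c * arccos (0 / 2))) (at 0)"
      unfolding mismatch_def by (intro tendsto_intros)
    moreover have "mismatch \<alpha> \<beta> (c * arccos (0 / 2)) = 0"
      using c mismatch_pi[OF \<alpha>] by auto
    ultimately show ?thesis by simp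
  qed
  have "\<exists>\<delta>>0. \<forall>d. d \<noteq> 0 \<and> \<bar>d\<bar> < \<delta> \<longrightarrow> cmod (mismatch \<alpha> \<beta> (c * arccos (d / 2))) < \<epsilon>" if "c = 2 \<or> c = -2" for c :: real
    using tend[OF that] \<epsilon> unfolding Lim_at by (auto simp: dist_norm)
  then obtain \<delta>1 \<delta>2 where \<delta>: "\<delta>1 > 0" "\<delta>2 > 0"
    and 1: "\<And>d. d \<noteq> 0 \<Longrightarrow> \<bar>d\<bar> < \<delta>1 \<Longrightarrow> cmod (mismatch \<alpha> \<beta> (2 * arccos (d / 2))) < \<epsilon>"
    and 2: "\<And>d. d \<noteq> 0 \<Longrightarrow> \<bar>d\<bar> < \<delta>2 \<Longrightarrow> cmod (mismatch \<alpha> \<beta> (- 2 * arccos (d / 2))) < \<epsilon>"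
    by (metis (no_types))
  show ?thesis
  proof (intro exI[of _ "min \<delta>1 \<delta>2"] conjI allI impI)
    show "0 < min \<delta>1 \<delta>2" using \<delta> by simp
    fix z :: complex assume z: "cmod z = 1" "cmod (z - \<tau>) < min \<delta>1 \<delta>2"
    show "cmod (fh_factor \<alpha> \<beta> \<tau> z - model \<alpha> \<beta> \<tau> z) \<le> \<epsilon> * cmod (z - \<tau>) powr (- (2 * Re \<alpha>))"
    proof (cases "z = \<tau>")
      case True
      then show ?thesis using fh_minus_model[OF \<tau> z(1), of \<alpha> \<beta>] by simp
    next
      case False
      define x where "x = Arg (- z / \<tau>)"
      have "\<bar>x\<bar> = 2 * arccos (cmod (z - \<tau>) / 2)"
        unfolding x_def by (rule circle_polar(1)[OF \<tau> z(1) False])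
      then have "x = 2 * arccos (cmod (z - \<tau>) / 2) \<or> x = - 2 * arccos (cmod (z - \<tau>) / 2)" by linarith
      then have "cmod (mismatch \<alpha> \<beta> x) \<le> \<epsilon>"
        using 1[of "cmod (z - \<tau>)"] 2[of "cmod (z - \<tau>)"] False z by auto
      then have "cmod (z - \<tau>) powr (- (2 * Re \<alpha>)) * cmod (mismatch \<alpha> \<beta> x) \<le> cmod (z - \<tau>) powr (- (2 * Re \<alpha>)) * \<epsilon>"
        by (rule mult_left_mono) simp
      then show ?thesis
        unfolding fh_minus_model[OF \<tau> z(1)] norm_mult by (simp add: norm_of_real_powr x_def mult.commute)
    qed
  qed
qed

lemma model_measurable:
  assumes "cmod \<tau> = 1"
  shows "(\<lambda>\<theta>. model \<alpha> \<beta> \<tau> (cis \<theta>)) \<in> borel_measurable (lebesgue_on S)"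
proof -
  have "cmod (inverse \<tau>) = 1" using assms by (simp add: norm_inverse)
  from circle_powr_measurable[OF this, of 1 "2 * \<alpha>" S] circle_powr_measurable[OF assms, of "-1" "2 * \<alpha>" S]
  show ?thesis
    unfolding model_def divide_inverse cis_inverse
    by (intro borel_measurable_add borel_measurable_times borel_measurable_const) (simp_all add: mult.commute)
qed

lemma fh_measurable:
  assumes \<tau>: "cmod \<tau> = 1"
  shows "(\<lambda>\<theta>. fh_factor \<alpha> \<beta> \<tau> (cis \<theta>)) \<in> borel_measurable (lebesgue_on S)"
proof (rule borel_measurable_lebesgue_on_borel)
  let ?A = "{\<theta>. cis \<theta> \<noteq> \<tau>}"
  let ?F = "\<lambda>\<theta>. fh_factor \<alpha> \<beta> \<tau> (cis \<theta>)"
  have ne: "\<tau> \<noteq> 0" using \<tau> by auto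
  have "open ?A" by (intro open_Collect_neq continuous_intros)
  then have op: "?A \<in> sets borel" by simp
  have "(\<lambda>\<theta>. indicator ?A \<theta> *\<^sub>R ?F \<theta>) \<in> borel_measurable borel"
  proof (rule borel_measurable_continuous_on_indicator[OF op])
    have np: "- cis \<theta> / \<tau> \<notin> \<real>\<^sub>\<le>\<^sub>0" if "cis \<theta> \<noteq> \<tau>" for \<theta>
    proof
      assume "- cis \<theta> / \<tau> \<in> \<real>\<^sub>\<le>\<^sub>0"
      then obtain y where y: "- cis \<theta> / \<tau> = of_real y" "y \<le> 0" by (elim nonpos_Reals_cases)
      have "cmod (- cis \<theta> / \<tau>) = 1" using \<tau> by (simp add: norm_divide)
      then have "\<bar>y\<bar> = 1" by (metis y(1) norm_of_real)
      then have "y = -1" using y(2) by simp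
      then have "cis \<theta> / \<tau> = 1" using y(1) by (metis minus_divide_left neg_equal_iff_equal of_real_1 of_real_minus)
      then show False using ne that by simp
    qed
    show "continuous_on ?A ?F"
      unfolding fh_factor_def phi_def using np by (intro continuous_intros) (auto simp: ne)
  qed
  moreover have "indicator ?A \<theta> *\<^sub>R ?F \<theta> = ?F \<theta>" for \<theta>
    by (cases "\<theta> \<in> ?A") (auto simp: fh_factor_def)
  ultimately show "?F \<in> borel_measurable borel" by simp
qed

text \<open>The factor \<open>\<tau> powr (k - j)\<close> comes out of the binomial series. It is split over the two indices because it
  will be moved into the test vectors.\<close>

lemma fourier_coeff_model:
  assumes \<tau>: "cmod \<tau> = 1" and \<alpha>: "0 < Re \<alpha>" "Re \<alpha> < 1 / 2"
  shows "fourier_coeff (model \<alpha> \<beta> \<tau>) (int j - int k)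
    = cnj \<tau> ^ j * \<tau> ^ k * model_coeff \<alpha> \<beta> (int j - int k)"
proof -
  let ?m = "int j - int k"
  have s: "0 < Re (2 * \<alpha>)" "Re (2 * \<alpha>) < 1" using \<alpha> by auto
  have ct: "cmod (cnj \<tau>) = 1" using \<tau> by simp
  have tt: "cnj \<tau> * \<tau> = 1" using \<tau> by (simp add: mult.commute flip: complex_norm_square)
  have ne: "\<tau> \<noteq> 0" using \<tau> by auto
  have inv: "inverse \<tau> = cnj \<tau>" using tt ne by (metis inverse_unique mult.commute)
  let ?F = "\<lambda>\<sigma> (e::int) \<theta>. (1 - \<sigma> * cis (of_int e * \<theta>)) powr (- (2 * \<alpha>)) * cis (- (of_int ?m * \<theta>))"
  have int: "integrable circ (?F \<sigma> e)" if \<sigma>: "cmod \<sigma> = 1" and e: "e = 1 \<or> e = (-1::int)" and \<sigma>\<tau>: "\<sigma> = (if e = 1 then cnj \<tau> else \<tau>)" for \<sigma> e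
  proof (rule Bochner_Integration.integrable_bound)
    show "integrable circ (\<lambda>\<theta>. exp (pi * \<bar>Im (2 * \<alpha>)\<bar>) * cmod (cis \<theta> - \<tau>) powr (- Re (2 * \<alpha>)))"
      by (intro integrable_mult_right circle_singularity_integrable \<tau> s)
    have cism: "(\<lambda>\<theta>. cis (- (x * \<theta>))) \<in> borel_measurable circ" for x
      by (intro borel_measurable_lebesgue_on_borel borel_measurable_continuous_onI continuous_intros)
    show "?F \<sigma> e \<in> borel_measurable circ"
      by (intro borel_measurable_times circle_powr_measurable \<sigma> e cism)
    show "AE \<theta> in circ. norm (?F \<sigma> e \<theta>) \<le> norm (exp (pi * \<bar>Im (2 * \<alpha>)\<bar>) * cmod (cis \<theta> - \<tau>) powr (- Re (2 * \<alpha>)))"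
    proof (rule AE_I2)
      fix \<theta>
      have d: "cmod (1 - \<sigma> * cis (of_int e * \<theta>)) = cmod (cis \<theta> - \<tau>)"
        using e
      proof
        assume e: "e = 1"
        have "1 - cnj \<tau> * cis \<theta> = cnj \<tau> * (\<tau> - cis \<theta>)" by (simp only: right_diff_distrib tt)
        then show ?thesis using e \<sigma>\<tau> \<tau> by (simp add: norm_mult norm_minus_commute)
      next
        assume e: "e = -1"
        have "1 - \<tau> * cis (- \<theta>) = cis (- \<theta>) * (cis \<theta> - \<tau>)" by (simp add: algebra_simps cis_mult)
        then show ?thesis using e \<sigma>\<tau> by (simp add: norm_mult)
      qed
      show "norm (?F \<sigma> e \<theta>) \<le> norm (exp (pi * \<bar>Im (2 * \<alpha>)\<bar>) * cmod (cis \<theta> - \<tau>) powr (- Re (2 * \<alpha>)))"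
      proof (cases "cis \<theta> = \<tau>")
        case True
        then show ?thesis using d by simp
      next
        case False
        then have "1 - \<sigma> * cis (of_int e * \<theta>) \<noteq> 0" using d by auto
        then show ?thesis
          using norm_powr_minus_le[of "2 * \<alpha>" "1 - \<sigma> * cis (of_int e * \<theta>)"] d s
          by (simp add: norm_mult)
      qed
    qed
  qed
  have eq: "model \<alpha> \<beta> \<tau> (cis \<theta>) * cis (- (of_int ?m * \<theta>))
      = jump_plus \<alpha> \<beta> * ?F (cnj \<tau>) 1 \<theta> + jump_minus \<alpha> \<beta> * ?F \<tau> (-1) \<theta>" for \<theta>
    unfolding model_def divide_inverse cis_inverse inv by (simp add: algebra_simps)
  have p: "nat ?m = j - k" "nat (- ?m) = k - j" "nat (int k - int j) = k - j" by auto
  have c1: "cnj \<tau> ^ (j - k) = cnj \<tau> ^ j * \<tau> ^ k" if "k \<le> j"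
  proof -
    have "cnj \<tau> ^ j * \<tau> ^ k = cnj \<tau> ^ (j - k) * (cnj \<tau> * \<tau>) ^ k"
      using that by (simp add: power_mult_distrib mult.assoc[symmetric] flip: power_add)
    then show ?thesis by (simp add: tt)
  qed
  have c2: "\<tau> ^ (k - j) = cnj \<tau> ^ j * \<tau> ^ k" if "j \<le> k"
  proof -
    have "cnj \<tau> ^ j * \<tau> ^ k = (cnj \<tau> * \<tau>) ^ j * \<tau> ^ (k - j)"
      using that by (simp add: power_mult_distrib mult.assoc flip: power_add)
    then show ?thesis by (simp add: tt)
  qed
  have I1: "(LINT \<theta>|circ. ?F (cnj \<tau>) 1 \<theta>) = (if 0 \<le> ?m then 2 * of_real pi * binom_coeff (2 * \<alpha>) (j - k) * cnj \<tau> ^ (j - k) else 0)"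
    using fourier_binomial_circle[OF ct s, of 1 ?m] by (simp add: p)
  have I2: "(LINT \<theta>|circ. ?F \<tau> (-1) \<theta>) = (if ?m \<le> 0 then 2 * of_real pi * binom_coeff (2 * \<alpha>) (k - j) * \<tau> ^ (k - j) else 0)"
    using fourier_binomial_circle[OF \<tau> s, of "-1" ?m] by (simp add: p)
  have "(LINT \<theta>|circ. model \<alpha> \<beta> \<tau> (cis \<theta>) * cis (- (of_int ?m * \<theta>)))
    = jump_plus \<alpha> \<beta> * (LINT \<theta>|circ. ?F (cnj \<tau>) 1 \<theta>) + jump_minus \<alpha> \<beta> * (LINT \<theta>|circ. ?F \<tau> (-1) \<theta>)"
    unfolding eq using int[OF ct, of 1] int[OF \<tau>, of "-1"]
    by (subst Bochner_Integration.integral_add) auto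
  also have "\<dots> = 2 * of_real pi * (cnj \<tau> ^ j * \<tau> ^ k * model_coeff \<alpha> \<beta> ?m)"
    unfolding I1 I2 model_coeff_def p using c1 c2 by (auto simp: algebra_simps)
  finally show ?thesis by (simp add: fourier_coeff_def)
qed

section \<open>Splitting off the model symbols\<close>

lemma circle_Linf_bounded:
  assumes "br \<in> circle_Linf"
  shows "\<exists>B\<ge>0. AE \<theta> in circ. cmod (br (cis \<theta>)) \<le> B"
proof -
  obtain B where B: "AE \<theta> in circ. cmod (br (cis \<theta>)) \<le> B"
    using assms by (auto simp: circle_Linf_def circle_AE_def)
  have "AE \<theta> in circ. cmod (br (cis \<theta>)) \<le> \<bar>B\<bar>"
    using B by eventually_elim auto
  then show ?thesis by (intro exI[of _ "\<bar>B\<bar>"]) auto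
qed

text \<open>Close to \<open>\<tau>\<close> both \<open>br\<close> and the model symbol approximate well; the rest of the circle is covered by the constant.\<close>

lemma dominant_residual:
  assumes \<tau>: "cmod \<tau> = 1" and \<alpha>: "0 < Re \<alpha>" "Re \<alpha> < 1 / 2" and \<epsilon>: "0 < \<epsilon>"
    and br: "br \<in> circle_Linf" and cont: "continuous (at \<tau> within sphere 0 1) br"
  shows "\<exists>C\<ge>0. AE \<theta> in circ. cmod (fh_factor \<alpha> \<beta> \<tau> (cis \<theta>) * br (cis \<theta>) - br \<tau> * model \<alpha> \<beta> \<tau> (cis \<theta>))
    \<le> \<epsilon> * cmod (cis \<theta> - \<tau>) powr (- (2 * Re \<alpha>)) + C"
proof -
  define K where "K = exp (pi * \<bar>Im \<beta>\<bar>)"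
  have K: "K > 0" by (simp add: K_def)
  obtain L where L: "L \<ge> 0" "\<And>z. cmod z = 1 \<Longrightarrow> cmod (model \<alpha> \<beta> \<tau> z) \<le> L * cmod (z - \<tau>) powr (- (2 * Re \<alpha>))"
    using model_le[OF \<tau>] by blast
  obtain B where B: "B \<ge> 0" "AE \<theta> in circ. cmod (br (cis \<theta>)) \<le> B"
    using circle_Linf_bounded[OF br] by blast
  have "0 < \<epsilon> / (2 * K)" using \<epsilon> K by simp
  then obtain \<delta>1 where \<delta>1: "\<delta>1 > 0" "\<And>z. cmod z = 1 \<Longrightarrow> cmod (z - \<tau>) < \<delta>1 \<Longrightarrow> cmod (br z - br \<tau>) < \<epsilon> / (2 * K)"
    using cont unfolding continuous_within_eps_delta by (auto simp: dist_norm)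
  have "0 < \<epsilon> / (2 * (cmod (br \<tau>) + 1))" using \<epsilon> by (simp add: add_nonneg_pos)
  then obtain \<delta>2 where \<delta>2: "\<delta>2 > 0" "\<And>z. cmod z = 1 \<Longrightarrow> cmod (z - \<tau>) < \<delta>2 \<Longrightarrow>
      cmod (fh_factor \<alpha> \<beta> \<tau> z - model \<alpha> \<beta> \<tau> z) \<le> \<epsilon> / (2 * (cmod (br \<tau>) + 1)) * cmod (z - \<tau>) powr (- (2 * Re \<alpha>))"
    using fh_model_close[OF \<tau> \<alpha>] by blast
  define \<delta> where "\<delta> = min \<delta>1 \<delta>2"
  have \<delta>: "\<delta> > 0" using \<delta>1 \<delta>2 by (simp add: \<delta>_def)
  define C where "C = (K * B + cmod (br \<tau>) * L) * \<delta> powr (- (2 * Re \<alpha>))"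
  have C0: "0 \<le> C" using K B L by (simp add: C_def)
  have "cmod (fh_factor \<alpha> \<beta> \<tau> z * br z - br \<tau> * model \<alpha> \<beta> \<tau> z) \<le> \<epsilon> * cmod (z - \<tau>) powr (- (2 * Re \<alpha>)) + C"
    if z: "cmod z = 1" "cmod (br z) \<le> B" for z
  proof -
    define P where "P = cmod (z - \<tau>) powr (- (2 * Re \<alpha>))"
    have P: "0 \<le> P" by (simp add: P_def)
    have fh: "cmod (fh_factor \<alpha> \<beta> \<tau> z) \<le> K * P" unfolding K_def P_def by (rule fh_le)
    show ?thesis
    proof (cases "cmod (z - \<tau>) < \<delta>")
      case True
      have "fh_factor \<alpha> \<beta> \<tau> z * br z - br \<tau> * model \<alpha> \<beta> \<tau> z
        = fh_factor \<alpha> \<beta> \<tau> z * (br z - br \<tau>) + br \<tau> * (fh_factor \<alpha> \<beta> \<tau> z - model \<alpha> \<beta> \<tau> z)"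
        by (simp add: algebra_simps)
      then have "cmod (fh_factor \<alpha> \<beta> \<tau> z * br z - br \<tau> * model \<alpha> \<beta> \<tau> z)
        \<le> cmod (fh_factor \<alpha> \<beta> \<tau> z) * cmod (br z - br \<tau>) + cmod (br \<tau>) * cmod (fh_factor \<alpha> \<beta> \<tau> z - model \<alpha> \<beta> \<tau> z)"
        by (metis norm_mult norm_triangle_ineq)
      also have "\<dots> \<le> (K * P) * (\<epsilon> / (2 * K)) + cmod (br \<tau>) * (\<epsilon> / (2 * (cmod (br \<tau>) + 1)) * P)"
        using True \<delta>1(2)[OF z(1)] \<delta>2(2)[OF z(1)] K P fh
        by (intro add_mono mult_mono) (auto simp: \<delta>_def P_def less_imp_le)
      also have "(K * P) * (\<epsilon> / (2 * K)) = \<epsilon> / 2 * P" using K by simp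
      also have "cmod (br \<tau>) * (\<epsilon> / (2 * (cmod (br \<tau>) + 1)) * P) = cmod (br \<tau>) / (cmod (br \<tau>) + 1) * (\<epsilon> / 2 * P)"
        by simp
      also have "\<dots> \<le> 1 * (\<epsilon> / 2 * P)"
        using \<epsilon> P by (intro mult_right_mono) (auto simp: divide_le_eq add_nonneg_pos)
      also have "\<epsilon> / 2 * P + 1 * (\<epsilon> / 2 * P) = \<epsilon> * P" by (simp add: field_simps)
      finally show ?thesis using C0 by (simp add: P_def)
    next
      case False
      have "cmod (fh_factor \<alpha> \<beta> \<tau> z * br z - br \<tau> * model \<alpha> \<beta> \<tau> z)
        \<le> cmod (fh_factor \<alpha> \<beta> \<tau> z) * cmod (br z) + cmod (br \<tau>) * cmod (model \<alpha> \<beta> \<tau> z)"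
        by (metis norm_mult norm_triangle_ineq4)
      also have "\<dots> \<le> (K * P) * B + cmod (br \<tau>) * (L * P)"
        using z fh L(2)[OF z(1)] K P by (intro add_mono mult_mono) (auto simp: P_def)
      also have "\<dots> = (K * B + cmod (br \<tau>) * L) * P" by (simp add: algebra_simps)
      also have "P \<le> \<delta> powr (- (2 * Re \<alpha>))"
        unfolding P_def using False \<delta> \<alpha> by (intro powr_mono2') auto
      finally have "cmod (fh_factor \<alpha> \<beta> \<tau> z * br z - br \<tau> * model \<alpha> \<beta> \<tau> z) \<le> C"
        using K B L by (simp add: C_def mult_left_mono)
      then show ?thesis using \<epsilon> by (simp add: add_increasing)
    qed
  qed
  then have "AE \<theta> in circ. cmod (fh_factor \<alpha> \<beta> \<tau> (cis \<theta>) * br (cis \<theta>) - br \<tau> * model \<alpha> \<beta> \<tau> (cis \<theta>))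
    \<le> \<epsilon> * cmod (cis \<theta> - \<tau>) powr (- (2 * Re \<alpha>)) + C"
    using B(2) by (auto elim!: eventually_mono)
  then show ?thesis using C0 by blast
qed

text \<open>A weaker singularity is a small multiple of a stronger one, up to a bounded error.\<close>

lemma subdominant_residual:
  assumes \<tau>: "cmod \<tau> = 1" and \<alpha>: "0 < Re \<alpha>" "2 * Re \<alpha> < s" and \<epsilon>: "0 < \<epsilon>" and br: "br \<in> circle_Linf"
  shows "\<exists>C\<ge>0. AE \<theta> in circ. cmod (fh_factor \<alpha> \<beta> \<tau> (cis \<theta>) * br (cis \<theta>)) \<le> \<epsilon> * cmod (cis \<theta> - \<tau>) powr (- s) + C"
proof -
  define K where "K = exp (pi * \<bar>Im \<beta>\<bar>)"
  have K: "K > 0" by (simp add: K_def)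
  obtain B where B: "B \<ge> 0" "AE \<theta> in circ. cmod (br (cis \<theta>)) \<le> B"
    using circle_Linf_bounded[OF br] by blast
  define q where "q = s - 2 * Re \<alpha>"
  have q: "q > 0" using \<alpha> by (simp add: q_def)
  \<comment> \<open>the solution of \<open>(K * B + 1) * \<delta> powr q = \<epsilon>\<close>; the summand \<open>1\<close> avoids a division by \<open>0\<close>\<close>
  define \<delta> where "\<delta> = (\<epsilon> / (K * B + 1)) powr (1 / q)"
  have KB: "0 \<le> K * B" using K B by simp
  have \<delta>: "\<delta> > 0" using \<epsilon> KB by (simp add: \<delta>_def add_nonneg_pos)
  have \<delta>q: "\<delta> powr q = \<epsilon> / (K * B + 1)"
    using q \<epsilon> KB by (simp add: \<delta>_def powr_powr)
  define C where "C = K * B * \<delta> powr (- (2 * Re \<alpha>))"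
  have C0: "0 \<le> C" using KB by (simp add: C_def)
  have "cmod (fh_factor \<alpha> \<beta> \<tau> z * br z) \<le> \<epsilon> * cmod (z - \<tau>) powr (- s) + C"
    if z: "cmod z = 1" "cmod (br z) \<le> B" for z
  proof -
    define d where "d = cmod (z - \<tau>)"
    have d0: "0 \<le> d" by (simp add: d_def)
    have "cmod (fh_factor \<alpha> \<beta> \<tau> z * br z) \<le> (K * d powr (- (2 * Re \<alpha>))) * B"
      unfolding norm_mult K_def d_def by (intro mult_mono fh_le z) auto
    also have "\<dots> = K * B * d powr (- (2 * Re \<alpha>))" by simp
    also have "\<dots> \<le> \<epsilon> * d powr (- s) + C"
    proof (cases "d < \<delta>")
      case True
      have "K * B * d powr (- (2 * Re \<alpha>)) = K * B * (d powr q * d powr (- s))"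
        by (simp add: q_def flip: powr_add)
      also have "\<dots> \<le> K * B * (\<delta> powr q * d powr (- s))"
        using KB True q d0 by (intro mult_left_mono mult_right_mono powr_mono2) auto
      also have "\<dots> = K * B / (K * B + 1) * (\<epsilon> * d powr (- s))" by (simp add: \<delta>q)
      also have "\<dots> \<le> 1 * (\<epsilon> * d powr (- s))"
        using KB \<epsilon> by (intro mult_right_mono) (auto simp: divide_le_eq)
      finally show ?thesis using C0 by simp
    next
      case False
      then have "d powr (- (2 * Re \<alpha>)) \<le> \<delta> powr (- (2 * Re \<alpha>))"
        using \<delta> \<alpha> by (intro powr_mono2') auto
      then have "K * B * d powr (- (2 * Re \<alpha>)) \<le> C"
        unfolding C_def using KB by (rule mult_left_mono)
      then show ?thesis using \<epsilon> by (simp add: add_increasing)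
    qed
    finally show ?thesis by (simp add: d_def)
  qed
  then have "AE \<theta> in circ. cmod (fh_factor \<alpha> \<beta> \<tau> (cis \<theta>) * br (cis \<theta>)) \<le> \<epsilon> * cmod (cis \<theta> - \<tau>) powr (- s) + C"
    using B(2) by (auto elim!: eventually_mono)
  then show ?thesis using C0 by blast
qed

section \<open>Integral operators on the unit interval\<close>

abbreviation U01 :: "real measure" where "U01 \<equiv> lebesgue_on {0<..<1}"

lemma finite_measure_U01: "finite_measure U01"
  by (rule finite_measure_lebesgue_on) simp

lemma sigma_finite_U01: "sigma_finite_measure U01"
  using finite_measure_U01 by (simp add: finite_measure_def)

interpretation U01: finite_measure U01 by (rule finite_measure_U01)
interpretation UU: pair_sigma_finite U01 U01
  by (simp add: pair_sigma_finite_def sigma_finite_U01)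

lemma cnj_measurable [measurable (raw)]:
  "f \<in> borel_measurable M \<Longrightarrow> (\<lambda>x. cnj (f x)) \<in> borel_measurable M"
  by (rule measurable_compose[where N = borel]) (auto intro!: borel_measurable_continuous_onI continuous_intros)

text \<open>Optimization over \<open>a\<close>; the cases \<open>p = 0\<close> and \<open>q = 0\<close> have no optimal \<open>a\<close> and are limits.\<close>

lemma amgm_opt:
  fixes X :: real
  assumes "0 \<le> p" "0 \<le> q" "\<And>a. 0 < a \<Longrightarrow> X \<le> a / 2 * p\<^sup>2 + q\<^sup>2 / (2 * a)"
  shows "X \<le> p * q"
proof (cases "p = 0")
  case True
  show ?thesis
  proof (rule ccontr)
    assume "\<not> X \<le> p * q"
    then have X: "X > 0" using True by simp
    show False
    proof (cases "q = 0")
      case True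
      then show ?thesis using assms(3)[of 1] X \<open>p = 0\<close> by simp
    next
      case False
      then have "X \<le> q\<^sup>2 / (2 * (q\<^sup>2 / X))" using assms(3)[of "q\<^sup>2 / X"] X \<open>p = 0\<close> by simp
      also have "\<dots> = X / 2" using False X by simp
      finally show False using X by simp
    qed
  qed
next
  case p: False
  show ?thesis
  proof (cases "q = 0")
    case True
    show ?thesis
    proof (rule ccontr)
      assume "\<not> X \<le> p * q"
      then have X: "X > 0" using True by simp
      then have "X \<le> X / p\<^sup>2 / 2 * p\<^sup>2" using assms(3)[of "X / p\<^sup>2"] p \<open>q = 0\<close> by simp
      also have "\<dots> = X / 2" using p by simp
      finally show False using X by simp
    qed
  next
    case False
    then have pq: "0 < p" "0 < q" using p assms by auto
    have "X \<le> q / p / 2 * p\<^sup>2 + q\<^sup>2 / (2 * (q / p))" using assms(3)[of "q / p"] pq by simp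
    also have "\<dots> = p * q" using pq by (simp add: power2_eq_square)
    finally show ?thesis .
  qed
qed

lemma weighted_amgm: "0 < a \<Longrightarrow> x * y \<le> a / 2 * x\<^sup>2 + y\<^sup>2 / (2 * a)" for a x y :: real
proof -
  assume a: "0 < a"
  have "0 \<le> (a * x - y)\<^sup>2" by simp
  then have "2 * a * (x * y) \<le> 2 * a * (a / 2 * x\<^sup>2 + y\<^sup>2 / (2 * a))"
    using a by (simp add: power2_eq_square algebra_simps)
  then show ?thesis using a by simp
qed

lemma L2_01_measurable: "f \<in> L2_01 \<Longrightarrow> f \<in> borel_measurable U01"
  by (simp add: L2_01_def)

lemma L2_01_integrable: "f \<in> L2_01 \<Longrightarrow> integrable U01 (\<lambda>x. (cmod (f x))\<^sup>2)"
  by (simp add: L2_01_def)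

lemma L2_01_norm_nonneg [simp]: "0 \<le> L2_01_norm f"
  by (simp add: L2_01_norm_def)

lemma L2_01_norm_power2: "(L2_01_norm f)\<^sup>2 = (LINT x|U01. (cmod (f x))\<^sup>2)"
  by (simp add: L2_01_norm_def)

lemma L2_01_nn: "f \<in> L2_01 \<Longrightarrow> (\<integral>\<^sup>+x. ennreal ((cmod (f x))\<^sup>2) \<partial>U01) = ennreal ((L2_01_norm f)\<^sup>2)"
  unfolding L2_01_norm_power2 by (rule nn_integral_eq_integral) (auto simp: L2_01_def)

lemma L2_01_I:
  assumes "f \<in> borel_measurable U01" "(\<integral>\<^sup>+x. ennreal ((cmod (f x))\<^sup>2) \<partial>U01) \<le> ennreal (C\<^sup>2)" "0 \<le> C"
  shows "f \<in> L2_01" "L2_01_norm f \<le> C"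
proof -
  have "integrable U01 (\<lambda>x. (cmod (f x))\<^sup>2)"
    using assms by (intro integrableI_bounded) (auto intro: le_less_trans)
  then show f: "f \<in> L2_01" using assms by (simp add: L2_01_def)
  have "(L2_01_norm f)\<^sup>2 \<le> C\<^sup>2"
    using assms(2) L2_01_nn[OF f] by simp
  then show "L2_01_norm f \<le> C" using assms(3) by (simp add: power2_le_iff_abs_le)
qed

lemma bounded_L2_01:
  assumes "f \<in> borel_measurable U01" "\<And>x. cmod (f x) \<le> c"
  shows "f \<in> L2_01"
proof -
  have "integrable U01 (\<lambda>x. (cmod (f x))\<^sup>2)"
    by (rule U01.integrable_const_bound[of _ "c\<^sup>2"]) (use assms in \<open>auto intro!: AE_I2 power_mono\<close>)
  then show ?thesis using assms by (simp add: L2_01_def)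
qed

lemma L2_01_scale:
  assumes "f \<in> L2_01"
  shows "(\<lambda>x. c * f x) \<in> L2_01" "L2_01_norm (\<lambda>x. c * f x) = cmod c * L2_01_norm f"
  using assms by (auto simp: L2_01_def L2_01_norm_def norm_mult power_mult_distrib real_sqrt_mult)

lemma L2_01_cauchy_schwarz:
  assumes f: "f \<in> L2_01" and g: "g \<in> L2_01"
  shows "cmod (LINT x|U01. f x * cnj (g x)) \<le> L2_01_norm f * L2_01_norm g"
proof (rule amgm_opt)
  note [measurable] = L2_01_measurable[OF f] L2_01_measurable[OF g]
  fix a :: real assume a: "0 < a"
  have "cmod (LINT x|U01. f x * cnj (g x)) \<le> (LINT x|U01. cmod (f x * cnj (g x)))"
    by (rule integral_norm_bound)
  also have "\<dots> \<le> (LINT x|U01. a / 2 * (cmod (f x))\<^sup>2 + (cmod (g x))\<^sup>2 / (2 * a))"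
  proof (rule integral_mono')
    show "integrable U01 (\<lambda>x. a / 2 * (cmod (f x))\<^sup>2 + (cmod (g x))\<^sup>2 / (2 * a))"
      using L2_01_integrable[OF f] L2_01_integrable[OF g] by auto
  qed (use weighted_amgm[OF a] a in \<open>auto simp: norm_mult\<close>)
  also have "\<dots> = a / 2 * (L2_01_norm f)\<^sup>2 + (L2_01_norm g)\<^sup>2 / (2 * a)"
    using L2_01_integrable[OF f] L2_01_integrable[OF g] by (simp add: L2_01_norm_power2)
  finally show "cmod (LINT x|U01. f x * cnj (g x)) \<le> a / 2 * (L2_01_norm f)\<^sup>2 + (L2_01_norm g)\<^sup>2 / (2 * a)" .
qed simp_all

lemma L2_01_norm_tendsto:
  assumes "\<And>n. f n \<in> borel_measurable U01" "F \<in> borel_measurable U01" "\<And>n x. cmod (f n x) \<le> c"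
    and "AE x in U01. (\<lambda>n. f n x) \<longlonglongrightarrow> F x"
  shows "(\<lambda>n. L2_01_norm (f n)) \<longlonglongrightarrow> L2_01_norm F"
  unfolding L2_01_norm_def
proof (intro tendsto_real_sqrt integral_dominated_convergence)
  show "integrable U01 (\<lambda>_. c\<^sup>2)" by simp
  show "AE x in U01. (\<lambda>n. (cmod (f n x))\<^sup>2) \<longlonglongrightarrow> (cmod (F x))\<^sup>2"
    using assms(4) by eventually_elim (intro tendsto_intros)
  show "AE x in U01. norm ((cmod (f n x))\<^sup>2) \<le> c\<^sup>2" for n
    using assms(3) by (auto intro!: AE_I2 power_mono)
qed (use assms in measurable)

definition clip :: "nat \<Rightarrow> ('a \<Rightarrow> complex) \<Rightarrow> 'a \<Rightarrow> complex" where
  "clip c f x = (if cmod (f x) \<le> real c then f x else 0)"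

lemma clip_measurable [measurable]:
  assumes [measurable]: "f \<in> borel_measurable M"
  shows "clip c f \<in> borel_measurable M"
  unfolding clip_def[abs_def] by measurable

lemma clip_le: "cmod (clip c f x) \<le> real c" "cmod (clip c f x) \<le> cmod (f x)"
  by (auto simp: clip_def)

lemma clip_tendsto: "(\<lambda>c. clip c f x) \<longlonglongrightarrow> f x"
proof (rule tendsto_eventually)
  show "\<forall>\<^sub>F c in sequentially. clip c f x = f x"
    using eventually_ge_at_top[of "nat \<lceil>cmod (f x)\<rceil>"]
    by eventually_elim (auto simp: clip_def)
qed

lemma L2_01_clip: "f \<in> borel_measurable U01 \<Longrightarrow> clip c f \<in> L2_01"
  by (rule bounded_L2_01[OF clip_measurable clip_le(1)])

text \<open>The function is tested against its own truncations, which are bounded, and the truncation is removed by Fatou's lemma.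
  Square integrability comes out along the way.\<close>

lemma L2_01_dual:
  assumes f: "f \<in> borel_measurable U01" and \<Lambda>: "0 \<le> \<Lambda>"
    and bd: "\<And>c. cmod (LINT x|U01. f x * cnj (clip c f x)) \<le> \<Lambda> * L2_01_norm (clip c f)"
  shows "f \<in> L2_01" "L2_01_norm f \<le> \<Lambda>"
proof -
  have clipn: "L2_01_norm (clip c f) \<le> \<Lambda>" for c
  proof -
    have eq: "f x * cnj (clip c f x) = complex_of_real ((cmod (clip c f x))\<^sup>2)" for x
      unfolding complex_norm_square by (simp add: clip_def)
    have "(L2_01_norm (clip c f))\<^sup>2 = cmod (LINT x|U01. f x * cnj (clip c f x))"
      unfolding eq L2_01_norm_power2 integral_complex_of_real by simp
    also have "\<dots> \<le> \<Lambda> * L2_01_norm (clip c f)" by (rule bd)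
    finally have "L2_01_norm (clip c f) * L2_01_norm (clip c f) \<le> \<Lambda> * L2_01_norm (clip c f)"
      by (simp add: power2_eq_square)
    then show ?thesis
      using \<Lambda> L2_01_norm_nonneg[of "clip c f"] by (cases "L2_01_norm (clip c f) = 0") auto
  qed
  have "(\<integral>\<^sup>+x. ennreal ((cmod (f x))\<^sup>2) \<partial>U01) \<le> liminf (\<lambda>c. \<integral>\<^sup>+x. ennreal ((cmod (clip c f x))\<^sup>2) \<partial>U01)"
  proof -
    have "(\<integral>\<^sup>+x. ennreal ((cmod (f x))\<^sup>2) \<partial>U01) = (\<integral>\<^sup>+x. liminf (\<lambda>c. ennreal ((cmod (clip c f x))\<^sup>2)) \<partial>U01)"
    proof (intro nn_integral_cong)
      fix x
      have "(\<lambda>c. ennreal ((cmod (clip c f x))\<^sup>2)) \<longlonglongrightarrow> ennreal ((cmod (f x))\<^sup>2)"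
        by (intro tendsto_ennrealI tendsto_intros clip_tendsto)
      then show "ennreal ((cmod (f x))\<^sup>2) = liminf (\<lambda>c. ennreal ((cmod (clip c f x))\<^sup>2))"
        by (intro lim_imp_Liminf[symmetric]) simp_all
    qed
    also have "\<dots> \<le> liminf (\<lambda>c. \<integral>\<^sup>+x. ennreal ((cmod (clip c f x))\<^sup>2) \<partial>U01)"
      using f by (intro nn_integral_liminf) measurable
    finally show ?thesis .
  qed
  also have "\<dots> \<le> limsup (\<lambda>c. \<integral>\<^sup>+x. ennreal ((cmod (clip c f x))\<^sup>2) \<partial>U01)"
    by (rule Liminf_le_Limsup) simp
  also have "\<dots> \<le> ennreal (\<Lambda>\<^sup>2)"
    unfolding L2_01_nn[OF L2_01_clip[OF f]]
    by (intro Limsup_bounded always_eventually allI ennreal_leI power_mono clipn) simp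
  finally show "f \<in> L2_01" "L2_01_norm f \<le> \<Lambda>"
    using L2_01_I[OF f _ \<Lambda>] by blast+
qed

text \<open>The form \<open>\<langle>K f, g\<rangle>\<close> of the operator with kernel \<open>k\<close>.\<close>

definition kernel_form :: "(real \<Rightarrow> real \<Rightarrow> complex) \<Rightarrow> (real \<Rightarrow> complex) \<Rightarrow> (real \<Rightarrow> complex) \<Rightarrow> complex" where
  "kernel_form k f g = (LINT x|U01. integral_operator k f x * cnj (g x))"

text \<open>The hypotheses of Schur's test.\<close>

locale schur_kernel =
  fixes k :: "real \<Rightarrow> real \<Rightarrow> complex" and H :: real
  assumes k_measurable: "(\<lambda>(x, y). k x y) \<in> borel_measurable (U01 \<Otimes>\<^sub>M U01)"
    and H_nonneg: "0 \<le> H"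
    and row: "\<And>x. x \<in> {0<..<1} \<Longrightarrow> (\<integral>\<^sup>+y. ennreal (cmod (k x y)) \<partial>U01) \<le> ennreal H"
    and col: "\<And>y. y \<in> {0<..<1} \<Longrightarrow> (\<integral>\<^sup>+x. ennreal (cmod (k x y)) \<partial>U01) \<le> ennreal H"
begin

lemma k_measurable' [measurable]:
  assumes [measurable]: "f \<in> measurable M U01" "g \<in> measurable M U01"
  shows "(\<lambda>x. k (f x) (g x)) \<in> borel_measurable M"
  using measurable_compose[OF measurable_Pair[OF assms] k_measurable] by simp

lemma row_measurable: "x \<in> {0<..<1} \<Longrightarrow> k x \<in> borel_measurable U01"
  using measurable_compose[OF measurable_Pair1'[of x U01 U01] k_measurable] by simp

text \<open>Schur's test: the weighted arithmetic-geometric mean inequality separates \<open>f\<close> from \<open>g\<close>, and then one of the two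
  integrations meets the kernel alone.\<close>

lemma double_nn_integral_le:
  assumes f: "f \<in> L2_01" and g: "g \<in> L2_01" and a: "0 < a"
  shows "(\<integral>\<^sup>+p. ennreal (cmod (k (fst p) (snd p) * f (snd p) * cnj (g (fst p)))) \<partial>(U01 \<Otimes>\<^sub>M U01))
    \<le> ennreal (H * (a / 2 * (L2_01_norm f)\<^sup>2 + (L2_01_norm g)\<^sup>2 / (2 * a)))"
proof -
  note [measurable] = L2_01_measurable[OF f] L2_01_measurable[OF g]
  have m: "(\<lambda>p. ennreal (cmod (k (fst p) (snd p))) * ennreal ((cmod (f (snd p)))\<^sup>2)) \<in> borel_measurable (U01 \<Otimes>\<^sub>M U01)"
    "(\<lambda>p. ennreal (cmod (k (fst p) (snd p))) * ennreal ((cmod (g (fst p)))\<^sup>2)) \<in> borel_measurable (U01 \<Otimes>\<^sub>M U01)"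
    by measurable
  let ?A = "\<lambda>p. ennreal (a / 2) * (ennreal (cmod (k (fst p) (snd p))) * ennreal ((cmod (f (snd p)))\<^sup>2))"
  let ?B = "\<lambda>p. ennreal (1 / (2 * a)) * (ennreal (cmod (k (fst p) (snd p))) * ennreal ((cmod (g (fst p)))\<^sup>2))"
  have "(\<integral>\<^sup>+p. ennreal (cmod (k (fst p) (snd p) * f (snd p) * cnj (g (fst p)))) \<partial>(U01 \<Otimes>\<^sub>M U01))
      \<le> (\<integral>\<^sup>+p. ?A p + ?B p \<partial>(U01 \<Otimes>\<^sub>M U01))"
  proof (intro nn_integral_mono)
    fix p :: "real \<times> real"
    let ?k = "cmod (k (fst p) (snd p))" and ?f = "cmod (f (snd p))" and ?g = "cmod (g (fst p))"
    have "?k * (?f * ?g) \<le> ?k * (a / 2 * ?f\<^sup>2 + ?g\<^sup>2 / (2 * a))"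
      by (rule mult_left_mono[OF weighted_amgm[OF a]]) simp
    also have "\<dots> = (a / 2) * (?k * ?f\<^sup>2) + (1 / (2 * a)) * (?k * ?g\<^sup>2)"
      by (simp add: algebra_simps)
    finally have "ennreal (?k * (?f * ?g)) \<le> ennreal ((a / 2) * (?k * ?f\<^sup>2) + (1 / (2 * a)) * (?k * ?g\<^sup>2))"
      by (rule ennreal_leI)
    also have "\<dots> = ennreal (a / 2) * ennreal (?k * ?f\<^sup>2) + ennreal (1 / (2 * a)) * ennreal (?k * ?g\<^sup>2)"
      by (rule ennreal_lincomb[symmetric]) (use a in auto)
    finally show "ennreal (cmod (k (fst p) (snd p) * f (snd p) * cnj (g (fst p)))) \<le> ?A p + ?B p"
      by (simp add: norm_mult ennreal_mult mult.assoc)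
  qed
  also have "\<dots> = ennreal (a / 2) * (\<integral>\<^sup>+p. ennreal (cmod (k (fst p) (snd p))) * ennreal ((cmod (f (snd p)))\<^sup>2) \<partial>(U01 \<Otimes>\<^sub>M U01))
      + ennreal (1 / (2 * a)) * (\<integral>\<^sup>+p. ennreal (cmod (k (fst p) (snd p))) * ennreal ((cmod (g (fst p)))\<^sup>2) \<partial>(U01 \<Otimes>\<^sub>M U01))"
    by (simp only: nn_integral_add[OF borel_measurable_times_ennreal[OF borel_measurable_const m(1)]
            borel_measurable_times_ennreal[OF borel_measurable_const m(2)]] nn_integral_cmult[OF m(1)] nn_integral_cmult[OF m(2)])
  also have "(\<integral>\<^sup>+p. ennreal (cmod (k (fst p) (snd p))) * ennreal ((cmod (f (snd p)))\<^sup>2) \<partial>(U01 \<Otimes>\<^sub>M U01))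
      = (\<integral>\<^sup>+y. (\<integral>\<^sup>+x. ennreal (cmod (k x y)) * ennreal ((cmod (f y))\<^sup>2) \<partial>U01) \<partial>U01)"
    using UU.nn_integral_snd[OF m(1)] by simp
  also have "\<dots> = (\<integral>\<^sup>+y. (\<integral>\<^sup>+x. ennreal (cmod (k x y)) \<partial>U01) * ennreal ((cmod (f y))\<^sup>2) \<partial>U01)"
    by (intro nn_integral_cong nn_integral_multc) measurable
  also have "\<dots> \<le> (\<integral>\<^sup>+y. ennreal H * ennreal ((cmod (f y))\<^sup>2) \<partial>U01)"
    by (intro nn_integral_mono mult_right_mono col) auto
  also have "\<dots> = ennreal H * ennreal ((L2_01_norm f)\<^sup>2)"
    unfolding L2_01_nn[OF f, symmetric] by (rule nn_integral_cmult) measurable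
  also have "(\<integral>\<^sup>+p. ennreal (cmod (k (fst p) (snd p))) * ennreal ((cmod (g (fst p)))\<^sup>2) \<partial>(U01 \<Otimes>\<^sub>M U01))
      = (\<integral>\<^sup>+x. (\<integral>\<^sup>+y. ennreal (cmod (k x y)) * ennreal ((cmod (g x))\<^sup>2) \<partial>U01) \<partial>U01)"
    using U01.nn_integral_fst[OF m(2)] by simp
  also have "\<dots> = (\<integral>\<^sup>+x. (\<integral>\<^sup>+y. ennreal (cmod (k x y)) \<partial>U01) * ennreal ((cmod (g x))\<^sup>2) \<partial>U01)"
    by (intro nn_integral_cong nn_integral_multc) measurable
  also have "\<dots> \<le> (\<integral>\<^sup>+x. ennreal H * ennreal ((cmod (g x))\<^sup>2) \<partial>U01)"
    by (intro nn_integral_mono mult_right_mono row) auto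
  also have "\<dots> = ennreal H * ennreal ((L2_01_norm g)\<^sup>2)"
    unfolding L2_01_nn[OF g, symmetric] by (rule nn_integral_cmult) measurable
  also have "ennreal (a / 2) * (ennreal H * ennreal ((L2_01_norm f)\<^sup>2)) + ennreal (1 / (2 * a)) * (ennreal H * ennreal ((L2_01_norm g)\<^sup>2))
     = ennreal (a / 2 * (H * (L2_01_norm f)\<^sup>2) + 1 / (2 * a) * (H * (L2_01_norm g)\<^sup>2))"
    using a H_nonneg by (subst ennreal_lincomb[symmetric]) (auto simp: ennreal_mult)
  also have "a / 2 * (H * (L2_01_norm f)\<^sup>2) + 1 / (2 * a) * (H * (L2_01_norm g)\<^sup>2)
      = H * (a / 2 * (L2_01_norm f)\<^sup>2 + (L2_01_norm g)\<^sup>2 / (2 * a))"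
    by (simp add: algebra_simps)
  finally show ?thesis by (simp add: add_mono mult_left_mono)
qed

lemma double_integrable:
  assumes f: "f \<in> L2_01" and g: "g \<in> L2_01"
  shows "integrable (U01 \<Otimes>\<^sub>M U01) (\<lambda>p. k (fst p) (snd p) * f (snd p) * cnj (g (fst p)))"
proof (rule integrableI_bounded)
  note [measurable] = L2_01_measurable[OF f] L2_01_measurable[OF g]
  show "(\<lambda>p. k (fst p) (snd p) * f (snd p) * cnj (g (fst p))) \<in> borel_measurable (U01 \<Otimes>\<^sub>M U01)"
    by measurable
  show "(\<integral>\<^sup>+p. ennreal (norm (k (fst p) (snd p) * f (snd p) * cnj (g (fst p)))) \<partial>(U01 \<Otimes>\<^sub>M U01)) < \<infinity>"
    by (rule le_less_trans[OF double_nn_integral_le[OF f g, of 1]]) auto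
qed

lemma kernel_form_eq:
  assumes f: "f \<in> L2_01" and g: "g \<in> L2_01"
  shows "kernel_form k f g = (LINT p|(U01 \<Otimes>\<^sub>M U01). k (fst p) (snd p) * f (snd p) * cnj (g (fst p)))"
  using UU.integral_fst'[OF double_integrable[OF f g]]
  by (simp add: kernel_form_def integral_operator_def)

text \<open>Optimize over \<open>a\<close> in the preceding estimate.\<close>

lemma kernel_form_le:
  assumes f: "f \<in> L2_01" and g: "g \<in> L2_01"
  shows "cmod (kernel_form k f g) \<le> H * L2_01_norm f * L2_01_norm g"
proof (cases "H = 0")
  case True
  have "ennreal (cmod (kernel_form k f g)) \<le> 0"
    using order_trans[OF integral_norm_bound_ennreal[OF double_integrable[OF f g]] double_nn_integral_le[OF f g, of 1]] True
    by (simp add: kernel_form_eq[OF f g])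
  then show ?thesis using True by simp
next
  case False
  then have H: "H > 0" using H_nonneg by simp
  have "cmod (kernel_form k f g) / H \<le> L2_01_norm f * L2_01_norm g"
  proof (rule amgm_opt)
    fix a :: real assume a: "0 < a"
    have "ennreal (cmod (kernel_form k f g)) \<le> ennreal (H * (a / 2 * (L2_01_norm f)\<^sup>2 + (L2_01_norm g)\<^sup>2 / (2 * a)))"
      unfolding kernel_form_eq[OF f g]
      by (rule order_trans[OF integral_norm_bound_ennreal[OF double_integrable[OF f g]] double_nn_integral_le[OF f g a]])
    then have "cmod (kernel_form k f g) \<le> H * (a / 2 * (L2_01_norm f)\<^sup>2 + (L2_01_norm g)\<^sup>2 / (2 * a))"
      using H a by (subst (asm) ennreal_le_iff) auto
    then show "cmod (kernel_form k f g) / H \<le> a / 2 * (L2_01_norm f)\<^sup>2 + (L2_01_norm g)\<^sup>2 / (2 * a)"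
      using H by (simp add: divide_le_eq mult.commute)
  qed simp_all
  then show ?thesis using H by (simp add: divide_le_eq mult_ac)
qed

lemma operator_measurable:
  assumes f: "f \<in> L2_01"
  shows "integral_operator k f \<in> borel_measurable U01"
proof -
  note [measurable] = L2_01_measurable[OF f]
  show ?thesis unfolding integral_operator_def[abs_def]
    by (rule U01.borel_measurable_lebesgue_integral) measurable
qed

text \<open>By duality, only bounded \<open>g\<close> have to be tested.\<close>

lemma operator_bound_from_form:
  assumes f: "f \<in> L2_01" and \<Lambda>: "0 \<le> \<Lambda>"
    and bd: "\<And>g c. g \<in> borel_measurable U01 \<Longrightarrow> (\<And>x. cmod (g x) \<le> real c) \<Longrightarrow> cmod (kernel_form k f g) \<le> \<Lambda> * L2_01_norm f * L2_01_norm g"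
  shows "integral_operator k f \<in> L2_01" "L2_01_norm (integral_operator k f) \<le> \<Lambda> * L2_01_norm f"
proof -
  note m = operator_measurable[OF f]
  have "0 \<le> \<Lambda> * L2_01_norm f" using \<Lambda> by simp
  moreover have "cmod (LINT x|U01. integral_operator k f x * cnj (clip c (integral_operator k f) x))
      \<le> \<Lambda> * L2_01_norm f * L2_01_norm (clip c (integral_operator k f))" for c
    using bd[OF clip_measurable[OF m] clip_le(1)] by (simp add: kernel_form_def)
  ultimately show "integral_operator k f \<in> L2_01" "L2_01_norm (integral_operator k f) \<le> \<Lambda> * L2_01_norm f"
    using L2_01_dual[OF m] by blast+
qed

lemma operator_bounded:
  assumes f: "f \<in> L2_01"
  shows "integral_operator k f \<in> L2_01" "L2_01_norm (integral_operator k f) \<le> H * L2_01_norm f"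
  by (intro operator_bound_from_form[OF f H_nonneg] kernel_form_le f bounded_L2_01; assumption)+

lemma zero_L2_01: "(\<lambda>_. 0) \<in> L2_01" "L2_01_norm (\<lambda>_. 0) = 0"
  by (auto simp: L2_01_def L2_01_norm_def)

text \<open>This justifies reading the supremum \<open>L2_01_op_norm\<close> as an operator norm.\<close>

lemma op_norm_bdd: "bdd_above ((\<lambda>f. L2_01_norm (integral_operator k f)) ` {f \<in> L2_01. L2_01_norm f \<le> 1})"
proof (rule bdd_aboveI2)
  fix f assume "f \<in> {f \<in> L2_01. L2_01_norm f \<le> 1}"
  then show "L2_01_norm (integral_operator k f) \<le> H"
    using operator_bounded(2)[of f] H_nonneg mult_left_mono[of "L2_01_norm f" 1 H] by auto
qed

lemma op_norm_nonneg: "0 \<le> L2_01_op_norm (integral_operator k)"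
proof -
  have "0 \<le> L2_01_norm (integral_operator k (\<lambda>_. 0))" by simp
  also have "\<dots> \<le> L2_01_op_norm (integral_operator k)"
    unfolding L2_01_op_norm_def by (rule cSUP_upper[OF _ op_norm_bdd]) (simp add: zero_L2_01)
  finally show ?thesis .
qed

lemma operator_le_op_norm:
  assumes f: "f \<in> L2_01"
  shows "L2_01_norm (integral_operator k f) \<le> L2_01_op_norm (integral_operator k) * L2_01_norm f"
proof (cases "L2_01_norm f = 0")
  case True
  then show ?thesis using operator_bounded(2)[OF f] by simp
next
  case False
  define p where "p = L2_01_norm f"
  have p: "p > 0" using False L2_01_norm_nonneg[of f] by (simp add: p_def less_le)
  define h where "h = (\<lambda>x. of_real (1 / p) * f x)"
  have h: "h \<in> L2_01" "L2_01_norm h = 1"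
    unfolding h_def L2_01_scale(2)[OF f] using L2_01_scale(1)[OF f] p
    by (simp_all only:) (simp add: norm_divide flip: p_def)
  have "f = (\<lambda>x. of_real p * h x)" using p by (auto simp: h_def)
  then have "integral_operator k f = (\<lambda>x. of_real p * integral_operator k h x)"
    unfolding integral_operator_def by (simp add: mult.left_commute)
  then have "L2_01_norm (integral_operator k f) = p * L2_01_norm (integral_operator k h)"
    using L2_01_scale(2)[OF operator_bounded(1)[OF h(1)]] p by simp
  also have "\<dots> \<le> p * L2_01_op_norm (integral_operator k)"
    unfolding L2_01_op_norm_def using p h
    by (intro mult_left_mono cSUP_upper[OF _ op_norm_bdd]) auto
  finally show ?thesis by (simp add: p_def mult.commute)
qed

lemma kernel_form_le_op_norm:
  assumes f: "f \<in> L2_01" and g: "g \<in> L2_01"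
  shows "cmod (kernel_form k f g) \<le> L2_01_op_norm (integral_operator k) * L2_01_norm f * L2_01_norm g"
proof -
  have "cmod (kernel_form k f g) \<le> L2_01_norm (integral_operator k f) * L2_01_norm g"
    unfolding kernel_form_def by (rule L2_01_cauchy_schwarz[OF operator_bounded(1)[OF f] g])
  also have "\<dots> \<le> L2_01_op_norm (integral_operator k) * L2_01_norm f * L2_01_norm g"
    by (intro mult_right_mono operator_le_op_norm f) simp
  finally show ?thesis .
qed

text \<open>Dominated convergence, first in the inner and then in the outer variable. Bounded convergence almost everywhere
  of the arguments is enough, which covers continuous approximations as well as step functions.\<close>

lemma kernel_form_tendsto:
  assumes fn: "\<And>n. f n \<in> borel_measurable U01" "\<And>n x. cmod (f n x) \<le> c" "AE x in U01. (\<lambda>n. f n x) \<longlonglongrightarrow> F x" "F \<in> borel_measurable U01"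
    and gn: "\<And>n. g n \<in> borel_measurable U01" "\<And>n x. cmod (g n x) \<le> d" "AE x in U01. (\<lambda>n. g n x) \<longlonglongrightarrow> G x" "G \<in> borel_measurable U01"
  shows "(\<lambda>n. kernel_form k (f n) (g n)) \<longlonglongrightarrow> kernel_form k F G"
proof -
  note [measurable] = fn(1,4) gn(1,4)
  have c: "0 \<le> c" using fn(2)[of 0 0] norm_ge_zero order_trans by blast
  have d: "0 \<le> d" using gn(2)[of 0 0] norm_ge_zero order_trans by blast
  have op_m: "integral_operator k h \<in> borel_measurable U01" if [measurable]: "h \<in> borel_measurable U01" for h
    unfolding integral_operator_def[abs_def]
    by (rule U01.borel_measurable_lebesgue_integral) measurable
  have k_int: "integrable U01 (k x)" if "x \<in> {0<..<1}" for x
    using row_measurable[OF that] row[OF that] by (intro integrableI_bounded) (auto intro: le_less_trans)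
  have inner: "(\<lambda>n. integral_operator k (f n) x) \<longlonglongrightarrow> integral_operator k F x" if x: "x \<in> {0<..<1}" for x
    unfolding integral_operator_def
  proof (rule integral_dominated_convergence)
    note [measurable] = row_measurable[OF x]
    show "(\<lambda>y. k x y * F y) \<in> borel_measurable U01" "(\<lambda>y. k x y * f n y) \<in> borel_measurable U01" for n
      by measurable
    show "integrable U01 (\<lambda>y. cmod (k x y) * c)" using k_int[OF x] by auto
    show "AE y in U01. (\<lambda>n. k x y * f n y) \<longlonglongrightarrow> k x y * F y"
      using fn(3) by eventually_elim (intro tendsto_intros)
    show "AE y in U01. norm (k x y * f n y) \<le> cmod (k x y) * c" for n
      using fn(2) by (auto simp: norm_mult mult_left_mono)
  qed
  have inner_le: "cmod (integral_operator k (f n) x) \<le> H * c" if x: "x \<in> {0<..<1}" for n x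
  proof -
    have "cmod (integral_operator k (f n) x) \<le> (LINT y|U01. cmod (k x y * f n y))"
      unfolding integral_operator_def by (rule integral_norm_bound)
    also have "\<dots> \<le> (LINT y|U01. cmod (k x y) * c)"
      by (rule integral_mono') (use k_int[OF x] fn(2) c in \<open>auto simp: norm_mult mult_left_mono\<close>)
    also have "\<dots> = (LINT y|U01. cmod (k x y)) * c" by simp
    also have "(LINT y|U01. cmod (k x y)) \<le> H"
    proof -
      have "ennreal (LINT y|U01. cmod (k x y)) = (\<integral>\<^sup>+y. ennreal (cmod (k x y)) \<partial>U01)"
        using k_int[OF x] by (subst nn_integral_eq_integral) auto
      then show ?thesis using row[OF x] H_nonneg by (metis ennreal_le_iff)
    qed
    finally show ?thesis using c by (simp add: mult_right_mono)
  qed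
  show ?thesis
    unfolding kernel_form_def
  proof (rule integral_dominated_convergence)
    note [measurable] = op_m
    show "(\<lambda>x. integral_operator k F x * cnj (G x)) \<in> borel_measurable U01"
      "(\<lambda>x. integral_operator k (f n) x * cnj (g n x)) \<in> borel_measurable U01" for n
      by measurable
    show "integrable U01 (\<lambda>x. H * c * d)" by simp
    show "AE x in U01. (\<lambda>n. integral_operator k (f n) x * cnj (g n x)) \<longlonglongrightarrow> integral_operator k F x * cnj (G x)"
      using gn(3) AE_space by eventually_elim (auto intro!: tendsto_intros inner)
    show "AE x in U01. norm (integral_operator k (f n) x * cnj (g n x)) \<le> H * c * d" for n
      by (rule AE_I2) (use inner_le gn(2) c d H_nonneg in \<open>auto simp: norm_mult intro!: mult_mono\<close>)
  qed
qed

end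

text \<open>A measurable function is an almost everywhere limit of continuous functions. These are brought into a ball of
  radius \<open>c + 1\<close> by radial retraction, which keeps them continuous and leaves the limit unchanged.\<close>

lemma continuous_approximation:
  assumes f: "f \<in> borel_measurable U01" and c: "\<And>x. cmod (f x) \<le> c"
  obtains g :: "nat \<Rightarrow> real \<Rightarrow> complex"
  where "\<And>n. continuous_on UNIV (g n)" "\<And>n x. cmod (g n x) \<le> c + 1" "AE x in U01. (\<lambda>n. g n x) \<longlonglongrightarrow> f x"
proof -
  have c0: "0 \<le> c" using c[of 0] norm_ge_zero order_trans by blast
  have "(\<lambda>x. if x \<in> {0<..<1} then f x else 0) \<in> borel_measurable lebesgue"
    using f by (intro borel_measurable_if_I) auto
  then have "(\<lambda>x. if x \<in> {0<..<1} then f x else 0) measurable_on UNIV"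
    by (rule lebesgue_measurable_imp_measurable_on) simp
  then obtain N h where N: "negligible N" and h: "\<And>n. continuous_on UNIV (h n)"
    and lim0: "\<And>x. x \<notin> N \<Longrightarrow> (\<lambda>n. h n x) \<longlonglongrightarrow> (if x \<in> UNIV then if x \<in> {0<..<1} then f x else 0 else 0)"
    unfolding measurable_on_def by blast
  have lim: "(\<lambda>n. h n x) \<longlonglongrightarrow> (if x \<in> {0<..<1} then f x else 0)" if "x \<notin> N" for x
    using lim0[OF that] by simp
  define g where "g = (\<lambda>n x. of_real ((c + 1) / max (c + 1) (cmod (h n x))) * h n x)"
  have m0: "max (c + 1) y > 0" for y using c0 by (simp add: less_max_iff_disj)
  show thesis
  proof
    show "continuous_on UNIV (g n)" for n
      unfolding g_def using m0 by (intro continuous_intros h) (auto simp: less_le)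
    show "cmod (g n x) \<le> c + 1" for n x
    proof -
      have "cmod (g n x) = (c + 1) * (cmod (h n x) / max (c + 1) (cmod (h n x)))"
        using c0 m0[of "cmod (h n x)"] by (simp add: g_def norm_mult norm_divide)
      also have "\<dots> \<le> (c + 1) * 1"
        using c0 m0[of "cmod (h n x)"] by (intro mult_left_mono) (auto simp: divide_le_eq)
      finally show ?thesis by simp
    qed
    have "N \<in> null_sets lebesgue" using N by (simp add: negligible_iff_null_sets)
    then have "AE x in lebesgue. x \<notin> N" by (rule AE_not_in)
    then have "AE x in U01. x \<notin> N" by (auto simp: AE_restrict_space_iff elim: eventually_mono)
    then show "AE x in U01. (\<lambda>n. g n x) \<longlonglongrightarrow> f x"
      using AE_space
    proof eventually_elim
      fix x assume x: "x \<notin> N" "x \<in> space U01"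
      then have l: "(\<lambda>n. h n x) \<longlonglongrightarrow> f x" using lim[of x] by simp
      have "(\<lambda>n. g n x) \<longlonglongrightarrow> of_real ((c + 1) / max (c + 1) (cmod (f x))) * f x"
        unfolding g_def using m0 by (intro tendsto_intros l) (auto simp: less_le)
      moreover have "max (c + 1) (cmod (f x)) = c + 1" using c[of x] by simp
      ultimately show "(\<lambda>n. g n x) \<longlonglongrightarrow> f x" using c0 by simp
    qed
  qed
qed

lemma continuous_measurable_U01: "continuous_on UNIV g \<Longrightarrow> g \<in> borel_measurable U01"
  by (intro borel_measurable_lebesgue_on_borel borel_measurable_continuous_onI)

context schur_kernel
begin

lemma kernel_form_clip_tendsto:
  assumes f: "f \<in> L2_01" and g: "g \<in> L2_01"
  shows "(\<lambda>c. kernel_form k (clip c f) g) \<longlonglongrightarrow> kernel_form k f g"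
proof -
  note [measurable] = L2_01_measurable[OF f] L2_01_measurable[OF g]
  show ?thesis
    unfolding kernel_form_eq[OF f g] kernel_form_eq[OF L2_01_clip[OF L2_01_measurable[OF f]] g]
  proof (rule integral_dominated_convergence)
    show "integrable (U01 \<Otimes>\<^sub>M U01) (\<lambda>p. cmod (k (fst p) (snd p) * f (snd p) * cnj (g (fst p))))"
      by (intro integrable_norm double_integrable f g)
    show "AE p in U01 \<Otimes>\<^sub>M U01. (\<lambda>c. k (fst p) (snd p) * clip c f (snd p) * cnj (g (fst p)))
        \<longlonglongrightarrow> k (fst p) (snd p) * f (snd p) * cnj (g (fst p))"
      by (intro AE_I2 tendsto_intros clip_tendsto)
    show "AE p in U01 \<Otimes>\<^sub>M U01. norm (k (fst p) (snd p) * clip c f (snd p) * cnj (g (fst p)))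
        \<le> cmod (k (fst p) (snd p) * f (snd p) * cnj (g (fst p)))" for c
      by (rule AE_I2) (auto simp: norm_mult intro!: mult_mono clip_le)
  qed measurable
qed

text \<open>Continuous bounded functions suffice to compute the operator norm: pass from continuous to bounded functions by
  \<open>continuous_approximation\<close>, and from bounded to square-integrable ones by truncation.\<close>

lemma op_norm_leI:
  assumes \<Lambda>: "0 \<le> \<Lambda>"
    and bd: "\<And>f g c. continuous_on UNIV f \<Longrightarrow> continuous_on UNIV g \<Longrightarrow> (\<And>x. cmod (f x) \<le> c) \<Longrightarrow> (\<And>x. cmod (g x) \<le> c)
      \<Longrightarrow> cmod (kernel_form k f g) \<le> \<Lambda> * L2_01_norm f * L2_01_norm g"
  shows "L2_01_op_norm (integral_operator k) \<le> \<Lambda>"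
proof -
  have bounded: "cmod (kernel_form k f g) \<le> \<Lambda> * L2_01_norm f * L2_01_norm g"
    if f: "f \<in> borel_measurable U01" "\<And>x. cmod (f x) \<le> c" and g: "g \<in> borel_measurable U01" "\<And>x. cmod (g x) \<le> d" for f g c d
  proof -
    obtain fn where fn: "\<And>n. continuous_on UNIV (fn n)" "\<And>n x. cmod (fn n x) \<le> c + 1" "AE x in U01. (\<lambda>n. fn n x) \<longlonglongrightarrow> f x"
      using continuous_approximation[OF f] by blast
    obtain gn where gn: "\<And>n. continuous_on UNIV (gn n)" "\<And>n x. cmod (gn n x) \<le> d + 1" "AE x in U01. (\<lambda>n. gn n x) \<longlonglongrightarrow> g x"
      using continuous_approximation[OF g] by blast
    note m = continuous_measurable_U01[OF fn(1)] continuous_measurable_U01[OF gn(1)]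
    have "(\<lambda>n. \<Lambda> * L2_01_norm (fn n) * L2_01_norm (gn n)) \<longlonglongrightarrow> \<Lambda> * L2_01_norm f * L2_01_norm g"
      by (intro tendsto_intros L2_01_norm_tendsto[OF m(1) f(1) fn(2,3)] L2_01_norm_tendsto[OF m(2) g(1) gn(2,3)])
    moreover have "(\<lambda>n. cmod (kernel_form k (fn n) (gn n))) \<longlonglongrightarrow> cmod (kernel_form k f g)"
      by (intro tendsto_norm kernel_form_tendsto[OF m(1) fn(2,3) f(1) m(2) gn(2,3) g(1)])
    moreover have "cmod (kernel_form k (fn n) (gn n)) \<le> \<Lambda> * L2_01_norm (fn n) * L2_01_norm (gn n)" for n
      by (rule bd[where c = "max (c + 1) (d + 1)"])
        (auto intro: fn(1) gn(1) order_trans[OF fn(2)] order_trans[OF gn(2)])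
    ultimately show ?thesis by (intro LIMSEQ_le) auto
  qed
  have L2: "L2_01_norm (integral_operator k f) \<le> \<Lambda> * L2_01_norm f" if f: "f \<in> L2_01" for f
  proof (rule operator_bound_from_form(2)[OF f \<Lambda>])
    fix g c assume g: "g \<in> borel_measurable U01" "\<And>x. cmod (g x) \<le> real c"
    have gL: "g \<in> L2_01" by (rule bounded_L2_01[OF g])
    have "cmod (kernel_form k (clip d f) g) \<le> \<Lambda> * L2_01_norm f * L2_01_norm g" for d
    proof -
      have "cmod (kernel_form k (clip d f) g) \<le> \<Lambda> * L2_01_norm (clip d f) * L2_01_norm g"
        by (rule bounded[OF clip_measurable[OF L2_01_measurable[OF f]] clip_le(1) g])
      also have "L2_01_norm (clip d f) \<le> L2_01_norm f"
        unfolding L2_01_norm_def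
        by (intro real_sqrt_le_mono integral_mono' L2_01_integrable[OF f] power_mono clip_le(2)) simp_all
      finally show ?thesis using \<Lambda> by (simp add: mult_left_mono mult_right_mono)
    qed
    then show "cmod (kernel_form k f g) \<le> \<Lambda> * L2_01_norm f * L2_01_norm g"
      using tendsto_norm[OF kernel_form_clip_tendsto[OF f gL]] by (intro LIMSEQ_le_const2) auto
  qed
  show ?thesis
    unfolding L2_01_op_norm_def
  proof (rule cSUP_least)
    show "{f \<in> L2_01. L2_01_norm f \<le> 1} \<noteq> {}" using zero_L2_01 by fastforce
    fix f assume "f \<in> {f \<in> L2_01. L2_01_norm f \<le> 1}"
    then show "L2_01_norm (integral_operator k f) \<le> \<Lambda>"
      using L2[of f] \<Lambda> mult_left_mono[of "L2_01_norm f" 1 \<Lambda>] by auto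
  qed
qed

end

section \<open>The Fisher--Hartwig kernel and step functions\<close>

lemma singular_kernel_row:
  assumes s: "0 < s" "s < 1" and h: "0 < h" and S: "S \<in> sets lebesgue"
  shows "(\<integral>\<^sup>+y. ennreal (\<bar>y - x\<bar> powr (s - 1)) * indicator S y \<partial>U01)
    \<le> ennreal (2 * h powr s / s) + ennreal (h powr (s - 1)) * emeasure lebesgue (S \<inter> {0<..<1})"
proof -
  have S1: "S \<inter> {0<..<1} \<in> sets lebesgue" using S by auto
  have ind: "(indicator S :: real \<Rightarrow> ennreal) \<in> borel_measurable U01"
    by (intro measurable_restrict_space1) (use S in measurable)
  have "(\<integral>\<^sup>+y. indicator S y \<partial>U01) = (\<integral>\<^sup>+y. indicator (S \<inter> {0<..<1}) y \<partial>lebesgue)"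
    by (subst nn_integral_restrict_space) (auto intro!: nn_integral_cong simp: indicator_def)
  also have "\<dots> = emeasure lebesgue (S \<inter> {0<..<1})" using S1 by simp
  finally have e: "(\<integral>\<^sup>+y. indicator S y \<partial>U01) = emeasure lebesgue (S \<inter> {0<..<1})" .
  have "(\<integral>\<^sup>+y. ennreal (\<bar>y - x\<bar> powr (- (1 - s))) * indicator S y \<partial>U01)
    \<le> ennreal (2 * h powr (1 - (1 - s)) / (1 - (1 - s))) * 1
      + ennreal (h powr (- (1 - s))) * (\<integral>\<^sup>+y. indicator S y \<partial>U01)"
  proof (rule nn_integral_powr_weight)
    show "indicator S y \<le> (1 :: ennreal)" for y by (simp add: indicator_def)
  qed (use s h ind in auto)
  then show ?thesis by (simp add: e)
qed

definition kernel_bound :: "complex \<Rightarrow> complex \<Rightarrow> real" where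
  "kernel_bound \<alpha> \<beta> = cmod (C_plus \<alpha> \<beta>) + cmod (C_minus \<alpha> \<beta>)"

lemma kernel_bound_nonneg: "0 \<le> kernel_bound \<alpha> \<beta>"
  by (simp add: kernel_bound_def)

lemma fh_kernel_le: "cmod (fh_kernel \<alpha> \<beta> x y) \<le> kernel_bound \<alpha> \<beta> * \<bar>y - x\<bar> powr (2 * Re \<alpha> - 1)"
proof -
  have n: "cmod (of_real d powr (2 * \<alpha> - 1)) = d powr (2 * Re \<alpha> - 1)" if "0 \<le> d" for d
    using that by (simp add: norm_powr_real_powr)
  consider "x > y" | "x < y" | "x = y" by linarith
  then show ?thesis
    by cases (use n[of "x - y"] n[of "y - x"] in
      \<open>simp_all add: fh_kernel_def kernel_bound_def norm_mult mult_right_mono del: of_real_diff\<close>)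
qed

lemma fh_kernel_row_le:
  assumes \<alpha>: "0 < Re \<alpha>" "Re \<alpha> < 1 / 2" and h: "0 < h" and S: "S \<in> sets lebesgue"
    and k: "k = (\<lambda>x y. fh_kernel \<alpha> \<beta> x y) \<or> k = (\<lambda>x y. fh_kernel \<alpha> \<beta> y x)"
  shows "(\<integral>\<^sup>+y. ennreal (cmod (k x y)) * indicator S y \<partial>U01)
    \<le> ennreal (kernel_bound \<alpha> \<beta>) * (ennreal (2 * h powr (2 * Re \<alpha>) / (2 * Re \<alpha>))
      + ennreal (h powr (2 * Re \<alpha> - 1)) * emeasure lebesgue (S \<inter> {0<..<1}))"
proof -
  have k': "cmod (k x y) \<le> kernel_bound \<alpha> \<beta> * \<bar>y - x\<bar> powr (2 * Re \<alpha> - 1)" for y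
    using k fh_kernel_le[of \<alpha> \<beta> x y] fh_kernel_le[of \<alpha> \<beta> y x] by (auto simp: abs_minus_commute)
  have m: "(\<lambda>y. ennreal (\<bar>y - x\<bar> powr (2 * Re \<alpha> - 1)) * indicator S y) \<in> borel_measurable U01"
  proof (rule borel_measurable_times_ennreal)
    show "(\<lambda>y. ennreal (\<bar>y - x\<bar> powr (2 * Re \<alpha> - 1))) \<in> borel_measurable U01"
      by (rule borel_measurable_lebesgue_on_borel) measurable
    show "(indicator S :: real \<Rightarrow> ennreal) \<in> borel_measurable U01"
      by (intro measurable_restrict_space1) (use S in measurable)
  qed
  have "(\<integral>\<^sup>+y. ennreal (cmod (k x y)) * indicator S y \<partial>U01)
    \<le> (\<integral>\<^sup>+y. ennreal (kernel_bound \<alpha> \<beta>) * (ennreal (\<bar>y - x\<bar> powr (2 * Re \<alpha> - 1)) * indicator S y) \<partial>U01)"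
    using k' kernel_bound_nonneg[of \<alpha> \<beta>]
    by (intro nn_integral_mono) (auto simp: mult.assoc[symmetric] ennreal_mult[symmetric] intro!: mult_right_mono ennreal_leI)
  also have "\<dots> = ennreal (kernel_bound \<alpha> \<beta>) * (\<integral>\<^sup>+y. ennreal (\<bar>y - x\<bar> powr (2 * Re \<alpha> - 1)) * indicator S y \<partial>U01)"
    by (rule nn_integral_cmult[OF m])
  also have "\<dots> \<le> ennreal (kernel_bound \<alpha> \<beta>) * (ennreal (2 * h powr (2 * Re \<alpha>) / (2 * Re \<alpha>))
      + ennreal (h powr (2 * Re \<alpha> - 1)) * emeasure lebesgue (S \<inter> {0<..<1}))"
    using \<alpha> by (intro mult_left_mono singular_kernel_row h S) auto
  finally show ?thesis .
qed

text \<open>The integral of \<open>\<bar>y - x\<bar> powr (2 * Re \<alpha> - 1)\<close> over the unit interval is estimated by splitting it at distance \<open>1\<close>,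
  which gives \<open>2 / (2 * Re \<alpha>) + 1\<close>.\<close>

definition schur_bound :: "complex \<Rightarrow> complex \<Rightarrow> real" where
  "schur_bound \<alpha> \<beta> = kernel_bound \<alpha> \<beta> * (2 / (2 * Re \<alpha>) + 1)"

lemma fh_kernel_measurable:
  "(\<lambda>(x, y). fh_kernel \<alpha> \<beta> x y) \<in> borel_measurable (U01 \<Otimes>\<^sub>M U01)"
proof -
  have id: "(\<lambda>x. x) \<in> borel_measurable U01"
    by (rule borel_measurable_lebesgue_on_borel) simp
  have [measurable]: "fst \<in> borel_measurable (U01 \<Otimes>\<^sub>M U01)"
    by (rule measurable_compose[OF measurable_fst id])
  have [measurable]: "snd \<in> borel_measurable (U01 \<Otimes>\<^sub>M U01)"
    by (rule measurable_compose[OF measurable_snd id])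
  have [measurable]: "(exp :: complex \<Rightarrow> complex) \<in> borel_measurable borel"
    by (intro borel_measurable_continuous_onI continuous_intros)
  have eq: "fh_kernel \<alpha> \<beta> x y = (if x > y then C_plus \<alpha> \<beta> * exp ((2 * \<alpha> - 1) * of_real (ln (x - y)))
      else if x < y then C_minus \<alpha> \<beta> * exp ((2 * \<alpha> - 1) * of_real (ln (y - x))) else 0)" for x y
  proof -
    have "of_real d powr (2 * \<alpha> - 1) = exp ((2 * \<alpha> - 1) * of_real (ln d))" if "0 < d" for d
      using that by (simp add: powr_def Ln_of_real)
    from this[of "x - y"] this[of "y - x"] show ?thesis by (simp add: fh_kernel_def)
  qed
  show ?thesis unfolding eq split_beta by measurable
qed

lemma fh_schur_kernel:
  assumes \<alpha>: "0 < Re \<alpha>" "Re \<alpha> < 1 / 2"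
  shows "schur_kernel (fh_kernel \<alpha> \<beta>) (schur_bound \<alpha> \<beta>)"
proof
  have eq: "ennreal (kernel_bound \<alpha> \<beta>) * (ennreal (2 * 1 powr (2 * Re \<alpha>) / (2 * Re \<alpha>))
      + ennreal (1 powr (2 * Re \<alpha> - 1)) * emeasure lebesgue (UNIV \<inter> {0<..<1::real})) = ennreal (schur_bound \<alpha> \<beta>)"
  proof -
    have "ennreal (2 / (2 * Re \<alpha>)) + 1 = ennreal (2 / (2 * Re \<alpha>) + 1)"
      using \<alpha> by (subst ennreal_plus) auto
    moreover have "emeasure lebesgue {0<..<1::real} = 1" using emeasure_lborel_Ioo[of 0 1] by simp
    moreover have "ennreal (schur_bound \<alpha> \<beta>) = ennreal (kernel_bound \<alpha> \<beta>) * ennreal (2 / (2 * Re \<alpha>) + 1)"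
      unfolding schur_bound_def using \<alpha> kernel_bound_nonneg[of \<alpha> \<beta>] by (intro ennreal_mult) auto
    ultimately show ?thesis by (simp only: Int_UNIV_left powr_one_eq_one ennreal_1 mult_1_right mult_1_left)
  qed
  show "(\<integral>\<^sup>+y. ennreal (cmod (fh_kernel \<alpha> \<beta> x y)) \<partial>U01) \<le> ennreal (schur_bound \<alpha> \<beta>)" for x
    using fh_kernel_row_le[OF \<alpha>, of 1 UNIV "fh_kernel \<alpha> \<beta>" \<beta> x] unfolding eq by simp
  show "(\<integral>\<^sup>+x. ennreal (cmod (fh_kernel \<alpha> \<beta> x y)) \<partial>U01) \<le> ennreal (schur_bound \<alpha> \<beta>)" for y
    using fh_kernel_row_le[OF \<alpha>, of 1 UNIV "\<lambda>x y. fh_kernel \<alpha> \<beta> y x" \<beta> y] unfolding eq by simp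
  show "(\<lambda>(x, y). fh_kernel \<alpha> \<beta> x y) \<in> borel_measurable (U01 \<Otimes>\<^sub>M U01)"
    by (rule fh_kernel_measurable)
  show "0 \<le> schur_bound \<alpha> \<beta>"
    using \<alpha> kernel_bound_nonneg[of \<alpha> \<beta>] by (simp add: schur_bound_def)
qed

definition cell :: "nat \<Rightarrow> nat \<Rightarrow> real set" where
  "cell m l = {real l / real m..<real (Suc l) / real m}"

lemma cell_borel [measurable]: "cell m l \<in> sets borel"
  by (simp add: cell_def)

lemma cell_unique: "0 < m \<Longrightarrow> x \<in> cell m l \<Longrightarrow> x \<in> cell m l' \<Longrightarrow> l = l'"
proof -
  assume m: "0 < m" and x: "x \<in> cell m l" "x \<in> cell m l'"
  have "real l < real (Suc l')" "real l' < real (Suc l)"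
    using x m unfolding cell_def by (auto simp: field_simps dest: le_less_trans)
  then show "l = l'" by linarith
qed

lemma in_cell_iff: "0 < m \<Longrightarrow> x \<in> cell m l \<Longrightarrow> x \<in> cell m l' \<longleftrightarrow> l' = l"
  by (blast intro: cell_unique)

text \<open>The first cell loses the point \<open>0\<close>, which is a null set.\<close>

lemma emeasure_cell:
  assumes "l < m"
  shows "emeasure lebesgue (cell m l \<inter> {0<..<1}) = ennreal (1 / real m)"
proof -
  have "emeasure lebesgue (cell m l \<inter> {0<..<1}) = emeasure lebesgue {real l / real m<..<real (Suc l) / real m}"
  proof (rule emeasure_eq_AE)
    have "AE x in lebesgue. x \<noteq> real l / real m"
      by (rule AE_completion) (rule AE_lborel_singleton)
    then show "AE x in lebesgue. x \<in> cell m l \<inter> {0<..<1} \<longleftrightarrow> x \<in> {real l / real m<..<real (Suc l) / real m}"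
    proof eventually_elim
      fix x assume x: "x \<noteq> real l / real m"
      have "real (Suc l) / real m \<le> 1" using assms by (simp add: divide_le_eq)
      moreover have "real l / real m < x \<Longrightarrow> 0 < x"
        by (rule le_less_trans[of 0 "real l / real m"]) simp_all
      ultimately show "x \<in> cell m l \<inter> {0<..<1} \<longleftrightarrow> x \<in> {real l / real m<..<real (Suc l) / real m}"
        using x unfolding cell_def by (auto simp del: of_nat_Suc)
    qed
  qed (auto simp: cell_def)
  also have "\<dots> = ennreal (1 / real m)"
    using assms by (simp add: field_simps flip: diff_divide_distrib)
  finally show ?thesis .
qed

abbreviation ind :: "real set \<Rightarrow> real \<Rightarrow> complex" where
  "ind S x \<equiv> of_real (indicator S x)"

lemma ind_measurable [measurable]:
  assumes [measurable]: "S \<in> sets borel"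
  shows "ind S \<in> borel_measurable U01"
  by (rule borel_measurable_lebesgue_on_borel) measurable

lemma ind_L2: "S \<in> sets borel \<Longrightarrow> ind S \<in> L2_01"
  by (rule bounded_L2_01[OF ind_measurable, of _ 1]) (simp_all add: indicator_def)

lemma integral_cell:
  assumes "l < m"
  shows "(LINT x|U01. indicator (cell m l) x) = 1 / real m" "(LINT x|U01. ind (cell m l) x) = 1 / of_nat m"
proof -
  have "(\<integral>\<^sup>+x. indicator (cell m l) x \<partial>U01) = (\<integral>\<^sup>+x. indicator (cell m l \<inter> {0<..<1}) x \<partial>lebesgue)"
    by (subst nn_integral_restrict_space) (simp, rule nn_integral_cong, simp add: indicator_def)
  also have "\<dots> = emeasure lebesgue (cell m l \<inter> {0<..<1})"
    by (rule nn_integral_indicator) (simp add: cell_def)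
  also have "\<dots> = ennreal (1 / real m)" by (rule emeasure_cell[OF assms])
  finally have nn: "(\<integral>\<^sup>+x. indicator (cell m l) x \<partial>U01) = ennreal (1 / real m)" .
  show 1: "(LINT x|U01. indicator (cell m l) x) = 1 / real m"
  proof -
    have im: "(indicator (cell m l) :: real \<Rightarrow> real) \<in> borel_measurable U01"
      by (rule borel_measurable_lebesgue_on_borel) measurable
    have "(LINT x|U01. indicator (cell m l) x) = enn2real (\<integral>\<^sup>+x. ennreal (indicator (cell m l) x) \<partial>U01)"
      by (rule integral_eq_nn_integral[OF im]) simp
    also have "\<dots> = 1 / real m" by (simp only: ennreal_indicator nn) simp
    finally show ?thesis .
  qed
  show "(LINT x|U01. ind (cell m l) x) = 1 / of_nat m"
    unfolding integral_complex_of_real 1 by simp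
qed

text \<open>Outside the interval \<open>{0..<1}\<close> the value is \<open>0\<close>, so a step function is bounded for every \<open>X\<close>.\<close>

definition step :: "nat \<Rightarrow> (nat \<Rightarrow> complex) \<Rightarrow> real \<Rightarrow> complex" where
  "step m X x = (\<Sum>l<m. X l * ind (cell m l) x)"

lemma step_measurable [measurable]: "step m X \<in> borel_measurable U01"
  unfolding step_def[abs_def] by measurable

lemma step_in_cell: "l < m \<Longrightarrow> x \<in> cell m l \<Longrightarrow> step m X x = X l"
proof -
  assume l: "l < m" "x \<in> cell m l"
  have "step m X x = (\<Sum>l'<m. if l' = l then X l else 0)"
    unfolding step_def
    by (intro sum.cong refl) (use l in \<open>simp add: indicator_def in_cell_iff[of m x l]\<close>)
  then show ?thesis using l by simp
qed

lemma step_le: "cmod (step m X x) \<le> (\<Sum>l<m. cmod (X l))"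
  unfolding step_def by (rule order_trans[OF norm_sum sum_mono]) (auto simp: norm_mult indicator_def)

lemma step_L2: "step m X \<in> L2_01"
  by (rule bounded_L2_01[OF step_measurable step_le])

lemma step_norm:
  shows "(L2_01_norm (step m X))\<^sup>2 = (\<Sum>l<m. (cmod (X l))\<^sup>2) / real m"
proof -
  have eq: "(cmod (step m X x))\<^sup>2 = (\<Sum>l<m. (cmod (X l))\<^sup>2 * indicator (cell m l) x)" for x
  proof (cases "\<exists>l<m. x \<in> cell m l")
    case True
    then obtain l where l: "l < m" "x \<in> cell m l" by blast
    have "(\<Sum>l<m. (cmod (X l))\<^sup>2 * indicator (cell m l) x) = (\<Sum>l'<m. if l' = l then (cmod (X l))\<^sup>2 else 0)"
      by (intro sum.cong refl) (use l in \<open>simp add: indicator_def in_cell_iff[of m x l]\<close>)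
    then show ?thesis using l by (simp add: step_in_cell)
  next
    case False
    then show ?thesis by (auto simp: step_def indicator_def intro!: sum.neutral)
  qed
  have int: "integrable U01 (\<lambda>x. (cmod (X l))\<^sup>2 * indicator (cell m l) x)" for l
    by (rule U01.integrable_const_bound[of _ "(cmod (X l))\<^sup>2"])
      (auto simp: indicator_def intro!: borel_measurable_lebesgue_on_borel)
  have "(L2_01_norm (step m X))\<^sup>2 = (\<Sum>l<m. (cmod (X l))\<^sup>2 * (LINT x|U01. indicator (cell m l) x))"
    unfolding L2_01_norm_power2 eq using int by (subst Bochner_Integration.integral_sum) auto
  also have "\<dots> = (\<Sum>l<m. (cmod (X l))\<^sup>2) / real m"
    unfolding sum_divide_distrib by (rule sum.cong) (simp_all only: lessThan_iff integral_cell times_divide_eq_right mult_1_right)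
  finally show ?thesis .
qed

context schur_kernel
begin

text \<open>The entries of the compression of the operator to step functions, up to normalisation.\<close>

definition cell_entry :: "nat \<Rightarrow> nat \<Rightarrow> nat \<Rightarrow> complex" where
  "cell_entry m l l' = kernel_form k (ind (cell m l')) (ind (cell m l))"

lemma kernel_form_step:
  "kernel_form k (step m X) (step m Y) = (\<Sum>l<m. \<Sum>l'<m. cell_entry m l l' * X l' * cnj (Y l))"
proof -
  define F where "F = (\<lambda>l l' p. k (fst p) (snd p) * ind (cell m l') (snd p) * cnj (ind (cell m l) (fst p)))"
  have int: "integrable (U01 \<Otimes>\<^sub>M U01) (F l l')" for l l'
    unfolding F_def by (intro double_integrable ind_L2 cell_borel)
  have entry: "cell_entry m l l' = integral\<^sup>L (U01 \<Otimes>\<^sub>M U01) (F l l')" for l l'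
    unfolding cell_entry_def F_def by (intro kernel_form_eq ind_L2 cell_borel)
  have eq: "k (fst p) (snd p) * step m X (snd p) * cnj (step m Y (fst p))
     = (\<Sum>l<m. \<Sum>l'<m. F l l' p * (X l' * cnj (Y l)))" for p
  proof -
    have "step m X (snd p) * cnj (step m Y (fst p))
      = (\<Sum>l'<m. \<Sum>l<m. (X l' * ind (cell m l') (snd p)) * cnj (Y l * ind (cell m l) (fst p)))"
      unfolding step_def cnj_sum by (rule sum_product)
    also have "\<dots> = (\<Sum>l<m. \<Sum>l'<m. (X l' * ind (cell m l') (snd p)) * cnj (Y l * ind (cell m l) (fst p)))"
      by (rule sum.swap)
    finally have "k (fst p) (snd p) * step m X (snd p) * cnj (step m Y (fst p))
      = (\<Sum>l<m. \<Sum>l'<m. k (fst p) (snd p) * ((X l' * ind (cell m l') (snd p)) * cnj (Y l * ind (cell m l) (fst p))))"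
      by (simp only: mult.assoc sum_distrib_left)
    then show ?thesis by (simp add: F_def mult_ac)
  qed
  show ?thesis
    unfolding kernel_form_eq[OF step_L2 step_L2] eq entry
    using int by (simp add: Bochner_Integration.integral_sum mult.assoc)
qed

lemma row_integrable: "x \<in> {0<..<1} \<Longrightarrow> integrable U01 (k x)"
  using row_measurable[of x] row[of x] by (intro integrableI_bounded) (auto intro: le_less_trans)

text \<open>For cells away from the diagonal: the kernel is almost constant on the product of the cells, which has measure \<open>1 / m\<^sup>2\<close>.\<close>

lemma cell_entry_close:
  assumes l: "l < m" "l' < m" and B: "0 \<le> B"
    and close: "\<And>x y. x \<in> cell m l \<Longrightarrow> y \<in> cell m l' \<Longrightarrow> x \<in> {0<..<1} \<Longrightarrow> y \<in> {0<..<1} \<Longrightarrow> cmod (k x y - k0) \<le> B"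
  shows "cmod (cell_entry m l l' - k0 / of_nat m ^ 2) \<le> B / real m ^ 2"
proof -
  let ?K = "integral_operator k (ind (cell m l'))"
  have ii: "integrable U01 (\<lambda>x. c * indicator (cell m q) x)" for c :: real and q
    by (rule U01.integrable_const_bound[of _ "\<bar>c\<bar>"])
      (auto simp: indicator_def intro!: borel_measurable_lebesgue_on_borel)
  have iic: "integrable U01 (\<lambda>x. c * ind (cell m q) x)" for c :: complex and q
    by (rule U01.integrable_const_bound[of _ "cmod c"])
      (auto simp: indicator_def intro!: borel_measurable_lebesgue_on_borel)
  have inner: "cmod (?K x - k0 / of_nat m) \<le> B / real m" if x: "x \<in> cell m l" "x \<in> {0<..<1}" for x
  proof -
    have kint: "integrable U01 (\<lambda>y. k x y * ind (cell m l') y)"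
    proof (rule Bochner_Integration.integrable_bound[OF row_integrable[OF x(2)]])
      show "(\<lambda>y. k x y * ind (cell m l') y) \<in> borel_measurable U01"
        by (intro borel_measurable_times row_measurable ind_measurable cell_borel x)
    qed (simp add: norm_mult indicator_def)
    have "?K x - k0 / of_nat m = (LINT y|U01. k x y * ind (cell m l') y) - (LINT y|U01. k0 * ind (cell m l') y)"
      using integral_cell(2)[OF l(2)] by (simp add: integral_operator_def)
    also have "\<dots> = (LINT y|U01. k x y * ind (cell m l') y - k0 * ind (cell m l') y)"
      by (rule Bochner_Integration.integral_diff[symmetric, OF kint iic])
    finally have "cmod (?K x - k0 / of_nat m) \<le> (LINT y|U01. cmod (k x y * ind (cell m l') y - k0 * ind (cell m l') y))"
      by (simp only: integral_norm_bound)
    also have "\<dots> \<le> (LINT y|U01. B * indicator (cell m l') y)"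
      using close[OF x(1) _ x(2)] B
      by (intro integral_mono' ii) (auto simp: indicator_def simp flip: left_diff_distrib)
    also have "\<dots> = B / real m" using integral_cell(1)[OF l(2)] by simp
    finally show ?thesis .
  qed
  have Kint: "integrable U01 (\<lambda>x. ?K x * ind (cell m l) x)"
  proof -
    have "integrable U01 (\<lambda>x. LINT y|U01. k x y * ind (cell m l') y * cnj (ind (cell m l) x))"
      using UU.integrable_fst'[OF double_integrable[OF ind_L2[OF cell_borel] ind_L2[OF cell_borel]], of m l' m l] by simp
    then show ?thesis by (simp add: integral_operator_def)
  qed
  have "cell_entry m l l' - k0 / of_nat m ^ 2 = (LINT x|U01. ?K x * ind (cell m l) x) - (LINT x|U01. k0 / of_nat m * ind (cell m l) x)"
    using integral_cell(2)[OF l(1)] by (simp add: cell_entry_def kernel_form_def power2_eq_square)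
  also have "\<dots> = (LINT x|U01. ?K x * ind (cell m l) x - k0 / of_nat m * ind (cell m l) x)"
    by (rule Bochner_Integration.integral_diff[symmetric, OF Kint iic])
  finally have "cmod (cell_entry m l l' - k0 / of_nat m ^ 2) \<le> (LINT x|U01. cmod (?K x * ind (cell m l) x - k0 / of_nat m * ind (cell m l) x))"
    by (simp only: integral_norm_bound)
  also have "\<dots> \<le> (LINT x|U01. B / real m * indicator (cell m l) x)"
    using inner B by (intro integral_mono' ii) (auto simp: indicator_def simp flip: left_diff_distrib)
  also have "\<dots> = B / real m ^ 2" using integral_cell(1)[OF l(1)] by (simp add: power2_eq_square)
  finally show ?thesis .
qed

text \<open>For cells near the diagonal, where the kernel is unbounded.\<close>

lemma cell_entry_small:
  assumes l: "l < m" and R: "0 \<le> R"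
    and bd: "\<And>x. x \<in> {0<..<1} \<Longrightarrow> (\<integral>\<^sup>+y. ennreal (cmod (k x y)) * indicator (cell m l') y \<partial>U01) \<le> ennreal R"
  shows "cmod (cell_entry m l l') \<le> R / real m"
proof -
  let ?K = "integral_operator k (ind (cell m l'))"
  have ii: "integrable U01 (\<lambda>x. c * indicator (cell m q) x)" for c :: real and q
    by (rule U01.integrable_const_bound[of _ "\<bar>c\<bar>"])
      (auto simp: indicator_def intro!: borel_measurable_lebesgue_on_borel)
  have inner: "cmod (?K x) \<le> R" if x: "x \<in> {0<..<1}" for x
  proof -
    have kint: "integrable U01 (\<lambda>y. k x y * ind (cell m l') y)"
    proof (rule Bochner_Integration.integrable_bound[OF row_integrable[OF x]])
      show "(\<lambda>y. k x y * ind (cell m l') y) \<in> borel_measurable U01"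
        by (intro borel_measurable_times row_measurable ind_measurable cell_borel x)
    qed (simp add: norm_mult indicator_def)
    have "ennreal (cmod (?K x)) \<le> (\<integral>\<^sup>+y. ennreal (norm (k x y * ind (cell m l') y)) \<partial>U01)"
      unfolding integral_operator_def by (rule integral_norm_bound_ennreal[OF kint])
    also have "\<dots> = (\<integral>\<^sup>+y. ennreal (cmod (k x y)) * indicator (cell m l') y \<partial>U01)"
      by (intro nn_integral_cong) (auto simp: norm_mult indicator_def)
    also have "\<dots> \<le> ennreal R" by (rule bd[OF x])
    finally show ?thesis using R by simp
  qed
  have "cmod (cell_entry m l l') \<le> (LINT x|U01. cmod (?K x * cnj (ind (cell m l) x)))"
    unfolding cell_entry_def kernel_form_def by (rule integral_norm_bound)
  also have "\<dots> \<le> (LINT x|U01. R * indicator (cell m l) x)"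
    using inner R by (intro integral_mono' ii) (auto simp: indicator_def)
  also have "\<dots> = R / real m" using integral_cell(1)[OF l] by simp
  finally show ?thesis .
qed

end

section \<open>Discretization of the integral operator\<close>

text \<open>Comparison with the integral of \<open>x powr (s - 1)\<close>, by the mean value theorem.\<close>

lemma sum_powr_le:
  assumes s: "0 < s" "s < 1"
  shows "(\<Sum>d=1..n. real d powr (s - 1)) \<le> real n powr s / s"
proof (induction n)
  case 0
  then show ?case using s by simp
next
  case (Suc n)
  have step: "real (Suc n) powr (s - 1) \<le> real (Suc n) powr s / s - real n powr s / s"
  proof (cases "n = 0")
    case True
    then show ?thesis using s by simp
  next
    case False
    have "\<exists>z>real n. z < real n + 1 \<and> (real n + 1) powr s - real n powr s = (real n + 1 - real n) * (s * z powr (s - 1))"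
      using False by (intro MVT2) (auto intro!: derivative_eq_intros simp: powr_diff)
    then obtain z where z: "real n < z" "z < real n + 1" "(real n + 1) powr s - real n powr s = s * z powr (s - 1)"
      by auto
    have "(real n + 1) powr (s - 1) \<le> z powr (s - 1)"
      using z False s powr_mono2'[of "s - 1" z "real n + 1"] by auto
    then show ?thesis using z(3) s by (simp add: field_simps)
  qed
  show ?case using Suc step by simp
qed

lemma powr_nat_at_top: "0 < s \<Longrightarrow> filterlim (\<lambda>n. real n powr s) at_top sequentially"
  by (rule filterlim_compose[OF real_powr_at_top filterlim_real_sequentially])

text \<open>Errors of order \<open>o(d powr (s - 1))\<close> sum up to \<open>o(n powr s)\<close>; this is what Schur's test will be fed with.\<close>

lemma error_sum_small:
  fixes e :: "nat \<Rightarrow> real"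
  assumes s: "0 < s" "s < 1" and e: "\<And>d. 0 \<le> e d"
    and lim: "(\<lambda>d. e d * real d powr (1 - s)) \<longlonglongrightarrow> 0" and \<epsilon>: "0 < \<epsilon>"
  shows "eventually (\<lambda>n. (\<Sum>d<n. e d) \<le> \<epsilon> * real n powr s) sequentially"
proof -
  have "eventually (\<lambda>d. e d * real d powr (1 - s) < \<epsilon> * s / 2) sequentially"
    by (rule order_tendstoD(2)[OF lim]) (use \<epsilon> s in simp)
  then obtain D where D: "\<And>d. d \<ge> D \<Longrightarrow> e d * real d powr (1 - s) < \<epsilon> * s / 2"
    by (auto simp: eventually_sequentially)
  define D' where "D' = Suc D"
  define K where "K = (\<Sum>d<D'. e d)"
  have tail: "e d \<le> \<epsilon> * s / 2 * real d powr (s - 1)" if "d \<ge> D'" for d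
  proof -
    have d: "real d > 0" using that by (simp add: D'_def)
    have "e d = e d * real d powr (1 - s) * real d powr (s - 1)"
      using d by (simp add: mult.assoc flip: powr_add)
    also have "\<dots> \<le> \<epsilon> * s / 2 * real d powr (s - 1)"
      using D[of d] that by (intro mult_right_mono) (auto simp: D'_def)
    finally show ?thesis .
  qed
  have "eventually (\<lambda>n. real n powr s \<ge> K / (\<epsilon> / 2)) sequentially"
    using powr_nat_at_top[OF s(1)] by (simp add: filterlim_at_top)
  then show ?thesis
    using eventually_ge_at_top[of D']
  proof eventually_elim
    case (elim n)
    have "(\<Sum>d<n. e d) = K + (\<Sum>d\<in>{D'..<n}. e d)"
      unfolding K_def using elim by (subst sum.union_disjoint[symmetric]) (auto intro!: sum.cong)
    also have "(\<Sum>d\<in>{D'..<n}. e d) \<le> (\<Sum>d\<in>{D'..<n}. \<epsilon> * s / 2 * real d powr (s - 1))"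
      by (intro sum_mono tail) auto
    also have "\<dots> \<le> (\<Sum>d=1..n. \<epsilon> * s / 2 * real d powr (s - 1))"
      using \<epsilon> s by (intro sum_mono2) (auto simp: D'_def)
    also have "\<dots> = \<epsilon> * s / 2 * (\<Sum>d=1..n. real d powr (s - 1))" by (simp add: sum_distrib_left)
    also have "\<dots> \<le> \<epsilon> * s / 2 * (real n powr s / s)"
      using \<epsilon> s by (intro mult_left_mono sum_powr_le) auto
    also have "\<dots> = \<epsilon> / 2 * real n powr s" using s by simp
    also have "K \<le> \<epsilon> / 2 * real n powr s" using elim(1) \<epsilon> by (simp add: field_simps)
    finally show ?case by simp
  qed
qed

lemma powr_of_real_diff_le:
  fixes \<gamma> :: complex
  assumes p: "0 < p" "p \<le> x" "p \<le> y" and \<gamma>: "Re \<gamma> \<le> 1"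
  shows "cmod (of_real x powr \<gamma> - of_real y powr \<gamma>) \<le> cmod \<gamma> * p powr (Re \<gamma> - 1) * \<bar>x - y\<bar>"
proof -
  have "norm (of_real x powr \<gamma> - of_real y powr \<gamma>) \<le> (cmod \<gamma> * p powr (Re \<gamma> - 1)) * norm (x - y)"
  proof (rule differentiable_bound[where S = "{p..}" and f' = "\<lambda>t h. h *\<^sub>R (\<gamma> * of_real t powr (\<gamma> - 1))"])
    fix t assume t: "t \<in> {p..}"
    then have t0: "t > 0" using p by simp
    have "((\<lambda>z. z powr \<gamma>) has_field_derivative \<gamma> * of_real t powr (\<gamma> - 1)) (at (of_real t))"
      using t0 by (intro has_field_derivative_powr) (auto simp: complex_nonpos_Reals_iff)
    then have "((\<lambda>t. of_real t powr \<gamma>) has_vector_derivative \<gamma> * of_real t powr (\<gamma> - 1)) (at t)"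
      by (rule has_vector_derivative_real_field)
    then show "((\<lambda>t. of_real t powr \<gamma>) has_derivative (\<lambda>h. h *\<^sub>R (\<gamma> * of_real t powr (\<gamma> - 1)))) (at t within {p..})"
      unfolding has_vector_derivative_def by (rule has_derivative_at_withinI)
    have "t powr (Re \<gamma> - 1) \<le> p powr (Re \<gamma> - 1)"
      using t p \<gamma> by (intro powr_mono2') auto
    then have "cmod (\<gamma> * of_real t powr (\<gamma> - 1)) \<le> cmod \<gamma> * p powr (Re \<gamma> - 1)"
      using t0 by (simp add: norm_mult norm_powr_real_powr mult_left_mono)
    then show "onorm (\<lambda>h. h *\<^sub>R (\<gamma> * of_real t powr (\<gamma> - 1))) \<le> cmod \<gamma> * p powr (Re \<gamma> - 1)"
      by (intro onorm_le) (metis abs_ge_zero mult.commute mult_right_mono norm_scaleR real_norm_def)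
  qed (use p in auto)
  then show ?thesis by simp
qed

text \<open>The factor is chosen such that \<open>u \<mapsto> step m (block_sum N m u)\<close> has norm at most \<open>1\<close>: the sum over a block of length
  \<open>N\<close> costs \<open>sqrt N\<close>, and each of the \<open>m\<close> cells has measure \<open>1 / m\<close>.\<close>

definition block_sum :: "nat \<Rightarrow> nat \<Rightarrow> (nat \<Rightarrow> complex) \<Rightarrow> nat \<Rightarrow> complex" where
  "block_sum N m u l = of_real (sqrt (real m / real N)) * (\<Sum>s<N. u (N * l + s))"

lemma sum_blocks:
  fixes g :: "nat \<Rightarrow> 'a::comm_monoid_add"
  shows "(\<Sum>j<N * m. g j) = (\<Sum>l<m. \<Sum>s<N. g (N * l + s))"
proof -
  have "(\<Sum>j<N * m. g j) = (\<Sum>l<m. sum g {l * N..<l * N + N})"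
    by (simp only: sum.nat_group mult.commute)
  moreover have "sum g {l * N..<l * N + N} = (\<Sum>s<N. g (N * l + s))" for l
    by (rule sum.reindex_bij_witness[of _ "\<lambda>s. N * l + s" "\<lambda>j. j - l * N"]) (auto simp: mult.commute)
  ultimately show ?thesis by simp
qed

lemma (in schur_kernel) kernel_form_block_sum:
  assumes N: "0 < N"
  shows "kernel_form k (step m (block_sum N m u)) (step m (block_sum N m v))
    = form (N * m) (\<lambda>j i. of_real (real m / real N) * cell_entry m (j div N) (i div N)) u v"
proof -
  define c where "c = complex_of_real (real m / real N)"
  have cc: "of_real (sqrt (real m / real N)) * cnj (of_real (sqrt (real m / real N))) = c"
    unfolding c_def by (simp only: complex_cnj_complex_of_real of_real_mult[symmetric] real_sqrt_mult_self) simp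
  have "kernel_form k (step m (block_sum N m u)) (step m (block_sum N m v))
    = (\<Sum>l<m. \<Sum>l'<m. \<Sum>s<N. \<Sum>s'<N. c * cell_entry m l l' * u (N * l' + s') * cnj (v (N * l + s)))"
    unfolding kernel_form_step
  proof (intro sum.cong refl)
    fix l l'
    define U where "U = (\<Sum>s'<N. u (N * l' + s'))"
    define V where "V = (\<Sum>s<N. v (N * l + s))"
    have "cell_entry m l l' * block_sum N m u l' * cnj (block_sum N m v l)
      = c * cell_entry m l l' * (cnj V * U)"
      unfolding block_sum_def U_def[symmetric] V_def[symmetric] complex_cnj_mult cc[symmetric] by (simp only: mult_ac)
    also have "cnj V * U = (\<Sum>s<N. \<Sum>s'<N. cnj (v (N * l + s)) * u (N * l' + s'))"
      unfolding U_def V_def cnj_sum by (rule sum_product)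
    finally show "cell_entry m l l' * block_sum N m u l' * cnj (block_sum N m v l)
      = (\<Sum>s<N. \<Sum>s'<N. c * cell_entry m l l' * u (N * l' + s') * cnj (v (N * l + s)))"
      by (simp add: sum_distrib_left mult_ac)
  qed
  also have "\<dots> = (\<Sum>l<m. \<Sum>s<N. \<Sum>l'<m. \<Sum>s'<N. c * cell_entry m l l' * u (N * l' + s') * cnj (v (N * l + s)))"
    by (intro sum.cong refl sum.swap)
  also have "\<dots> = form (N * m) (\<lambda>j i. c * cell_entry m (j div N) (i div N)) u v"
    unfolding form_def sum_blocks
    by (intro sum.cong refl) (use N in simp)
  finally show ?thesis by (simp only: c_def)
qed

text \<open>The point \<open>j / (N * m)\<close> lies in the same cell as \<open>x\<close>, and cells have length \<open>1 / m\<close>.\<close>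

lemma cell_block_close:
  assumes N: "0 < N" and m: "0 < m" and x: "x \<in> cell m (j div N)"
  shows "\<bar>x - real j / real (N * m)\<bar> \<le> real N / real (N * m)"
proof -
  define l where "l = j div N"
  have "N * l \<le> j" "j < N * l + N" unfolding l_def
    using dividend_less_times_div[OF N, of j] by (simp_all add: add.commute)
  then have j: "real N * real l \<le> real j" "real j \<le> real N * real l + real N"
    by (simp_all only: of_nat_mult[symmetric] of_nat_add[symmetric] of_nat_le_iff less_imp_le)
  have nm: "0 < real N * real m" using N m by simp
  have x': "real l * real N \<le> x * (real N * real m)" "x * (real N * real m) \<le> (real l + 1) * real N"
  proof -
    have "real l \<le> x * real m" "x * real m \<le> real l + 1"
      using x m unfolding cell_def l_def[symmetric] by (auto simp: divide_le_eq less_divide_eq)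
    then show "real l * real N \<le> x * (real N * real m)" "x * (real N * real m) \<le> (real l + 1) * real N"
      using mult_right_mono[of "real l" "x * real m" "real N"] mult_right_mono[of "x * real m" "real l + 1" "real N"]
      by (simp_all add: mult_ac)
  qed
  have "\<bar>x * (real N * real m) - real j\<bar> \<le> real N"
    using j x' by (simp add: abs_le_iff algebra_simps)
  then have "\<bar>x * (real N * real m) - real j\<bar> / (real N * real m) \<le> real N / (real N * real m)"
    by (rule divide_right_mono) (use nm in simp)
  moreover have "\<bar>x * (real N * real m) - real j\<bar> / (real N * real m) = \<bar>x - real j / real (N * m)\<bar>"
  proof -
    have "x - real j / real (N * m) = (x * (real N * real m) - real j) / (real N * real m)"
      using N m by (simp add: diff_divide_distrib)
    then show ?thesis using nm by (simp add: abs_divide)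
  qed
  ultimately show ?thesis by simp
qed

context
  fixes \<alpha> \<beta> :: complex and N :: nat
  assumes \<alpha>: "0 < Re \<alpha>" "Re \<alpha> < 1 / 2" and N: "0 < N"
begin

interpretation schur_kernel "fh_kernel \<alpha> \<beta>" "schur_bound \<alpha> \<beta>"
  by (rule fh_schur_kernel[OF \<alpha>])

text \<open>The matrix entry that stands for the integral operator: the value at \<open>(j, i)\<close> depends only on the blocks of \<open>j\<close> and \<open>i\<close>.
  The power of \<open>N * m\<close> undoes the scaling to the unit interval.\<close>

definition scaled_entry :: "nat \<Rightarrow> nat \<Rightarrow> nat \<Rightarrow> complex" where
  "scaled_entry m j i = of_real (real (N * m)) powr (2 * \<alpha>) * (of_real (real m / real N) * cell_entry m (j div N) (i div N))"

definition far_const :: real where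
  "far_const = kernel_bound \<alpha> \<beta> * cmod (2 * \<alpha> - 1) * (2 * real N) * (1 / 2) powr (2 * Re \<alpha> - 2)"

text \<open>The kernel is homogeneous of degree \<open>2 * \<alpha> - 1\<close>, and on the cells of \<open>j\<close> and \<open>i\<close> its argument deviates from
  \<open>d / (N * m)\<close> by at most \<open>2 / m\<close>. The mean value theorem gains one power of \<open>d\<close>.\<close>

lemma scaled_entry_far:
  assumes j: "j < N * m" "i < N * m" and d: "d = nat \<bar>int j - int i\<bar>" "4 * N \<le> d"
  shows "cmod (scaled_entry m j i - (if i < j then C_plus \<alpha> \<beta> else C_minus \<alpha> \<beta>) * of_real (real d) powr (2 * \<alpha> - 1))
    \<le> far_const * real d powr (2 * Re \<alpha> - 2)"
proof -
  define n where "n = real (N * m)"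
  define \<gamma> where "\<gamma> = 2 * \<alpha> - 1"
  define c where "c = (if i < j then C_plus \<alpha> \<beta> else C_minus \<alpha> \<beta>)"
  have m: "0 < m" using j by (cases m) auto
  have n: "0 < n" using m N by (simp add: n_def)
  have nN: "n = real N * real m" by (simp add: n_def)
  have dr: "4 * real N \<le> real d" using d(2) by (metis of_nat_le_iff of_nat_mult of_nat_numeral)
  have dpos: "0 < real d" using dr N by (smt (verit) of_nat_0_less_iff)
  have \<gamma>: "Re \<gamma> = 2 * Re \<alpha> - 1" by (simp add: \<gamma>_def)
  have cle: "cmod c \<le> kernel_bound \<alpha> \<beta>" by (simp add: c_def kernel_bound_def)
  have l: "j div N < m" "i div N < m" using j by (simp_all add: less_mult_imp_div_less mult.commute)
  \<comment> \<open>the deviation of the argument, \<open>2 * N / n\<close>, is at most half of \<open>d / n\<close> because \<open>d \<ge> 4 * N\<close>\<close>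
  define p where "p = real d / (2 * n)"
  define k0 where "k0 = c * of_real (real d / n) powr \<gamma>"
  define B where "B = kernel_bound \<alpha> \<beta> * (cmod \<gamma> * p powr (2 * Re \<alpha> - 2) * (2 * real N / n))"
  have B0: "0 \<le> B" using kernel_bound_nonneg[of \<alpha> \<beta>] n by (simp add: B_def)
  have p0: "0 < p" using dpos n by (simp add: p_def)
  have pd: "p \<le> real d / n" using dpos n by (simp add: p_def field_simps)
  have close: "cmod (fh_kernel \<alpha> \<beta> x y - k0) \<le> B" if x: "x \<in> cell m (j div N)" and y: "y \<in> cell m (i div N)" for x y
  proof -
    have ax: "\<bar>x - real j / n\<bar> \<le> real N / n" "\<bar>y - real i / n\<bar> \<le> real N / n"
      using cell_block_close[OF N m x] cell_block_close[OF N m y] by (simp_all add: n_def)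
    define t where "t = (if i < j then x - y else y - x)"
    have rd: "real d / n = (if i < j then real j / n - real i / n else real i / n - real j / n)"
      using d(1) by (auto simp: diff_divide_distrib[symmetric] of_nat_diff nat_minus_as_int)
    have td: "\<bar>t - real d / n\<bar> \<le> 2 * real N / n"
      using ax unfolding t_def rd by (auto simp: abs_le_iff)
    have "2 * real N / n \<le> p" using dr n by (simp add: p_def divide_simps)
    moreover have "real d / n = 2 * p" using n by (simp add: p_def)
    ultimately have pt: "p \<le> t" using td by linarith
    then have t0: "0 < t" using p0 by linarith
    have "fh_kernel \<alpha> \<beta> x y = c * of_real t powr \<gamma>"
      using t0 by (auto simp: fh_kernel_def c_def \<gamma>_def t_def)
    then have "fh_kernel \<alpha> \<beta> x y - k0 = c * (of_real t powr \<gamma> - of_real (real d / n) powr \<gamma>)"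
      by (simp add: k0_def right_diff_distrib)
    then have "cmod (fh_kernel \<alpha> \<beta> x y - k0) = cmod c * cmod (of_real t powr \<gamma> - of_real (real d / n) powr \<gamma>)"
      by (simp add: norm_mult)
    also have "\<dots> \<le> kernel_bound \<alpha> \<beta> * (cmod \<gamma> * p powr (Re \<gamma> - 1) * \<bar>t - real d / n\<bar>)"
      using \<alpha> by (intro mult_mono cle powr_of_real_diff_le p0 pt pd kernel_bound_nonneg) (auto simp: \<gamma>)
    also have "\<dots> \<le> kernel_bound \<alpha> \<beta> * (cmod \<gamma> * p powr (Re \<gamma> - 1) * (2 * real N / n))"
      by (intro mult_left_mono td kernel_bound_nonneg) auto
    finally show ?thesis by (simp add: B_def \<gamma>)
  qed
  have ce: "cmod (cell_entry m (j div N) (i div N) - k0 / of_nat m ^ 2) \<le> B / real m ^ 2"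
    by (rule cell_entry_close[OF l B0 close])
  define Z where "Z = complex_of_real n powr (2 * \<alpha>) * of_real (real m / real N)"
  have Zc: "Z * (k0 / of_nat m ^ 2) = c * of_real (real d) powr \<gamma>"
  proof -
    have 1: "complex_of_real n powr (2 * \<alpha>) = of_real n powr \<gamma> * of_real n"
      using n by (simp add: \<gamma>_def powr_diff)
    have 2: "of_real n powr \<gamma> * of_real (real d / n) powr \<gamma> = of_real (real d) powr \<gamma>"
    proof -
      have "of_real n powr \<gamma> * of_real (real d / n) powr \<gamma> = (of_real n * of_real (real d / n)) powr \<gamma>"
        using n dpos by (intro powr_times_real[symmetric]) auto
      then show ?thesis using n by simp
    qed
    have 3: "complex_of_real n * (of_real (real m / real N) / of_nat m ^ 2) = 1"
      using N m by (simp add: nN power2_eq_square)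
    have "Z * (k0 / of_nat m ^ 2) = c * (of_real n powr \<gamma> * of_real (real d / n) powr \<gamma>) * (complex_of_real n * (of_real (real m / real N) / of_nat m ^ 2))"
      unfolding Z_def k0_def 1 by (simp only: divide_inverse mult_ac)
    then show ?thesis unfolding 2 3 by simp
  qed
  have "scaled_entry m j i - c * of_real (real d) powr \<gamma> = Z * (cell_entry m (j div N) (i div N) - k0 / of_nat m ^ 2)"
    unfolding right_diff_distrib Zc by (simp add: scaled_entry_def Z_def n_def mult.assoc)
  then have "cmod (scaled_entry m j i - c * of_real (real d) powr \<gamma>) = cmod Z * cmod (cell_entry m (j div N) (i div N) - k0 / of_nat m ^ 2)"
    by (simp add: norm_mult)
  also have "\<dots> \<le> cmod Z * (B / real m ^ 2)" by (intro mult_left_mono ce) simp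
  also have "cmod Z = n powr (2 * Re \<alpha>) * (real m / real N)"
    using n unfolding Z_def norm_mult norm_of_real by (simp add: norm_powr_real_powr)
  also have "n powr (2 * Re \<alpha>) * (real m / real N) * (B / real m ^ 2) = far_const * real d powr (2 * Re \<alpha> - 2)"
  proof -
    have pp: "p powr (2 * Re \<alpha> - 2) = (1 / 2) powr (2 * Re \<alpha> - 2) * (real d powr (2 * Re \<alpha> - 2) / n powr (2 * Re \<alpha> - 2))"
    proof -
      have "p = (1 / 2) * (real d / n)" by (simp add: p_def)
      then show ?thesis using n dpos by (simp only: powr_mult powr_divide)
    qed
    have np: "n powr (2 * Re \<alpha>) = n powr (2 * Re \<alpha> - 2) * n ^ 2"
      using n by (simp add: powr_diff)
    have 3: "n ^ 2 * (real m / real N) / real m ^ 2 / n = 1"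
      using N m by (simp add: nN power2_eq_square)
    have nz: "n powr (2 * Re \<alpha> - 2) \<noteq> 0" using n by simp
    have "n powr (2 * Re \<alpha>) * (real m / real N) * (B / real m ^ 2)
      = kernel_bound \<alpha> \<beta> * cmod \<gamma> * (2 * real N) * (1 / 2) powr (2 * Re \<alpha> - 2) * real d powr (2 * Re \<alpha> - 2)
        * (n powr (2 * Re \<alpha> - 2) / n powr (2 * Re \<alpha> - 2)) * (n ^ 2 * (real m / real N) / real m ^ 2 / n)"
      unfolding B_def pp np by (simp only: divide_inverse mult_ac)
    then show ?thesis using nz unfolding 3 by (simp add: far_const_def \<gamma>_def)
  qed
  finally show ?thesis by (simp add: c_def \<gamma>_def)
qed

text \<open>By homogeneity the bound does not depend on \<open>m\<close>. It is used for the boundedly many diagonals next to the main one.\<close>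

lemma scaled_entry_bounded:
  assumes j: "j < N * m" "i < N * m"
  shows "cmod (scaled_entry m j i) \<le> schur_bound \<alpha> \<beta>"
proof -
  define s where "s = 2 * Re \<alpha>"
  have s: "0 < s" "s < 1" using \<alpha> by (auto simp: s_def)
  have m: "0 < m" using j by (cases m) auto
  have l: "j div N < m" "i div N < m" using j by (simp_all add: less_mult_imp_div_less mult.commute)
  define R where "R = schur_bound \<alpha> \<beta> * (1 / real m) powr s"
  have sb: "0 \<le> schur_bound \<alpha> \<beta>" by (rule H_nonneg)
  have R0: "0 \<le> R" using sb by (simp add: R_def)
  have Rb: "(\<integral>\<^sup>+y. ennreal (cmod (fh_kernel \<alpha> \<beta> x y)) * indicator (cell m (i div N)) y \<partial>U01) \<le> ennreal R" for x
  proof -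
    have "(\<integral>\<^sup>+y. ennreal (cmod (fh_kernel \<alpha> \<beta> x y)) * indicator (cell m (i div N)) y \<partial>U01)
      \<le> ennreal (kernel_bound \<alpha> \<beta>) * (ennreal (2 * (1 / real m) powr (2 * Re \<alpha>) / (2 * Re \<alpha>))
      + ennreal ((1 / real m) powr (2 * Re \<alpha> - 1)) * emeasure lebesgue (cell m (i div N) \<inter> {0<..<1}))"
      using m by (intro fh_kernel_row_le \<alpha>) (auto simp: cell_def)
    also have "\<dots> = ennreal (kernel_bound \<alpha> \<beta>) * (ennreal 1 * ennreal (2 * (1 / real m) powr s / s) + ennreal ((1 / real m) powr (s - 1)) * ennreal (1 / real m))"
      unfolding emeasure_cell[OF l(2)] by (simp add: s_def)
    also have "\<dots> = ennreal (kernel_bound \<alpha> \<beta> * (1 * (2 * (1 / real m) powr s / s) + (1 / real m) powr (s - 1) * (1 / real m)))"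
      using kernel_bound_nonneg[of \<alpha> \<beta>] s by (subst ennreal_lincomb) (auto simp: ennreal_mult)
    also have "(1 / real m) powr (s - 1) * (1 / real m) = (1 / real m) powr s"
      using m by (simp add: powr_diff)
    finally show ?thesis by (simp add: R_def schur_bound_def s_def algebra_simps)
  qed
  have "cmod (cell_entry m (j div N) (i div N)) \<le> R / real m"
    by (rule cell_entry_small[OF l(1) R0 Rb])
  then have "cmod (scaled_entry m j i) \<le> real (N * m) powr s * ((real m / real N) * (R / real m))"
    unfolding scaled_entry_def norm_mult norm_of_real
    by (intro mult_mono) (auto simp: norm_powr_real_powr s_def)
  also have "\<dots> = schur_bound \<alpha> \<beta> * (real N powr s / real N)"
  proof -
    have "real (N * m) powr s * (1 / real m) powr s = real N powr s"
      using m by (simp add: powr_mult powr_divide)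
    moreover have "(real m / real N) * (R / real m) = R / real N" using m by simp
    ultimately show ?thesis by (simp add: R_def mult_ac)
  qed
  also have "\<dots> \<le> schur_bound \<alpha> \<beta> * 1"
  proof (intro mult_left_mono sb)
    have "real N powr s \<le> real N powr 1" using N s by (intro powr_mono) auto
    then show "real N powr s / real N \<le> 1" using N by (simp add: divide_le_eq)
  qed
  finally show ?thesis by simp
qed

definition coeff_error :: "nat \<Rightarrow> real" where
  "coeff_error d = cmod (model_coeff \<alpha> \<beta> (int d) * of_nat d powr (1 - 2 * \<alpha>) - C_plus \<alpha> \<beta>)
     + cmod (model_coeff \<alpha> \<beta> (- int d) * of_nat d powr (1 - 2 * \<alpha>) - C_minus \<alpha> \<beta>)"

text \<open>Depends on the distance \<open>d\<close> from the diagonal only, as Schur's test requires.\<close>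

definition entry_error :: "nat \<Rightarrow> real" where
  "entry_error d = (if d < 4 * N
     then (\<Sum>q<4 * N. cmod (model_coeff \<alpha> \<beta> (int q)) + cmod (model_coeff \<alpha> \<beta> (- int q))) + schur_bound \<alpha> \<beta>
     else coeff_error d * real d powr (2 * Re \<alpha> - 1) + far_const * real d powr (2 * Re \<alpha> - 2))"

lemma far_const_nonneg: "0 \<le> far_const"
  using kernel_bound_nonneg[of \<alpha> \<beta>] by (simp add: far_const_def)

lemma entry_error_nonneg: "0 \<le> entry_error d"
  using far_const_nonneg H_nonneg by (simp add: entry_error_def coeff_error_def sum_nonneg)

lemma entry_error_lim: "(\<lambda>d. entry_error d * real d powr (1 - 2 * Re \<alpha>)) \<longlonglongrightarrow> 0"
proof -
  have "coeff_error \<longlonglongrightarrow> cmod (C_plus \<alpha> \<beta> - C_plus \<alpha> \<beta>) + cmod (C_minus \<alpha> \<beta> - C_minus \<alpha> \<beta>)"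
    unfolding coeff_error_def[abs_def] by (intro tendsto_intros model_coeff_asymp \<alpha>)
  moreover have "(\<lambda>d. far_const / real d) \<longlonglongrightarrow> 0" by (rule lim_const_over_n)
  ultimately have "(\<lambda>d. coeff_error d + far_const / real d) \<longlonglongrightarrow> 0"
    using tendsto_add by fastforce
  moreover have "eventually (\<lambda>d. coeff_error d + far_const / real d = entry_error d * real d powr (1 - 2 * Re \<alpha>)) sequentially"
    using eventually_ge_at_top[of "4 * N"]
  proof eventually_elim
    case (elim d)
    then have d: "0 < real d" using N by simp
    have "real d powr (2 * Re \<alpha> - 1) * real d powr (1 - 2 * Re \<alpha>) = 1"
      using d by (simp flip: powr_add)
    moreover have "real d powr (2 * Re \<alpha> - 2) * real d powr (1 - 2 * Re \<alpha>) = 1 / real d"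
      using d by (simp add: powr_minus_divide flip: powr_add)
    ultimately show ?case using elim by (simp add: entry_error_def distrib_right mult.assoc)
  qed
  ultimately show ?thesis by (rule Lim_transform_eventually)
qed

lemma entry_error_bound:
  assumes j: "j < N * m" "i < N * m"
  shows "cmod (model_coeff \<alpha> \<beta> (int j - int i) - scaled_entry m j i) \<le> entry_error (nat \<bar>int j - int i\<bar>)"
proof -
  define d where "d = nat \<bar>int j - int i\<bar>"
  show ?thesis
  proof (cases "d < 4 * N")
    case True
    let ?g = "\<lambda>q. cmod (model_coeff \<alpha> \<beta> (int q)) + cmod (model_coeff \<alpha> \<beta> (- int q))"
    have "int j - int i = int d \<or> int j - int i = - int d" by (auto simp: d_def)
    then have "cmod (model_coeff \<alpha> \<beta> (int j - int i)) \<le> ?g d" by auto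
    also have "?g d \<le> (\<Sum>q<4 * N. ?g q)" using True by (intro member_le_sum) auto
    finally have "cmod (model_coeff \<alpha> \<beta> (int j - int i) - scaled_entry m j i) \<le> (\<Sum>q<4 * N. ?g q) + schur_bound \<alpha> \<beta>"
      using scaled_entry_bounded[OF j] by (intro order_trans[OF norm_triangle_ineq4] add_mono)
    then show ?thesis using True by (simp add: entry_error_def d_def)
  next
    case False
    then have d4: "4 * N \<le> d" by simp
    then have dpos: "0 < d" using N by simp
    define c where "c = (if i < j then C_plus \<alpha> \<beta> else C_minus \<alpha> \<beta>)"
    define P where "P = complex_of_real (real d) powr (2 * \<alpha> - 1)"
    define w where "w = model_coeff \<alpha> \<beta> (int j - int i)"
    have PP: "of_nat d powr (1 - 2 * \<alpha>) * P = 1"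
      using dpos by (simp add: P_def flip: powr_add)
    have Pn: "cmod P = real d powr (2 * Re \<alpha> - 1)" by (simp add: P_def norm_powr_real_powr)
    have ce: "cmod (w * of_nat d powr (1 - 2 * \<alpha>) - c) \<le> coeff_error d"
    proof (cases "i < j")
      case True
      then have "int j - int i = int d" by (simp add: d_def)
      then show ?thesis using True by (simp add: w_def c_def coeff_error_def)
    next
      case False
      then have "int j - int i = - int d" by (simp add: d_def)
      then show ?thesis using False by (simp add: w_def c_def coeff_error_def)
    qed
    have "w - c * P = (w * of_nat d powr (1 - 2 * \<alpha>) - c) * P"
      using PP by (simp add: left_diff_distrib mult.assoc)
    then have "cmod (w - c * P) = cmod (w * of_nat d powr (1 - 2 * \<alpha>) - c) * real d powr (2 * Re \<alpha> - 1)"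
      by (simp add: norm_mult Pn)
    also have "\<dots> \<le> coeff_error d * real d powr (2 * Re \<alpha> - 1)"
      by (intro mult_right_mono ce) simp
    finally have 1: "cmod (w - c * P) \<le> coeff_error d * real d powr (2 * Re \<alpha> - 1)" .
    have 2: "cmod (scaled_entry m j i - c * P) \<le> far_const * real d powr (2 * Re \<alpha> - 2)"
      unfolding c_def P_def by (rule scaled_entry_far[OF j d_def d4])
    have "cmod (w - scaled_entry m j i) \<le> cmod (w - c * P) + cmod (scaled_entry m j i - c * P)"
      using norm_triangle_ineq4[of "w - c * P" "scaled_entry m j i - c * P"] by simp
    also have "\<dots> \<le> entry_error d" using 1 2 d4 by (simp add: entry_error_def)
    finally show ?thesis by (simp add: w_def d_def)
  qed
qed

text \<open>The coefficient matrix of the model symbol acts like the integral operator, scaled by \<open>n powr (2 * \<alpha>)\<close> and compressed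
  to step functions with cells of \<open>N\<close> indices. The freedom in \<open>N\<close> is what separates several singularities later.\<close>

lemma discretization:
  assumes \<epsilon>: "0 < \<epsilon>"
  shows "eventually (\<lambda>m. \<forall>u v. cmod (form (N * m) (\<lambda>j i. model_coeff \<alpha> \<beta> (int j - int i)) u v
      - of_real (real (N * m)) powr (2 * \<alpha>) * kernel_form (fh_kernel \<alpha> \<beta>) (step m (block_sum N m u)) (step m (block_sum N m v)))
    \<le> \<epsilon> * real (N * m) powr (2 * Re \<alpha>) * l2 (N * m) u * l2 (N * m) v) sequentially"
proof -
  have s: "0 < 2 * Re \<alpha>" "2 * Re \<alpha> < 1" using \<alpha> by auto
  have "eventually (\<lambda>n. (\<Sum>d<n. entry_error d) \<le> \<epsilon> / 2 * real n powr (2 * Re \<alpha>)) sequentially"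
    using \<epsilon> by (intro error_sum_small s entry_error_nonneg entry_error_lim) simp
  moreover have "filterlim (\<lambda>m. N * m) at_top sequentially"
    using N by (simp add: mult_nat_left_at_top)
  ultimately have "eventually (\<lambda>m. (\<Sum>d<N * m. entry_error d) \<le> \<epsilon> / 2 * real (N * m) powr (2 * Re \<alpha>)) sequentially"
    by (rule eventually_compose_filterlim)
  then show ?thesis
  proof eventually_elim
    case (elim m)
    show ?case
    proof (intro allI)
      fix u v
      have eq: "form (N * m) (\<lambda>j i. model_coeff \<alpha> \<beta> (int j - int i)) u v
        - of_real (real (N * m)) powr (2 * \<alpha>) * kernel_form (fh_kernel \<alpha> \<beta>) (step m (block_sum N m u)) (step m (block_sum N m v))
        = form (N * m) (\<lambda>j i. model_coeff \<alpha> \<beta> (int j - int i) - scaled_entry m j i) u v"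
        unfolding kernel_form_block_sum[OF N] form_diff scaled_entry_def form_cmult ..
      have "cmod (form (N * m) (\<lambda>j i. model_coeff \<alpha> \<beta> (int j - int i) - scaled_entry m j i) u v)
        \<le> 2 * (\<Sum>d<N * m. entry_error d) * l2 (N * m) u * l2 (N * m) v"
        by (intro form_schur entry_error_nonneg entry_error_bound)
      also have "\<dots> \<le> 2 * (\<epsilon> / 2 * real (N * m) powr (2 * Re \<alpha>)) * l2 (N * m) u * l2 (N * m) v"
        using elim by (intro mult_right_mono) auto
      finally show "cmod (form (N * m) (\<lambda>j i. model_coeff \<alpha> \<beta> (int j - int i)) u v
        - of_real (real (N * m)) powr (2 * \<alpha>) * kernel_form (fh_kernel \<alpha> \<beta>) (step m (block_sum N m u)) (step m (block_sum N m v)))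
        \<le> \<epsilon> * real (N * m) powr (2 * Re \<alpha>) * l2 (N * m) u * l2 (N * m) v"
        unfolding eq by simp
    qed
  qed
qed

end

section \<open>Positivity of the limit, and reductions\<close>

text \<open>Not both constants \<open>C_plus\<close>, \<open>C_minus\<close> vanish, since \<open>2 * \<alpha>\<close> is not an integer. Near the corner
  \<open>(1, 0)\<close> of the unit square the kernel is close to \<open>C_plus\<close>, near \<open>(0, 1)\<close> it is close to \<open>C_minus\<close>, so one of
  the two corner entries of the compression to a fine grid is nonzero.\<close>

lemma fh_op_norm_pos:
  assumes \<alpha>: "0 < Re \<alpha>" "Re \<alpha> < 1 / 2"
  shows "0 < L2_01_op_norm (integral_operator (fh_kernel \<alpha> \<beta>))"
proof -
  interpret schur_kernel "fh_kernel \<alpha> \<beta>" "schur_bound \<alpha> \<beta>"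
    by (rule fh_schur_kernel[OF \<alpha>])
  define \<gamma> where "\<gamma> = 2 * \<alpha> - 1"
  have G: "Gamma (1 - 2 * \<alpha>) \<noteq> 0"
    using \<alpha> by (simp add: Gamma_eq_zero_iff not_nonpos_Int)
  have "C_plus \<alpha> \<beta> \<noteq> 0 \<or> C_minus \<alpha> \<beta> \<noteq> 0"
  proof (rule ccontr)
    assume "\<not> ?thesis"
    then have z: "sin (of_real pi * (\<alpha> - \<beta>)) = 0" "sin (of_real pi * (\<alpha> + \<beta>)) = 0"
      using G by (auto simp: C_plus_def C_minus_def)
    have "sin (of_real pi * (2 * \<alpha>)) = sin (of_real pi * (\<alpha> - \<beta>) + of_real pi * (\<alpha> + \<beta>))"
      by (rule arg_cong[of _ _ sin]) (simp add: algebra_simps)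
    also have "\<dots> = 0" by (simp only: sin_add z) simp
    finally show False using sin_pi_eq(1)[of "2 * \<alpha>"] \<alpha> by simp
  qed
  define c0 where "c0 = cmod \<gamma> * (1 / 2) powr (2 * Re \<alpha> - 2) * 2"
  \<comment> \<open>\<open>m \<ge> 4\<close> keeps the argument of the kernel above \<open>1 / 2\<close>, and \<open>m \<ge> 2 * c0\<close> makes its variation at most \<open>1 / 2\<close>\<close>
  obtain m :: nat where m: "real m \<ge> max 4 (2 * c0)" by (metis real_arch_simple)
  have m4: "4 \<le> m" using m by auto
  have mc: "c0 / real m \<le> 1 / 2" using m m4 by (simp add: divide_le_eq)
  have near: "cmod (of_real t powr \<gamma> - 1) \<le> 1 / 2" if t: "1 - 2 / real m \<le> t" "t \<le> 1" for t
  proof -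
    have "2 / real m \<le> 1 / 2" using m4 by (simp add: divide_le_eq)
    then have th: "1 / 2 \<le> t" using t by linarith
    have "cmod (of_real t powr \<gamma> - of_real 1 powr \<gamma>) \<le> cmod \<gamma> * (1 / 2) powr (Re \<gamma> - 1) * \<bar>t - 1\<bar>"
      using \<alpha> th by (intro powr_of_real_diff_le) (auto simp: \<gamma>_def)
    also have "\<dots> \<le> cmod \<gamma> * (1 / 2) powr (Re \<gamma> - 1) * (2 / real m)"
      using t by (intro mult_left_mono) auto
    also have "\<dots> = c0 / real m" by (simp add: c0_def \<gamma>_def)
    finally have "cmod (of_real t powr \<gamma> - of_real 1 powr \<gamma>) \<le> 1 / 2" using mc by linarith
    then show ?thesis by simp
  qed
  have pos: "0 < L2_01_op_norm (integral_operator (fh_kernel \<alpha> \<beta>))"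
    if l: "l < m" "l' < m" and c: "c \<noteq> 0"
      and k: "\<And>x y. x \<in> cell m l \<Longrightarrow> y \<in> cell m l' \<Longrightarrow> x \<in> {0<..<1} \<Longrightarrow> y \<in> {0<..<1} \<Longrightarrow>
        \<exists>t. fh_kernel \<alpha> \<beta> x y = c * of_real t powr \<gamma> \<and> 1 - 2 / real m \<le> t \<and> t \<le> 1" for l l' c
  proof (rule ccontr)
    assume "\<not> ?thesis"
    then have z: "L2_01_op_norm (integral_operator (fh_kernel \<alpha> \<beta>)) = 0" using op_norm_nonneg by linarith
    have "cell_entry m l l' = 0"
      using kernel_form_le_op_norm[OF ind_L2[OF cell_borel] ind_L2[OF cell_borel], of m l' m l] z
      by (simp add: cell_entry_def)
    moreover have "cmod (cell_entry m l l' - c / of_nat m ^ 2) \<le> (cmod c * (1 / 2)) / real m ^ 2"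
    proof (rule cell_entry_close[OF l])
      fix x y assume xy: "x \<in> cell m l" "y \<in> cell m l'" "x \<in> {0<..<1}" "y \<in> {0<..<1}"
      obtain t where t: "fh_kernel \<alpha> \<beta> x y = c * of_real t powr \<gamma>" "1 - 2 / real m \<le> t" "t \<le> 1"
        using k[OF xy] by blast
      have "fh_kernel \<alpha> \<beta> x y - c = c * (of_real t powr \<gamma> - 1)" by (simp add: t(1) right_diff_distrib)
      then show "cmod (fh_kernel \<alpha> \<beta> x y - c) \<le> cmod c * (1 / 2)"
        using near[OF t(2,3)] by (simp only: norm_mult mult_left_mono norm_ge_zero)
    qed simp
    ultimately have "cmod c / real m ^ 2 \<le> (cmod c * (1 / 2)) / real m ^ 2"
      by (simp add: norm_divide norm_power)
    moreover have "(cmod c * (1 / 2)) / real m ^ 2 < cmod c / real m ^ 2"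
      by (rule divide_strict_right_mono) (use c m4 in auto)
    ultimately show False by linarith
  qed
  have first: "0 \<le> y \<and> y < 1 / real m" if "y \<in> cell m 0" for y using that by (auto simp: cell_def)
  have last: "1 - 1 / real m \<le> x" if "x \<in> cell m (m - 1)" for x
    using that m4 by (auto simp: cell_def of_nat_diff diff_divide_distrib)
  have gap: "1 - 2 / real m \<le> x - y \<and> x - y \<le> 1 \<and> y < x"
    if "x \<in> cell m (m - 1)" "y \<in> cell m 0" "x < 1" for x y
  proof -
    have "2 / real m = 1 / real m + 1 / real m" by simp
    moreover have "2 / real m \<le> 1 / 2" using m4 by (simp add: divide_le_eq)
    ultimately show ?thesis using first[OF that(2)] last[OF that(1)] that(3) by linarith
  qed
  from \<open>C_plus \<alpha> \<beta> \<noteq> 0 \<or> C_minus \<alpha> \<beta> \<noteq> 0\<close> show ?thesis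
  proof
    assume c: "C_plus \<alpha> \<beta> \<noteq> 0"
    show ?thesis
    proof (rule pos[of "m - 1" 0, OF _ _ c])
      fix x y assume "x \<in> cell m (m - 1)" "y \<in> cell m 0" "x \<in> {0<..<1}" "y \<in> {0<..<1::real}"
      with gap[of x y] show "\<exists>t. fh_kernel \<alpha> \<beta> x y = C_plus \<alpha> \<beta> * of_real t powr \<gamma> \<and> 1 - 2 / real m \<le> t \<and> t \<le> 1"
        by (intro exI[of _ "x - y"]) (auto simp: fh_kernel_def \<gamma>_def)
    qed (use m4 in auto)
  next
    assume c: "C_minus \<alpha> \<beta> \<noteq> 0"
    show ?thesis
    proof (rule pos[of 0 "m - 1", OF _ _ c])
      fix x y assume "x \<in> cell m 0" "y \<in> cell m (m - 1)" "x \<in> {0<..<1}" "y \<in> {0<..<1::real}"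
      with gap[of y x] show "\<exists>t. fh_kernel \<alpha> \<beta> x y = C_minus \<alpha> \<beta> * of_real t powr \<gamma> \<and> 1 - 2 / real m \<le> t \<and> t \<le> 1"
        by (intro exI[of _ "y - x"]) (auto simp: fh_kernel_def \<gamma>_def)
    qed (use m4 in auto)
  qed
qed

text \<open>Lebesgue measure is complete. The symbol \<open>a\<close> is specified only almost everywhere, and without measurability its
  Fourier integrals would be \<open>0\<close> by convention.\<close>

lemma AE_eq_measurable_lebesgue_on:
  fixes f g :: "real \<Rightarrow> complex"
  assumes S: "S \<in> sets lebesgue" and g: "g \<in> borel_measurable (lebesgue_on S)" and ae: "AE x in lebesgue_on S. f x = g x"
  shows "f \<in> borel_measurable (lebesgue_on S)"
proof (rule measurableI)
  fix A :: "complex set" assume A: "A \<in> sets borel"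
  define Z where "Z = {x \<in> S. f x \<noteq> g x}"
  have "AE x in lebesgue. x \<in> S \<longrightarrow> f x = g x"
    using ae S by (simp add: AE_restrict_space_iff)
  then have Z: "Z \<in> null_sets lebesgue"
    unfolding completion.AE_iff_null_sets by (simp add: Z_def conj_commute)
  have gA: "g -` A \<inter> S \<in> sets lebesgue"
    using measurable_sets[OF g A] S by (simp add: sets_restrict_space_iff)
  have "f -` A \<inter> Z \<in> null_sets lebesgue"
    by (rule completion.complete2[OF _ Z]) auto
  then have fZ: "f -` A \<inter> Z \<in> sets lebesgue" by auto
  have "f -` A \<inter> space (lebesgue_on S) = (g -` A \<inter> S - Z) \<union> (f -` A \<inter> Z)"
    by (auto simp: Z_def)
  also have "\<dots> \<in> sets lebesgue" using gA fZ Z by auto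
  finally show "f -` A \<inter> space (lebesgue_on S) \<in> sets (lebesgue_on S)"
    using S by (subst sets_restrict_space_iff) auto
qed simp

text \<open>The product of the denominators of the angles serves for all \<open>r\<close> at once.\<close>

lemma common_power:
  fixes t :: "nat \<Rightarrow> complex"
  assumes "\<forall>r\<in>{1..R}. \<exists>\<phi>::rat. t r = exp (2 * of_real pi * \<i> * of_rat \<phi>) * t0"
  shows "\<exists>N>0. \<forall>r\<in>{1..R}. t r ^ N = t0 ^ N"
proof -
  have "\<exists>d::nat. d > 0 \<and> t r ^ d = t0 ^ d" if "r \<in> {1..R}" for r
  proof -
    obtain \<phi> :: rat where \<phi>: "t r = exp (2 * of_real pi * \<i> * of_rat \<phi>) * t0" using assms \<open>r \<in> {1..R}\<close> by blast
    obtain p q where pq: "quotient_of \<phi> = (p, q)" by force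
    have q: "q > 0" using quotient_of_denom_pos[OF pq] .
    have "\<phi> = of_int p / of_int q" by (rule quotient_of_div[OF pq])
    then have \<phi>': "(of_rat \<phi> :: complex) = of_int p / of_int q" by (simp add: of_rat_divide)
    have "exp (2 * of_real pi * \<i> * of_rat \<phi>) ^ nat q = exp (of_nat (nat q) * (2 * of_real pi * \<i> * of_rat \<phi>))"
      by (rule exp_of_nat_mult[symmetric])
    also have "of_nat (nat q) * (2 * of_real pi * \<i> * of_rat \<phi>) = 2 * of_int p * of_real pi * \<i>"
      using q by (simp add: \<phi>')
    also have "exp (2 * of_int p * of_real pi * \<i>) = 1"
      using exp_integer_2pi[of "of_int p"] by (simp add: mult_ac)
    finally have "t r ^ nat q = t0 ^ nat q" by (simp add: \<phi> power_mult_distrib)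
    then show ?thesis using q by (intro exI[of _ "nat q"]) simp
  qed
  then obtain d where d: "\<And>r. r \<in> {1..R} \<Longrightarrow> d r > 0 \<and> t r ^ d r = t0 ^ d r" by metis
  define N where "N = (\<Prod>r\<in>{1..R}. d r :: nat)"
  have "N > 0" unfolding N_def by (intro prod_pos) (use d in auto)
  moreover have "t r ^ N = t0 ^ N" if r: "r \<in> {1..R}" for r
  proof -
    have "d r dvd N" unfolding N_def using r by (intro dvd_prodI) auto
    then obtain e where "N = d r * e" by (rule dvdE)
    then show ?thesis using d[OF r] by (simp add: power_mult)
  qed
  ultimately show ?thesis by blast
qed

text \<open>Round \<open>n\<close> down and up to a multiple of \<open>N\<close>; this changes \<open>n powr s\<close> by a factor that tends to \<open>1\<close>.\<close>

lemma monotone_ratio_limit: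
  fixes g :: "nat \<Rightarrow> real"
  assumes mono: "\<And>n n'. n \<le> n' \<Longrightarrow> g n \<le> g n'" and N: "0 < N" and s: "0 < s"
    and lim: "(\<lambda>m. g (N * m) / real (N * m) powr s) \<longlonglongrightarrow> L"
  shows "(\<lambda>n. g n / real n powr s) \<longlonglongrightarrow> L"
proof (rule tendsto_sandwich)
  have dv: "filterlim (\<lambda>n. n div N) at_top sequentially"
    using N by (simp add: filterlim_at_top eventually_sequentially) (metis div_le_mono div_mult_self1_is_m le_refl order_trans)
  then have dvS: "filterlim (\<lambda>n. Suc (n div N)) at_top sequentially"
    by (rule filterlim_compose[OF filterlim_Suc])
  have quot: "(\<lambda>n. real (N * (n div N)) / real n) \<longlonglongrightarrow> 1" "(\<lambda>n. real (N * Suc (n div N)) / real n) \<longlonglongrightarrow> 1"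
  proof -
    have z: "(\<lambda>n. real (n mod N) / real n) \<longlonglongrightarrow> 0"
    proof (rule tendsto_sandwich[where f = "\<lambda>_. 0" and h = "\<lambda>n. real N / real n"])
      show "(\<lambda>n. real N / real n) \<longlonglongrightarrow> 0" by (rule lim_const_over_n)
      show "eventually (\<lambda>n. real (n mod N) / real n \<le> real N / real n) sequentially"
        using N by (intro always_eventually allI divide_right_mono) (simp_all add: less_imp_le)
    qed simp_all
    have "(\<lambda>n. 1 - real (n mod N) / real n) \<longlonglongrightarrow> 1 - 0" by (intro tendsto_intros z)
    moreover have "eventually (\<lambda>n. 1 - real (n mod N) / real n = real (N * (n div N)) / real n) sequentially"
      using eventually_gt_at_top[of 0]
    proof eventually_elim
      case (elim n)
      have "real n = real (N * (n div N)) + real (n mod N)"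
        by (metis mult_div_mod_eq of_nat_add)
      then show ?case using elim by (simp add: field_simps)
    qed
    ultimately show 1: "(\<lambda>n. real (N * (n div N)) / real n) \<longlonglongrightarrow> 1"
      using Lim_transform_eventually by fastforce
    have "(\<lambda>n. real (N * (n div N)) / real n + real N / real n) \<longlonglongrightarrow> 1 + 0"
      by (intro tendsto_add 1 lim_const_over_n)
    then show "(\<lambda>n. real (N * Suc (n div N)) / real n) \<longlonglongrightarrow> 1"
      by (simp add: add_divide_distrib algebra_simps)
  qed
  show "(\<lambda>n. g (N * (n div N)) / real (N * (n div N)) powr s * (real (N * (n div N)) / real n) powr s) \<longlonglongrightarrow> L"
    using tendsto_mult[OF filterlim_compose[OF lim dv] tendsto_powr[OF quot(1) tendsto_const[of s]]] by simp
  show "(\<lambda>n. g (N * Suc (n div N)) / real (N * Suc (n div N)) powr s * (real (N * Suc (n div N)) / real n) powr s) \<longlonglongrightarrow> L"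
    using tendsto_mult[OF filterlim_compose[OF lim dvS] tendsto_powr[OF quot(2) tendsto_const[of s]]] by simp
  show "eventually (\<lambda>n. g (N * (n div N)) / real (N * (n div N)) powr s * (real (N * (n div N)) / real n) powr s \<le> g n / real n powr s) sequentially"
    using eventually_ge_at_top[of N]
  proof eventually_elim
    case (elim n)
    then have "0 < n div N" using N by (simp add: div_greater_zero_iff)
    then have "g (N * (n div N)) / real (N * (n div N)) powr s * (real (N * (n div N)) / real n) powr s = g (N * (n div N)) / real n powr s"
      using N elim by (simp add: powr_divide)
    also have "\<dots> \<le> g n / real n powr s" by (intro divide_right_mono mono) simp_all
    finally show ?case .
  qed
  show "eventually (\<lambda>n. g n / real n powr s \<le> g (N * Suc (n div N)) / real (N * Suc (n div N)) powr s * (real (N * Suc (n div N)) / real n) powr s) sequentially"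
    using eventually_ge_at_top[of N]
  proof eventually_elim
    case (elim n)
    have "n \<le> N * Suc (n div N)" using dividend_less_times_div[OF N, of n] by simp
    then have "g n / real n powr s \<le> g (N * Suc (n div N)) / real n powr s" by (intro divide_right_mono mono) simp_all
    also have "\<dots> = g (N * Suc (n div N)) / real (N * Suc (n div N)) powr s * (real (N * Suc (n div N)) / real n) powr s"
      using N elim by (simp add: powr_divide del: mult_Suc_right of_nat_mult)
    finally show ?case .
  qed
qed

section \<open>Norms of the Toeplitz matrices\<close>

text \<open>The data of the theorem, with the rational angles entering through the exponent \<open>N\<close>.\<close>

locale fh_sum =
  fixes R :: nat and t \<alpha> \<beta> :: "nat \<Rightarrow> complex" and a :: "complex \<Rightarrow> complex"
    and br :: "nat \<Rightarrow> complex \<Rightarrow> complex" and \<rho> :: real and M :: "nat set" and N :: nat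
  assumes R: "1 \<le> R"
    and t: "\<And>r. r \<in> {1..R} \<Longrightarrow> cmod (t r) = 1"
    and inj: "inj_on t {1..R}"
    and \<alpha>: "\<And>r. r \<in> {1..R} \<Longrightarrow> 0 < Re (\<alpha> r)" "\<And>r. r \<in> {1..R} \<Longrightarrow> Re (\<alpha> r) < 1 / 2"
    and br: "\<And>r. r \<in> {1..R} \<Longrightarrow> br r \<in> circle_Linf"
    and br_cont: "\<And>r. r \<in> {1..R} \<Longrightarrow> continuous (at (t r) within sphere 0 1) (br r)"
    and br_nz: "\<And>r. r \<in> {1..R} \<Longrightarrow> br r (t r) \<noteq> 0"
    and a: "circle_AE (\<lambda>z. a z = (\<Sum>r=1..R. fh_factor (\<alpha> r) (\<beta> r) (t r) z * br r z))"
    and \<rho>: "\<rho> = (MAX r\<in>{1..R}. Re (\<alpha> r))"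
    and M: "M = {r \<in> {1..R}. Re (\<alpha> r) = \<rho>}"
    and N: "0 < N"
    and root: "\<And>r q. r \<in> {1..R} \<Longrightarrow> q \<in> {1..R} \<Longrightarrow> (t r / t q) ^ N = 1"
begin

lemma finM: "finite M" and MR: "r \<in> M \<Longrightarrow> r \<in> {1..R}" and Re_M: "r \<in> M \<Longrightarrow> Re (\<alpha> r) = \<rho>"
  by (auto simp: M)

lemma Re_le: "r \<in> {1..R} \<Longrightarrow> Re (\<alpha> r) \<le> \<rho>"
  unfolding \<rho> by (intro Max_ge) auto

lemma M_nonempty: "M \<noteq> {}"
proof -
  have "\<rho> \<in> (\<lambda>r. Re (\<alpha> r)) ` {1..R}" unfolding \<rho> using R by (intro Max_in) auto
  then show ?thesis by (auto simp: M)
qed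

lemma rho: "0 < 2 * \<rho>" "2 * \<rho> < 1"
proof -
  obtain r where "r \<in> M" using M_nonempty by blast
  then show "0 < 2 * \<rho>" "2 * \<rho> < 1" using \<alpha>[of r] MR Re_M by force+
qed

text \<open>What remains of the symbol after the model symbols of the strongest singularities are taken out.\<close>

definition residual :: "complex \<Rightarrow> complex" where
  "residual z = a z - (\<Sum>r\<in>M. br r (t r) * model (\<alpha> r) (\<beta> r) (t r) z)"

lemma a_measurable: "(\<lambda>\<theta>. a (cis \<theta>)) \<in> borel_measurable circ"
proof (rule AE_eq_measurable_lebesgue_on)
  show "AE \<theta> in circ. a (cis \<theta>) = (\<Sum>r=1..R. fh_factor (\<alpha> r) (\<beta> r) (t r) (cis \<theta>) * br r (cis \<theta>))"
    using a by (simp add: circle_AE_def)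
  show "(\<lambda>\<theta>. \<Sum>r=1..R. fh_factor (\<alpha> r) (\<beta> r) (t r) (cis \<theta>) * br r (cis \<theta>)) \<in> borel_measurable circ"
    using br by (intro borel_measurable_sum borel_measurable_times fh_measurable t) (auto simp: circle_Linf_def)
qed simp

lemma residual_measurable: "(\<lambda>\<theta>. residual (cis \<theta>)) \<in> borel_measurable circ"
  unfolding residual_def
  by (intro borel_measurable_diff a_measurable borel_measurable_sum borel_measurable_times borel_measurable_const
      model_measurable t MR)

lemma residual_bound:
  assumes \<epsilon>: "0 < \<epsilon>"
  shows "\<exists>C\<ge>0. AE \<theta> in circ. cmod (residual (cis \<theta>)) \<le> \<epsilon> * (\<Sum>\<tau>\<in>t ` {1..R}. cmod (cis \<theta> - \<tau>) powr (- (2 * \<rho>))) + C"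
proof -
  define h where "h = (\<lambda>r z. fh_factor (\<alpha> r) (\<beta> r) (t r) z * br r z
    - (if r \<in> M then br r (t r) * model (\<alpha> r) (\<beta> r) (t r) z else 0))"
  have "\<forall>r\<in>{1..R}. \<exists>C. C \<ge> 0 \<and> (AE \<theta> in circ. cmod (h r (cis \<theta>)) \<le> \<epsilon> * cmod (cis \<theta> - t r) powr (- (2 * \<rho>)) + C)"
  proof
    fix r assume r: "r \<in> {1..R}"
    show "\<exists>C. C \<ge> 0 \<and> (AE \<theta> in circ. cmod (h r (cis \<theta>)) \<le> \<epsilon> * cmod (cis \<theta> - t r) powr (- (2 * \<rho>)) + C)"
    proof (cases "r \<in> M")
      case True
      then show ?thesis
        using dominant_residual[OF t[OF r] \<alpha>(1)[OF r] \<alpha>(2)[OF r] \<epsilon> br[OF r] br_cont[OF r], of "\<beta> r"]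
        by (simp add: h_def Re_M)
    next
      case False
      then have "2 * Re (\<alpha> r) < 2 * \<rho>" using Re_le[OF r] r by (auto simp: M less_le)
      from subdominant_residual[OF t[OF r] \<alpha>(1)[OF r] this \<epsilon> br[OF r], of "\<beta> r"] show ?thesis
        using False by (simp add: h_def)
    qed
  qed
  from bchoice[OF this] obtain C where C: "\<And>r. r \<in> {1..R} \<Longrightarrow> C r \<ge> 0"
    "\<And>r. r \<in> {1..R} \<Longrightarrow> AE \<theta> in circ. cmod (h r (cis \<theta>)) \<le> \<epsilon> * cmod (cis \<theta> - t r) powr (- (2 * \<rho>)) + C r"
    by blast
  have all: "AE \<theta> in circ. \<forall>r\<in>{1..R}. cmod (h r (cis \<theta>)) \<le> \<epsilon> * cmod (cis \<theta> - t r) powr (- (2 * \<rho>)) + C r"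
    by (rule AE_finite_allI) (use C in auto)
  have eq: "AE \<theta> in circ. residual (cis \<theta>) = (\<Sum>r=1..R. h r (cis \<theta>))"
    using a unfolding circle_AE_def
  proof eventually_elim
    case (elim \<theta>)
    have "(\<Sum>r=1..R. if r \<in> M then br r (t r) * model (\<alpha> r) (\<beta> r) (t r) (cis \<theta>) else 0)
      = (\<Sum>r\<in>{1..R} \<inter> M. br r (t r) * model (\<alpha> r) (\<beta> r) (t r) (cis \<theta>))"
      by (rule sum.inter_restrict[symmetric]) simp
    also have "{1..R} \<inter> M = M" using MR by auto
    finally show ?case by (simp add: residual_def h_def elim sum_subtractf)
  qed
  have "AE \<theta> in circ. cmod (residual (cis \<theta>)) \<le> \<epsilon> * (\<Sum>\<tau>\<in>t ` {1..R}. cmod (cis \<theta> - \<tau>) powr (- (2 * \<rho>))) + (\<Sum>r=1..R. C r)"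
    using all eq
  proof eventually_elim
    case (elim \<theta>)
    have "cmod (residual (cis \<theta>)) \<le> (\<Sum>r=1..R. cmod (h r (cis \<theta>)))" unfolding elim(2) by (rule norm_sum)
    also have "\<dots> \<le> (\<Sum>r=1..R. \<epsilon> * cmod (cis \<theta> - t r) powr (- (2 * \<rho>)) + C r)"
      using elim(1) by (intro sum_mono) auto
    also have "\<dots> = \<epsilon> * (\<Sum>r=1..R. cmod (cis \<theta> - t r) powr (- (2 * \<rho>))) + (\<Sum>r=1..R. C r)"
      by (simp add: sum.distrib sum_distrib_left)
    finally show ?case by (simp only: sum.reindex[OF inj] o_def)
  qed
  moreover have "0 \<le> (\<Sum>r=1..R. C r)" using C(1) by (intro sum_nonneg) auto
  ultimately show ?thesis by blast
qed

text \<open>Conjugating the matrix by the diagonal matrix of the powers of \<open>t r\<close> moves the singularity from \<open>t r\<close> to \<open>1\<close>.\<close>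

definition twist :: "nat \<Rightarrow> (nat \<Rightarrow> complex) \<Rightarrow> nat \<Rightarrow> complex" where
  "twist r u k = t r ^ k * u k"

lemma l2_twist: "r \<in> {1..R} \<Longrightarrow> l2 n (twist r u) = l2 n u"
  using t[of r] by (simp add: l2_def twist_def norm_mult norm_power)

lemma model_integrable: "r \<in> {1..R} \<Longrightarrow> integrable circ (\<lambda>\<theta>. model (\<alpha> r) (\<beta> r) (t r) (cis \<theta>))"
proof -
  assume r: "r \<in> {1..R}"
  obtain K where K: "K \<ge> 0" "\<And>z. cmod z = 1 \<Longrightarrow> cmod (model (\<alpha> r) (\<beta> r) (t r) z) \<le> K * cmod (z - t r) powr (- (2 * Re (\<alpha> r)))"
    using model_le[OF t[OF r]] by blast
  show ?thesis
    by (rule singular_symbol_integrable[of "{t r}" "2 * Re (\<alpha> r)" K 0])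
      (use t[OF r] \<alpha>[OF r] K in \<open>auto intro: model_measurable\<close>)
qed

lemma residual_integrable: "integrable circ (\<lambda>\<theta>. residual (cis \<theta>))"
proof -
  obtain C where "C \<ge> 0" "AE \<theta> in circ. cmod (residual (cis \<theta>)) \<le> 1 * (\<Sum>\<tau>\<in>t ` {1..R}. cmod (cis \<theta> - \<tau>) powr (- (2 * \<rho>))) + C"
    using residual_bound[of 1] by auto
  then show ?thesis
    by (intro singular_symbol_integrable[of "t ` {1..R}" "2 * \<rho>" 1 C] rho residual_measurable) (use t in auto)
qed

lemma fourier_decomposition:
  "fourier_coeff a (int j - int k) = fourier_coeff residual (int j - int k)
    + (\<Sum>r\<in>M. br r (t r) * (cnj (t r) ^ j * t r ^ k * model_coeff (\<alpha> r) (\<beta> r) (int j - int k)))"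
proof -
  define e where "e = (\<lambda>\<theta>. cis (- (of_int (int j - int k) * \<theta>)))"
  have cism: "e \<in> borel_measurable circ"
    unfolding e_def by (intro borel_measurable_lebesgue_on_borel borel_measurable_continuous_onI continuous_intros)
  have ie: "integrable circ (\<lambda>\<theta>. f (cis \<theta>) * e \<theta>)" if f: "integrable circ (\<lambda>\<theta>. f (cis \<theta>))" for f :: "complex \<Rightarrow> complex"
  proof (rule Bochner_Integration.integrable_bound[OF f])
    show "(\<lambda>\<theta>. f (cis \<theta>) * e \<theta>) \<in> borel_measurable circ"
      by (rule borel_measurable_times[OF borel_measurable_integrable[OF f] cism])
    show "AE \<theta> in circ. norm (f (cis \<theta>) * e \<theta>) \<le> norm (f (cis \<theta>))"
      by (rule AE_I2) (simp add: norm_mult e_def)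
  qed
  have im: "integrable circ (\<lambda>\<theta>. br r (t r) * (model (\<alpha> r) (\<beta> r) (t r) (cis \<theta>) * e \<theta>))" if "r \<in> M" for r
    by (intro integrable_mult_right ie model_integrable MR that)
  have eq: "a (cis \<theta>) * e \<theta> = residual (cis \<theta>) * e \<theta>
      + (\<Sum>r\<in>M. br r (t r) * (model (\<alpha> r) (\<beta> r) (t r) (cis \<theta>) * e \<theta>))" for \<theta>
    by (simp add: residual_def left_diff_distrib sum_distrib_right mult.assoc)
  have "(LINT \<theta>|circ. a (cis \<theta>) * e \<theta>) = (LINT \<theta>|circ. residual (cis \<theta>) * e \<theta>)
     + (\<Sum>r\<in>M. br r (t r) * (LINT \<theta>|circ. model (\<alpha> r) (\<beta> r) (t r) (cis \<theta>) * e \<theta>))"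
    unfolding eq
    by (simp only: Bochner_Integration.integral_add[OF ie[OF residual_integrable] Bochner_Integration.integrable_sum[OF im]]
        Bochner_Integration.integral_sum[OF im] integral_mult_right_zero)
  then have "fourier_coeff a (int j - int k) = fourier_coeff residual (int j - int k)
    + (\<Sum>r\<in>M. br r (t r) * fourier_coeff (model (\<alpha> r) (\<beta> r) (t r)) (int j - int k))"
    by (simp add: fourier_coeff_def e_def distrib_left sum_distrib_left mult_ac)
  also have "(\<Sum>r\<in>M. br r (t r) * fourier_coeff (model (\<alpha> r) (\<beta> r) (t r)) (int j - int k))
    = (\<Sum>r\<in>M. br r (t r) * (cnj (t r) ^ j * t r ^ k * model_coeff (\<alpha> r) (\<beta> r) (int j - int k)))"
    by (intro sum.cong refl) (use fourier_coeff_model[OF t \<alpha>] MR in auto)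
  finally show ?thesis .
qed

definition tform :: "nat \<Rightarrow> (nat \<Rightarrow> complex) \<Rightarrow> (nat \<Rightarrow> complex) \<Rightarrow> complex" where
  "tform n u v = form n (\<lambda>j k. fourier_coeff a (int j - int k)) u v"

lemma tform_decomposition:
  "tform n u v = form n (\<lambda>j k. fourier_coeff residual (int j - int k)) u v
    + (\<Sum>r\<in>M. br r (t r) * form n (\<lambda>j k. model_coeff (\<alpha> r) (\<beta> r) (int j - int k)) (twist r u) (twist r v))"
proof -
  have "form n (\<lambda>j k. cnj (t r) ^ j * t r ^ k * model_coeff (\<alpha> r) (\<beta> r) (int j - int k)) u v
    = form n (\<lambda>j k. model_coeff (\<alpha> r) (\<beta> r) (int j - int k)) (twist r u) (twist r v)" for r
    unfolding form_def twist_def by (intro sum.cong refl) (simp add: mult_ac)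
  then show ?thesis
    unfolding tform_def fourier_decomposition form_add form_sum form_cmult by simp
qed

lemma residual_form_small:
  assumes \<epsilon>: "0 < \<epsilon>"
  shows "eventually (\<lambda>n. \<forall>u v. cmod (form n (\<lambda>j k. fourier_coeff residual (int j - int k)) u v)
    \<le> \<epsilon> * real n powr (2 * \<rho>) * l2 n u * l2 n v) sequentially"
proof -
  define W where "W = real (card (t ` {1..R})) * weight_const (2 * \<rho>)"
  have W: "0 \<le> W" using weight_const_pos[OF rho] by (simp add: W_def)
  define \<delta> where "\<delta> = \<epsilon> / (2 * (W + 1))"
  have \<delta>: "0 < \<delta>" using \<epsilon> W by (simp add: \<delta>_def)
  have \<delta>W: "\<delta> * W \<le> \<epsilon> / 2"
    using \<epsilon> W by (simp add: \<delta>_def divide_simps)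
  obtain C where C: "C \<ge> 0" "AE \<theta> in circ. cmod (residual (cis \<theta>)) \<le> \<delta> * (\<Sum>\<tau>\<in>t ` {1..R}. cmod (cis \<theta> - \<tau>) powr (- (2 * \<rho>))) + C"
    using residual_bound[OF \<delta>] by auto
  have "eventually (\<lambda>n. real n powr (2 * \<rho>) \<ge> C / (\<epsilon> / 2)) sequentially"
    using powr_nat_at_top[OF rho(1)] by (simp add: filterlim_at_top)
  then show ?thesis
    using eventually_ge_at_top[of 1]
  proof eventually_elim
    case (elim n)
    show ?case
    proof (intro allI)
      fix u v
      have "cmod (form n (\<lambda>j k. fourier_coeff residual (int j - int k)) u v)
        \<le> (\<delta> * real (card (t ` {1..R})) * weight_const (2 * \<rho>) * real n powr (2 * \<rho>) + C) * l2 n u * l2 n v"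
        by (rule singular_symbol_form_le[OF _ _ rho _ C(1) residual_measurable C(2) elim(2)]) (use t \<delta> in auto)
      also have "\<dots> \<le> (\<epsilon> * real n powr (2 * \<rho>)) * l2 n u * l2 n v"
      proof (intro mult_right_mono l2_nonneg)
        have "\<delta> * real (card (t ` {1..R})) * weight_const (2 * \<rho>) * real n powr (2 * \<rho>) \<le> \<epsilon> / 2 * real n powr (2 * \<rho>)"
          using mult_right_mono[OF \<delta>W, of "real n powr (2 * \<rho>)"] by (simp add: W_def mult.assoc)
        moreover have "C \<le> \<epsilon> / 2 * real n powr (2 * \<rho>)" using elim(1) \<epsilon> by (simp add: field_simps)
        ultimately show "\<delta> * real (card (t ` {1..R})) * weight_const (2 * \<rho>) * real n powr (2 * \<rho>) + C \<le> \<epsilon> * real n powr (2 * \<rho>)"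
          by (simp add: field_simps)
      qed
      finally show "cmod (form n (\<lambda>j k. fourier_coeff residual (int j - int k)) u v) \<le> \<epsilon> * real n powr (2 * \<rho>) * l2 n u * l2 n v" .
    qed
  qed
qed

definition kern :: "nat \<Rightarrow> real \<Rightarrow> real \<Rightarrow> complex" where
  "kern r = fh_kernel (\<alpha> r) (\<beta> r)"

text \<open>The step function through which the singularity \<open>t r\<close> sees the vector \<open>u\<close>.\<close>

definition compressed :: "nat \<Rightarrow> nat \<Rightarrow> (nat \<Rightarrow> complex) \<Rightarrow> real \<Rightarrow> complex" where
  "compressed m r u = step m (block_sum N m (twist r u))"

definition main_form :: "nat \<Rightarrow> (nat \<Rightarrow> complex) \<Rightarrow> (nat \<Rightarrow> complex) \<Rightarrow> complex" where
  "main_form m u v = (\<Sum>r\<in>M. br r (t r) * (of_real (real (N * m)) powr (2 * \<alpha> r)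
      * kernel_form (kern r) (compressed m r u) (compressed m r v)))"

text \<open>This collects the errors from the residual symbol and from the discretization; what remains concerns \<open>main_form\<close> only.\<close>

lemma tform_close:
  assumes \<epsilon>: "0 < \<epsilon>"
  shows "eventually (\<lambda>m. \<forall>u v. cmod (tform (N * m) u v - main_form m u v)
    \<le> \<epsilon> * real (N * m) powr (2 * \<rho>) * l2 (N * m) u * l2 (N * m) v) sequentially"
proof -
  define S where "S = (\<Sum>r\<in>M. cmod (br r (t r)))"
  have S: "0 \<le> S" by (simp add: S_def sum_nonneg)
  define \<delta> where "\<delta> = \<epsilon> / (S + 1)"
  have \<delta>: "0 < \<delta>" using \<epsilon> S by (simp add: \<delta>_def)
  have \<delta>S: "\<delta> + S * \<delta> = \<epsilon>"
  proof -
    have "\<delta> * (S + 1) = \<epsilon>" using S by (simp add: \<delta>_def)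
    then show ?thesis by (simp add: algebra_simps)
  qed
  let ?D = "\<lambda>r m u v. form (N * m) (\<lambda>j i. model_coeff (\<alpha> r) (\<beta> r) (int j - int i)) u v
      - of_real (real (N * m)) powr (2 * \<alpha> r) * kernel_form (fh_kernel (\<alpha> r) (\<beta> r)) (step m (block_sum N m u)) (step m (block_sum N m v))"
  have "eventually (\<lambda>m. \<forall>u v. cmod (?D r m u v) \<le> \<delta> * real (N * m) powr (2 * \<rho>) * l2 (N * m) u * l2 (N * m) v) sequentially"
    if "r \<in> M" for r
    using discretization[OF \<alpha>(1)[OF MR[OF that]] \<alpha>(2)[OF MR[OF that]] N \<delta>, of "\<beta> r"] Re_M[OF that] by simp
  then have "eventually (\<lambda>m. \<forall>r\<in>M. \<forall>u v. cmod (?D r m u v) \<le> \<delta> * real (N * m) powr (2 * \<rho>) * l2 (N * m) u * l2 (N * m) v) sequentially"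
    using finM by (simp add: eventually_ball_finite)
  moreover have "filterlim (\<lambda>m. N * m) at_top sequentially" using N by (simp add: mult_nat_left_at_top)
  then have "eventually (\<lambda>m. \<forall>u v. cmod (form (N * m) (\<lambda>j k. fourier_coeff residual (int j - int k)) u v)
    \<le> \<delta> * real (N * m) powr (2 * \<rho>) * l2 (N * m) u * l2 (N * m) v) sequentially"
    by (rule eventually_compose_filterlim[OF residual_form_small[OF \<delta>]])
  ultimately show ?thesis
  proof eventually_elim
    case (elim m)
    show ?case
    proof (intro allI)
      fix u v
      define P where "P = real (N * m) powr (2 * \<rho>) * l2 (N * m) u * l2 (N * m) v"
      have "tform (N * m) u v - main_form m u v = form (N * m) (\<lambda>j k. fourier_coeff residual (int j - int k)) u v
        + (\<Sum>r\<in>M. br r (t r) * ?D r m (twist r u) (twist r v))"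
        unfolding tform_decomposition main_form_def compressed_def kern_def
        by (simp only: right_diff_distrib sum_subtractf) simp
      then have "cmod (tform (N * m) u v - main_form m u v) \<le> cmod (form (N * m) (\<lambda>j k. fourier_coeff residual (int j - int k)) u v)
        + (\<Sum>r\<in>M. cmod (br r (t r)) * cmod (?D r m (twist r u) (twist r v)))"
        by (simp only: norm_mult[symmetric]) (intro order_trans[OF norm_triangle_ineq] add_left_mono norm_sum)
      also have "\<dots> \<le> \<delta> * P + (\<Sum>r\<in>M. cmod (br r (t r)) * (\<delta> * P))"
      proof (intro add_mono sum_mono mult_left_mono norm_ge_zero)
        show "cmod (form (N * m) (\<lambda>j k. fourier_coeff residual (int j - int k)) u v) \<le> \<delta> * P"
          using elim(2) by (simp add: P_def mult.assoc)
        show "cmod (?D r m (twist r u) (twist r v)) \<le> \<delta> * P" if "r \<in> M" for r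
        proof -
          have "cmod (?D r m (twist r u) (twist r v)) \<le> \<delta> * real (N * m) powr (2 * \<rho>) * l2 (N * m) (twist r u) * l2 (N * m) (twist r v)"
            using elim(1) that by blast
          then show ?thesis by (simp only: l2_twist[OF MR[OF that]] P_def mult.assoc)
        qed
      qed
      also have "\<dots> = (\<delta> + S * \<delta>) * P" by (simp add: S_def distrib_right sum_distrib_right mult.assoc)
      finally show "cmod (tform (N * m) u v - main_form m u v) \<le> \<epsilon> * real (N * m) powr (2 * \<rho>) * l2 (N * m) u * l2 (N * m) v"
        unfolding \<delta>S by (simp add: P_def mult.assoc)
    qed
  qed
qed

end

context fh_sum
begin

lemma kern_schur: "r \<in> M \<Longrightarrow> schur_kernel (kern r) (schur_bound (\<alpha> r) (\<beta> r))"
  unfolding kern_def by (intro fh_schur_kernel \<alpha> MR)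

text \<open>Bessel's inequality in every block: the contributions of different singularities share the norm of \<open>u\<close> instead of
  each taking all of it. For this reason a maximum and not a sum appears in the theorem.\<close>

lemma compressed_norm_sum: "(\<Sum>r\<in>M. (L2_01_norm (compressed m r u))\<^sup>2) \<le> (l2 (N * m) u)\<^sup>2"
proof (cases "m = 0")
  case True
  then show ?thesis by (simp add: compressed_def step_norm l2_power2)
next
  case False
  let ?B = "\<lambda>r l. (cmod (\<Sum>s<N. t r ^ (N * l + s) * u (N * l + s)))\<^sup>2"
  have one: "(L2_01_norm (compressed m r u))\<^sup>2 = (\<Sum>l<m. ?B r l / real N)" for r
  proof -
    have "(cmod (block_sum N m (twist r u) l))\<^sup>2 = real m / real N * ?B r l" for l
      unfolding block_sum_def twist_def norm_mult power_mult_distrib by simp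
    then have "(L2_01_norm (compressed m r u))\<^sup>2 = (\<Sum>l<m. real m / real N * ?B r l) / real m"
      by (simp add: compressed_def step_norm)
    also have "\<dots> = (\<Sum>l<m. ?B r l / real N)"
      unfolding sum_divide_distrib using False by (intro sum.cong refl) simp
    finally show ?thesis .
  qed
  have "(\<Sum>r\<in>M. (L2_01_norm (compressed m r u))\<^sup>2) = (\<Sum>l<m. (\<Sum>r\<in>M. ?B r l) / real N)"
    unfolding one sum_divide_distrib by (rule sum.swap)
  also have "\<dots> \<le> (\<Sum>l<m. (real N * (\<Sum>s<N. (cmod (u (N * l + s)))\<^sup>2)) / real N)"
  proof (intro sum_mono divide_right_mono)
    fix l
    show "(\<Sum>r\<in>M. ?B r l) \<le> real N * (\<Sum>s<N. (cmod (u (N * l + s)))\<^sup>2)"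
    proof (rule bessel_characters[OF finM])
      show "inj_on t M" by (rule inj_on_subset[OF inj]) (use MR in blast)
    qed (use t MR root in auto)
  qed simp
  also have "\<dots> = (l2 (N * m) u)\<^sup>2"
    unfolding l2_power2 sum_blocks using N by simp
  finally show ?thesis .
qed

definition limit_const :: real where
  "limit_const = (MAX r\<in>M. L2_01_op_norm (integral_operator (kern r)) * cmod (br r (t r)))"

lemma limit_const_ge: "r \<in> M \<Longrightarrow> L2_01_op_norm (integral_operator (kern r)) * cmod (br r (t r)) \<le> limit_const"
  unfolding limit_const_def using finM by (intro Max_ge) auto

lemma limit_const_attained: "\<exists>r\<in>M. limit_const = L2_01_op_norm (integral_operator (kern r)) * cmod (br r (t r))"
proof -
  have "limit_const \<in> (\<lambda>r. L2_01_op_norm (integral_operator (kern r)) * cmod (br r (t r))) ` M"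
    unfolding limit_const_def using finM M_nonempty by (intro Max_in) auto
  then show ?thesis by auto
qed

lemma limit_const_pos: "0 < limit_const"
proof -
  obtain r where r: "r \<in> M" using M_nonempty by blast
  have "0 < L2_01_op_norm (integral_operator (kern r)) * cmod (br r (t r))"
    unfolding kern_def using r by (intro mult_pos_pos fh_op_norm_pos \<alpha> MR) (use br_nz MR in auto)
  then show ?thesis using limit_const_ge[OF r] by linarith
qed

text \<open>The Cauchy--Schwarz inequality over \<open>r\<close>, combined with \<open>compressed_norm_sum\<close> for \<open>u\<close> and \<open>v\<close>.\<close>

lemma main_form_le: "cmod (main_form m u v) \<le> limit_const * real (N * m) powr (2 * \<rho>) * l2 (N * m) u * l2 (N * m) v"
proof -
  define n where "n = real (N * m)"
  let ?f = "\<lambda>r. L2_01_norm (compressed m r u)" and ?g = "\<lambda>r. L2_01_norm (compressed m r v)"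
  have L: "L2_set (\<lambda>r. L2_01_norm (compressed m r w)) M \<le> l2 (N * m) w" for w
    unfolding L2_set_def by (rule real_le_lsqrt) (use compressed_norm_sum in auto)
  have "cmod (main_form m u v) \<le> (\<Sum>r\<in>M. limit_const * n powr (2 * \<rho>) * (?f r * ?g r))"
    unfolding main_form_def
  proof (intro order_trans[OF norm_sum] sum_mono)
    fix r assume r: "r \<in> M"
    interpret schur_kernel "kern r" "schur_bound (\<alpha> r) (\<beta> r)" by (rule kern_schur[OF r])
    have "cmod (kernel_form (kern r) (compressed m r u) (compressed m r v)) \<le> L2_01_op_norm (integral_operator (kern r)) * ?f r * ?g r"
      unfolding compressed_def by (intro kernel_form_le_op_norm step_L2)
    then have "cmod (br r (t r)) * (n powr (2 * \<rho>) * cmod (kernel_form (kern r) (compressed m r u) (compressed m r v)))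
      \<le> cmod (br r (t r)) * (n powr (2 * \<rho>) * (L2_01_op_norm (integral_operator (kern r)) * ?f r * ?g r))"
      by (intro mult_left_mono) auto
    also have "\<dots> = (L2_01_op_norm (integral_operator (kern r)) * cmod (br r (t r))) * (n powr (2 * \<rho>) * (?f r * ?g r))"
      by (simp add: mult_ac)
    also have "\<dots> \<le> limit_const * (n powr (2 * \<rho>) * (?f r * ?g r))"
      by (intro mult_right_mono limit_const_ge r) auto
    finally show "cmod (br r (t r) * (of_real (real (N * m)) powr (2 * \<alpha> r) * kernel_form (kern r) (compressed m r u) (compressed m r v)))
      \<le> limit_const * n powr (2 * \<rho>) * (?f r * ?g r)"
      by (simp only: norm_mult norm_of_real_powr of_nat_0_le_iff n_def mult.assoc) (simp add: Re_M[OF r] mult.assoc)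
  qed
  also have "\<dots> = limit_const * n powr (2 * \<rho>) * (\<Sum>r\<in>M. \<bar>?f r\<bar> * \<bar>?g r\<bar>)"
    by (simp add: sum_distrib_left)
  also have "\<dots> \<le> limit_const * n powr (2 * \<rho>) * (l2 (N * m) u * l2 (N * m) v)"
    using limit_const_pos
    by (intro mult_left_mono order_trans[OF L2_set_mult_ineq] mult_mono L) auto
  finally show ?thesis by (simp add: n_def mult.assoc)
qed

definition tnorm :: "nat \<Rightarrow> real" where
  "tnorm n = spectral_norm (toeplitz n a)"

lemma tnorm_eq: "tnorm n = spectral_norm (Matrix.mat n n (\<lambda>(j, k). fourier_coeff a (int j - int k)))"
  by (simp add: tnorm_def toeplitz_def)

lemma tnorm_upper:
  assumes \<epsilon>: "0 < \<epsilon>"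
  shows "eventually (\<lambda>m. tnorm (N * m) \<le> (limit_const + \<epsilon>) * real (N * m) powr (2 * \<rho>)) sequentially"
  using tform_close[OF \<epsilon>]
proof eventually_elim
  case (elim m)
  show ?case
    unfolding tnorm_eq
  proof (rule spectral_norm_leI)
    show "0 \<le> (limit_const + \<epsilon>) * real (N * m) powr (2 * \<rho>)" using limit_const_pos \<epsilon> by simp
    fix u v
    have "cmod (tform (N * m) u v) \<le> cmod (tform (N * m) u v - main_form m u v) + cmod (main_form m u v)"
      using norm_triangle_ineq[of "tform (N * m) u v - main_form m u v" "main_form m u v"] by simp
    also have "\<dots> \<le> \<epsilon> * real (N * m) powr (2 * \<rho>) * l2 (N * m) u * l2 (N * m) v
        + limit_const * real (N * m) powr (2 * \<rho>) * l2 (N * m) u * l2 (N * m) v"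
      using elim by (intro add_mono main_form_le) auto
    finally show "cmod (form (N * m) (\<lambda>j k. fourier_coeff a (int j - int k)) u v)
      \<le> (limit_const + \<epsilon>) * real (N * m) powr (2 * \<rho>) * l2 (N * m) u * l2 (N * m) v"
      by (simp add: tform_def distrib_right)
  qed
qed

text \<open>The vector that the singularity \<open>t r\<close> sees as \<open>step m X\<close> and that is invisible to all others.\<close>

definition lift :: "nat \<Rightarrow> nat \<Rightarrow> (nat \<Rightarrow> complex) \<Rightarrow> nat \<Rightarrow> complex" where
  "lift r m X j = cnj (t r) ^ j * (X (j div N) / of_real (sqrt (real m * real N)))"

text \<open>Orthogonality of the characters on each block.\<close>

lemma compressed_lift:
  assumes r: "r \<in> M" "q \<in> M" and m: "0 < m"
  shows "compressed m q (lift r m X) = step m (\<lambda>l. if q = r then X l else 0)"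
proof -
  have "block_sum N m (twist q (lift r m X)) l = (if q = r then X l else 0)" for l
  proof -
    have "(\<Sum>s<N. twist q (lift r m X) (N * l + s))
      = (\<Sum>s<N. t q ^ (N * l + s) * cnj (t r ^ (N * l + s))) * (X l / of_real (sqrt (real m * real N)))"
      unfolding sum_distrib_right twist_def lift_def using N by (intro sum.cong refl) simp
    also have "(\<Sum>s<N. t q ^ (N * l + s) * cnj (t r ^ (N * l + s))) = (if q = r then of_nat N else 0)"
      using unit_power_sum_eq[OF t[OF MR[OF r(1)]], of "N * l" N]
        unit_power_sum_zero[OF t[OF MR[OF r(2)]] t[OF MR[OF r(1)]] _ root[OF MR[OF r(2)] MR[OF r(1)]], of "N * l"]
        inj_onD[OF inj _ MR[OF r(2)] MR[OF r(1)]]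
      by (cases "q = r") auto
    finally have "block_sum N m (twist q (lift r m X)) l
      = (if q = r then of_real (sqrt (real m / real N) * real N / sqrt (real m * real N)) * X l else 0)"
      by (simp add: block_sum_def)
    moreover have "sqrt (real m / real N) * real N / sqrt (real m * real N) = 1"
    proof -
      have "real N = sqrt (real N) * sqrt (real N)" by simp
      then show ?thesis using N m by (simp add: real_sqrt_divide real_sqrt_mult)
    qed
    ultimately show ?thesis by simp
  qed
  then have "block_sum N m (twist q (lift r m X)) = (\<lambda>l. if q = r then X l else 0)" by (rule ext)
  then show ?thesis by (simp only: compressed_def)
qed

lemma l2_lift:
  assumes r: "r \<in> M" and m: "0 < m"
  shows "l2 (N * m) (lift r m X) = L2_01_norm (step m X)"
proof -
  have "(cmod (lift r m X (N * l + s)))\<^sup>2 = (cmod (X l))\<^sup>2 / (real m * real N)" if "s < N" for l s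
    using that t[OF MR[OF r]] by (simp add: lift_def norm_mult norm_power norm_divide power_divide)
  then have "(l2 (N * m) (lift r m X))\<^sup>2 = (\<Sum>l<m. real N * ((cmod (X l))\<^sup>2 / (real m * real N)))"
    unfolding l2_power2 sum_blocks by simp
  also have "\<dots> = (L2_01_norm (step m X))\<^sup>2"
    unfolding step_norm sum_divide_distrib using N by (intro sum.cong refl) simp
  finally show ?thesis by (subst (asm) power2_eq_iff_nonneg) auto
qed

lemma main_form_lift:
  assumes r: "r \<in> M" and m: "0 < m"
  shows "main_form m (lift r m X) (lift r m Y)
    = br r (t r) * (of_real (real (N * m)) powr (2 * \<alpha> r) * kernel_form (kern r) (step m X) (step m Y))"
proof -
  have z: "kernel_form (kern q) (step m (\<lambda>_. 0)) (step m (\<lambda>_. 0)) = 0" for q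
    by (simp add: kernel_form_def step_def)
  have "main_form m (lift r m X) (lift r m Y) = (\<Sum>q\<in>M. if q = r then
      br r (t r) * (of_real (real (N * m)) powr (2 * \<alpha> r) * kernel_form (kern r) (step m X) (step m Y)) else 0)"
    unfolding main_form_def
  proof (intro sum.cong refl)
    fix q assume q: "q \<in> M"
    show "br q (t q) * (of_real (real (N * m)) powr (2 * \<alpha> q) * kernel_form (kern q) (compressed m q (lift r m X)) (compressed m q (lift r m Y)))
      = (if q = r then br r (t r) * (of_real (real (N * m)) powr (2 * \<alpha> r) * kernel_form (kern r) (step m X) (step m Y)) else 0)"
      unfolding compressed_lift[OF r q m] using z by (cases "q = r") simp_all
  qed
  then show ?thesis using finM r by simp
qed

text \<open>The cell that contains \<open>x\<close> has its left end point within distance \<open>1 / m\<close> of \<open>x\<close>.\<close>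

lemma step_samples_tendsto:
  fixes f :: "real \<Rightarrow> complex"
  assumes f: "continuous_on UNIV f" and x: "x \<in> {0<..<1}"
  shows "(\<lambda>m. step m (\<lambda>l. f (real l / real m)) x) \<longlonglongrightarrow> f x"
proof -
  define p where "p = (\<lambda>m::nat. real (nat \<lfloor>real m * x\<rfloor>) / real m)"
  have pm: "x - 1 / real m \<le> p m \<and> p m \<le> x" "step m (\<lambda>l. f (real l / real m)) x = f (p m)" if m: "0 < m" for m
  proof -
    define l where "l = nat \<lfloor>real m * x\<rfloor>"
    have l: "real l \<le> real m * x" "real m * x < real l + 1"
      using x m unfolding l_def by simp_all
    have "real m * x < real m * 1" by (rule mult_strict_left_mono) (use x m in auto)
    then have "real l < real m" using l(1) by linarith
    then have lm: "l < m" by simp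
    have lx: "real l / real m \<le> x" "x < (real l + 1) / real m"
      using l m by (simp_all add: field_simps)
    then have "x \<in> cell m l" by (simp add: cell_def add.commute)
    then show "step m (\<lambda>l. f (real l / real m)) x = f (p m)"
      using step_in_cell[OF lm] by (simp add: p_def l_def)
    show "x - 1 / real m \<le> p m \<and> p m \<le> x"
      using lx by (simp add: p_def l_def[symmetric] add_divide_distrib)
  qed
  have "p \<longlonglongrightarrow> x"
  proof (rule tendsto_sandwich)
    show "eventually (\<lambda>m. x - 1 / real m \<le> p m) sequentially" "eventually (\<lambda>m. p m \<le> x) sequentially"
      using eventually_gt_at_top[of 0] by (eventually_elim, use pm in blast)+
    have "(\<lambda>m. x - 1 / real m) \<longlonglongrightarrow> x - 0" by (intro tendsto_intros lim_const_over_n)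
    then show "(\<lambda>m. x - 1 / real m) \<longlonglongrightarrow> x" by simp
  qed simp
  then have "(\<lambda>m. f (p m)) \<longlonglongrightarrow> f x"
    using f by (intro isCont_tendsto_compose[of x f]) (auto simp: continuous_on_eq_continuous_at)
  moreover have "eventually (\<lambda>m. f (p m) = step m (\<lambda>l. f (real l / real m)) x) sequentially"
    using eventually_gt_at_top[of 0] by eventually_elim (use pm in simp)
  ultimately show ?thesis by (rule Lim_transform_eventually)
qed

lemma step_samples_le:
  assumes "\<And>x. cmod (f x) \<le> c"
  shows "cmod (step m (\<lambda>l. f (real l / real m)) x) \<le> c"
proof (cases "\<exists>l<m. x \<in> cell m l")
  case True
  then show ?thesis using assms by (auto simp: step_in_cell)
next
  case False
  then have "step m (\<lambda>l. f (real l / real m)) x = 0"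
    by (auto simp: step_def indicator_def intro!: sum.neutral)
  moreover have "0 \<le> c" using assms[of 0] norm_ge_zero order_trans by blast
  ultimately show ?thesis by simp
qed

text \<open>Choose continuous functions \<open>f\<close>, \<open>g\<close> for which the form of the maximizing operator nearly attains its norm, sample them
  on the grid, and lift the samples to vectors.\<close>

lemma tnorm_lower:
  assumes \<epsilon>: "0 < \<epsilon>"
  shows "eventually (\<lambda>m. (limit_const - \<epsilon>) * real (N * m) powr (2 * \<rho>) \<le> tnorm (N * m)) sequentially"
proof -
  obtain r where r: "r \<in> M" and L: "limit_const = L2_01_op_norm (integral_operator (kern r)) * cmod (br r (t r))"
    using limit_const_attained by blast
  interpret schur_kernel "kern r" "schur_bound (\<alpha> r) (\<beta> r)" by (rule kern_schur[OF r])
  define K where "K = L2_01_op_norm (integral_operator (kern r))"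
  define c where "c = cmod (br r (t r))"
  have c: "0 < c" using br_nz MR r by (simp add: c_def)
  define \<delta> where "\<delta> = \<epsilon> / (2 * c)"
  have \<delta>: "0 < \<delta>" "c * \<delta> = \<epsilon> / 2" using \<epsilon> c by (simp_all add: \<delta>_def)
  \<comment> \<open>strictly below the operator norm, hence exceeded by the form at some pair of continuous functions\<close>
  define \<Lambda> where "\<Lambda> = max 0 (K - \<delta>)"
  have K: "0 < K" unfolding K_def kern_def by (intro fh_op_norm_pos \<alpha> MR r)
  have \<Lambda>: "0 \<le> \<Lambda>" "\<Lambda> < K" "K - \<delta> \<le> \<Lambda>" using K \<delta> by (auto simp: \<Lambda>_def)
  obtain f g d where f: "continuous_on UNIV f" "\<And>x. cmod (f x) \<le> d" and g: "continuous_on UNIV g" "\<And>x. cmod (g x) \<le> d"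
    and fg: "\<Lambda> * L2_01_norm f * L2_01_norm g < cmod (kernel_form (kern r) f g)"
    using op_norm_leI[OF \<Lambda>(1)] \<Lambda>(2) unfolding K_def by (meson not_le)
  define F where "F = (\<lambda>m::nat. step m (\<lambda>l. f (real l / real m)))"
  define G where "G = (\<lambda>m::nat. step m (\<lambda>l. g (real l / real m)))"
  have Fm: "F m \<in> borel_measurable U01" "G m \<in> borel_measurable U01" "F m \<in> L2_01" "G m \<in> L2_01" for m
    by (simp_all add: F_def G_def step_L2)
  have Fd: "cmod (F m x) \<le> d" "cmod (G m x) \<le> d" for m x
    using step_samples_le f(2) g(2) by (simp_all add: F_def G_def)
  have Fl: "AE x in U01. (\<lambda>m. F m x) \<longlonglongrightarrow> f x" "AE x in U01. (\<lambda>m. G m x) \<longlonglongrightarrow> g x"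
    unfolding F_def G_def by (rule AE_I2, rule step_samples_tendsto, use f g in auto)+
  note fm = continuous_measurable_U01[OF f(1)] continuous_measurable_U01[OF g(1)]
  have "(\<lambda>m. cmod (kernel_form (kern r) (F m) (G m)) - \<Lambda> * L2_01_norm (F m) * L2_01_norm (G m))
    \<longlonglongrightarrow> cmod (kernel_form (kern r) f g) - \<Lambda> * L2_01_norm f * L2_01_norm g"
    by (intro tendsto_intros kernel_form_tendsto[OF Fm(1) Fd(1) Fl(1) fm(1) Fm(2) Fd(2) Fl(2) fm(2)]
        L2_01_norm_tendsto[OF Fm(1) fm(1) Fd(1) Fl(1)] L2_01_norm_tendsto[OF Fm(2) fm(2) Fd(2) Fl(2)])
  then have "eventually (\<lambda>m. 0 < cmod (kernel_form (kern r) (F m) (G m)) - \<Lambda> * L2_01_norm (F m) * L2_01_norm (G m)) sequentially"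
    by (rule order_tendstoD(1)) (use fg in simp)
  moreover have "0 < \<epsilon> / 2" using \<epsilon> by simp
  note tform_close[OF this]
  ultimately show ?thesis
    using eventually_gt_at_top[of 0]
  proof eventually_elim
    case (elim m)
    define n where "n = real (N * m)"
    define u where "u = lift r m (\<lambda>l. f (real l / real m))"
    define v where "v = lift r m (\<lambda>l. g (real l / real m))"
    define p where "p = L2_01_norm (F m) * L2_01_norm (G m)"
    have uv: "l2 (N * m) u = L2_01_norm (F m)" "l2 (N * m) v = L2_01_norm (G m)"
      unfolding u_def v_def F_def G_def by (rule l2_lift[OF r elim(3)])+
    have p0: "0 < p"
    proof -
      have "0 \<le> \<Lambda> * L2_01_norm (F m) * L2_01_norm (G m)" using \<Lambda>(1) by simp
      then have "0 < cmod (kernel_form (kern r) (F m) (G m))" using elim(1) by linarith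
      also have "\<dots> \<le> K * L2_01_norm (F m) * L2_01_norm (G m)"
        unfolding K_def by (intro kernel_form_le_op_norm Fm)
      finally have "0 < K * p" by (simp add: p_def mult.assoc)
      then show ?thesis using K by (simp add: zero_less_mult_iff)
    qed
    have mf: "cmod (main_form m u v) = n powr (2 * \<rho>) * (c * cmod (kernel_form (kern r) (F m) (G m)))"
      unfolding u_def v_def main_form_lift[OF r elim(3)] norm_mult norm_of_real_powr[OF of_nat_0_le_iff]
      by (simp add: F_def G_def c_def n_def Re_M[OF r])
    have "n powr (2 * \<rho>) * (c * (\<Lambda> * p)) \<le> cmod (main_form m u v)"
      unfolding mf using elim(1) c by (intro mult_left_mono) (auto simp: p_def mult.assoc)
    also have "\<dots> \<le> cmod (tform (N * m) u v) + cmod (tform (N * m) u v - main_form m u v)"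
      using norm_triangle_ineq4[of "tform (N * m) u v" "tform (N * m) u v - main_form m u v"] by simp
    also have "\<dots> \<le> tnorm (N * m) * p + \<epsilon> / 2 * n powr (2 * \<rho>) * p"
    proof (rule add_mono)
      show "cmod (tform (N * m) u v) \<le> tnorm (N * m) * p"
        using form_le_spectral_norm[of "N * m" "\<lambda>j k. fourier_coeff a (int j - int k)" u v]
        by (simp add: tform_def tnorm_eq uv p_def mult.assoc)
      show "cmod (tform (N * m) u v - main_form m u v) \<le> \<epsilon> / 2 * n powr (2 * \<rho>) * p"
        using elim(2)[rule_format, of u v] by (simp only: uv p_def n_def mult.assoc)
    qed
    finally have "(n powr (2 * \<rho>) * (c * \<Lambda>)) * p \<le> (tnorm (N * m) + \<epsilon> / 2 * n powr (2 * \<rho>)) * p"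
      by (simp add: algebra_simps)
    then have "n powr (2 * \<rho>) * (c * \<Lambda>) \<le> tnorm (N * m) + \<epsilon> / 2 * n powr (2 * \<rho>)"
      using p0 by (rule mult_right_le_imp_le)
    moreover have "n powr (2 * \<rho>) * (c * (K - \<delta>)) \<le> n powr (2 * \<rho>) * (c * \<Lambda>)"
      using c \<Lambda>(3) by (intro mult_left_mono) auto
    moreover have "c * (K - \<delta>) = limit_const - \<epsilon> / 2"
    proof -
      have "c * K = limit_const" by (simp add: L K_def c_def mult.commute)
      then show ?thesis by (simp only: right_diff_distrib \<delta>(2))
    qed
    ultimately have "n powr (2 * \<rho>) * (limit_const - \<epsilon> / 2) \<le> tnorm (N * m) + \<epsilon> / 2 * n powr (2 * \<rho>)" by simp
    then show ?case unfolding n_def[symmetric] by (simp add: algebra_simps)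
  qed
qed

lemma tnorm_asymptotics: "(\<lambda>n. tnorm n / real n powr (2 * \<rho>)) \<longlonglongrightarrow> limit_const"
proof (rule monotone_ratio_limit[OF _ N rho(1)])
  show "tnorm n \<le> tnorm n'" if "n \<le> n'" for n n'
    unfolding tnorm_eq by (rule spectral_norm_mono[OF that])
  show "(\<lambda>m. tnorm (N * m) / real (N * m) powr (2 * \<rho>)) \<longlonglongrightarrow> limit_const"
  proof (rule LIMSEQ_I)
    fix \<epsilon> :: real assume "0 < \<epsilon>"
    then have \<epsilon>: "0 < \<epsilon> / 2" by simp
    have "eventually (\<lambda>m. norm (tnorm (N * m) / real (N * m) powr (2 * \<rho>) - limit_const) < \<epsilon>) sequentially"
      using tnorm_upper[OF \<epsilon>] tnorm_lower[OF \<epsilon>] eventually_gt_at_top[of 0]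
    proof eventually_elim
      case (elim m)
      have n: "0 < real (N * m) powr (2 * \<rho>)" using elim(3) N by simp
      have "tnorm (N * m) / real (N * m) powr (2 * \<rho>) \<le> limit_const + \<epsilon> / 2"
        using elim(1) n by (simp only: divide_le_eq) simp
      moreover have "limit_const - \<epsilon> / 2 \<le> tnorm (N * m) / real (N * m) powr (2 * \<rho>)"
        using elim(2) n by (simp only: le_divide_eq if_True)
      ultimately show ?case using \<open>0 < \<epsilon>\<close> unfolding real_norm_def by linarith
    qed
    then show "\<exists>n0. \<forall>m\<ge>n0. norm (tnorm (N * m) / real (N * m) powr (2 * \<rho>) - limit_const) < \<epsilon>"
      by (simp only: eventually_sequentially)
  qed
qed

end

theorem theorem4p2:
  fixes R :: nat
    and t \<alpha> \<beta> :: "nat \<Rightarrow> complex"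
    and a b :: "complex \<Rightarrow> complex"
    and br :: "nat \<Rightarrow> complex \<Rightarrow> complex"
    and \<rho> :: real
    and M :: "nat set"
  assumes "R \<ge> 2"
    and "\<And>r. r \<in> {1..R} \<Longrightarrow> t r \<in> sphere 0 1"
    and "inj_on t {1..R}"
    and "\<And>r. r \<in> {1..R} \<Longrightarrow> 0 < Re (\<alpha> r) \<and> Re (\<alpha> r) < 1 / 2"
    and "\<And>r. r \<in> {1..R} \<Longrightarrow> - 1 / 2 < Re (\<beta> r) \<and> Re (\<beta> r) \<le> 1 / 2"
    and "b \<in> circle_Linf"
    and "\<And>r. r \<in> {1..R} \<Longrightarrow> continuous (at (t r) within sphere 0 1) b"
    and "\<And>r. r \<in> {1..R} \<Longrightarrow> b (t r) \<noteq> 0"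
    and "circle_AE (\<lambda>z. a z = b z * (\<Prod>r=1..R. fh_factor (\<alpha> r) (\<beta> r) (t r) z))"
    and "\<And>r. r \<in> {1..R} \<Longrightarrow> br r \<in> circle_Linf"
    and "\<And>r. r \<in> {1..R} \<Longrightarrow> continuous (at (t r) within sphere 0 1) (br r)"
    and "\<And>r. r \<in> {1..R} \<Longrightarrow> br r (t r) \<noteq> 0"
    and "circle_AE (\<lambda>z. a z = (\<Sum>r=1..R. fh_factor (\<alpha> r) (\<beta> r) (t r) z * br r z))"
    and "\<rho> = (MAX r\<in>{1..R}. Re (\<alpha> r))"
    and "M = {r \<in> {1..R}. Re (\<alpha> r) = \<rho>}"
    and "\<exists>t0 \<in> sphere 0 1. \<forall>r\<in>{1..R}. \<exists>\<phi>::rat. t r = exp (2 * of_real pi * \<i> * of_rat \<phi>) * t0"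
  shows "(\<lambda>n. spectral_norm (toeplitz n a) /
            ((MAX r\<in>M. L2_01_op_norm (integral_operator (fh_kernel (\<alpha> r) (\<beta> r))) * cmod (br r (t r)))
              * real n powr (2 * \<rho>))) \<longlonglongrightarrow> 1"
proof -
  have t1: "cmod (t r) = 1" if "r \<in> {1..R}" for r using assms(2)[OF that] by simp
  obtain t0 where t0: "t0 \<in> sphere 0 1" "\<forall>r\<in>{1..R}. \<exists>\<phi>::rat. t r = exp (2 * of_real pi * \<i> * of_rat \<phi>) * t0"
    using assms(16) by blast
  obtain N where N: "0 < N" "\<And>r. r \<in> {1..R} \<Longrightarrow> t r ^ N = t0 ^ N"
    using common_power[OF t0(2)] by blast
  interpret fh_sum R t \<alpha> \<beta> a br \<rho> M N
  proof
    show "(t r / t q) ^ N = 1" if "r \<in> {1..R}" "q \<in> {1..R}" for r q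
      using N(2)[OF that(1)] N(2)[OF that(2)] t0(1) by (auto simp: power_divide)
  qed (use assms t1 N in auto)
  have "(\<lambda>n. (tnorm n / real n powr (2 * \<rho>)) / limit_const) \<longlonglongrightarrow> limit_const / limit_const"
    by (intro tendsto_divide tnorm_asymptotics tendsto_const) (use limit_const_pos in simp)
  then show ?thesis
    using limit_const_pos by (simp add: tnorm_def limit_const_def kern_def divide_divide_eq_left mult.commute)
qed

end
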